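(* Let $1<p<\infty$ and let $u:M\times[a,b]\to\mathbb{R}$ be a smooth function with $u(\cdot,a)\not\equiv0$ which satisfies $$|u(x,t)|^{p-2}u_t(x,t)-\Delta_{f,p}u(x,t)=\eta(t)\,|u(x,t)|^{p-2}u(x,t)\quad\text{on } M\times[a,b],$$ where $\eta$ is a smooth function of $t\in[a,b]$. Then $$I_p(b)\ \ge\ I_p(a)\,e^{p\int_a^b\eta(t)\,dt+pU_p(a)(b-a)}.$$
   Context: $(M,g)$ is a closed (compact, without boundary) Riemannian manifold with Riemannian volume form $d\nu$, $f\in C^\infty(M)$ is a real-valued function, and $d\mu=e^{-f}d\nu$ is the weighted measure. The weighted $p$-Laplacian is $$\Delta_{f,p}u=\mathrm{div}_f(|\nabla u|^{p-2}\nabla u)=e^{f}\,\mathrm{div}(e^{-f}|\nabla u|^{p-2}\nabla u),$$ acting in the $M$-variable, where $|\nabla u|^{p-2}\nabla u$ and $|u|^{p-2}u$ are read as $0$ where $\nabla u=0$, respectively $u=0$. For a function $u$ on $M\times[a,b]$, $$D_p(t)=\int_M u\,\Delta_{f,p}u\,d\mu=-\int_M|\nabla u|^p\,d\mu,\qquad I_p(t)=\int_M|u|^p\,d\mu,\qquad U_p(t)=\frac{D_p(t)}{I_p(t)}.$$ *)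

theory Defs
  imports "HOL-Analysis.Analysis"
begin

section \<open>Smooth functions on subsets of a normed space\<close>

text \<open>
  Derivatives are taken within \<open>S\<close>, so that the notion also applies to sets \<open>V \<times> {a..b}\<close>
  with \<open>V\<close> open and \<open>a < b\<close> (one-sided derivatives at the two ends). It is only used for sets
  on which such derivatives are unique.
\<close>

primrec C_k_on :: "nat \<Rightarrow> 'a::real_normed_vector set \<Rightarrow> ('a \<Rightarrow> 'b::real_normed_vector) \<Rightarrow> bool"
where
  "C_k_on 0 S h \<longleftrightarrow> continuous_on S h"
| "C_k_on (Suc k) S h \<longleftrightarrow> (\<forall>x\<in>S. h differentiable (at x within S)) \<and>
     (\<forall>v. C_k_on k S (\<lambda>x. frechet_derivative h (at x within S) v))"

definition smooth_on :: "'a::real_normed_vector set \<Rightarrow> ('a \<Rightarrow> 'b::real_normed_vector) \<Rightarrow> bool"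
  where "smooth_on S h \<longleftrightarrow> (\<forall>k. C_k_on k S h)"


section \<open>Closed Riemannian manifolds\<close>

text \<open>
  The manifold is the whole type \<open>'a\<close>. A chart is a pair of its domain and its coordinate map;
  the values of the coordinate map outside the domain are irrelevant.
\<close>

type_synonym ('a, 'n) chart = "'a set \<times> ('a \<Rightarrow> real ^ 'n)"

abbreviation dom_chart :: "('a, 'n) chart \<Rightarrow> 'a set"
  where "dom_chart c \<equiv> fst c"

abbreviation coord :: "('a, 'n) chart \<Rightarrow> 'a \<Rightarrow> real ^ 'n"
  where "coord c \<equiv> snd c"

abbreviation codom_chart :: "('a, 'n) chart \<Rightarrow> (real ^ 'n) set"
  where "codom_chart c \<equiv> coord c ` dom_chart c"

abbreviation param :: "('a, 'n) chart \<Rightarrow> real ^ 'n \<Rightarrow> 'a"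
  where "param c \<equiv> inv_into (dom_chart c) (coord c)"

definition smooth_atlas :: "('a::topological_space, 'n::finite) chart set \<Rightarrow> bool" where
  "smooth_atlas A \<longleftrightarrow>
     (\<Union>c\<in>A. dom_chart c) = UNIV \<and>
     (\<forall>c\<in>A. open (dom_chart c) \<and> open (codom_chart c) \<and>
        homeomorphism (dom_chart c) (codom_chart c) (coord c) (param c)) \<and>
     (\<forall>c\<in>A. \<forall>d\<in>A. smooth_on (coord c ` (dom_chart c \<inter> dom_chart d)) (coord d \<circ> param c))"

text \<open>
  A metric is given by its Gram matrices \<open>G c x\<close> in the coordinate frame of each chart \<open>c\<close>
  at each point \<open>x\<close> of its domain; the last clause is the transformation law of a covariant
  2-tensor.
\<close>

definition riemannian_metric ::
  "('a, 'n::finite) chart set \<Rightarrow> (('a, 'n) chart \<Rightarrow> 'a \<Rightarrow> real ^ 'n ^ 'n) \<Rightarrow> bool" where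
  "riemannian_metric A G \<longleftrightarrow>
     (\<forall>c\<in>A. smooth_on (codom_chart c) (\<lambda>y. G c (param c y))) \<and>
     (\<forall>c\<in>A. \<forall>x\<in>dom_chart c. transpose (G c x) = G c x \<and> (\<forall>v. v \<noteq> 0 \<longrightarrow> 0 < v \<bullet> (G c x *v v))) \<and>
     (\<forall>c\<in>A. \<forall>d\<in>A. \<forall>x\<in>dom_chart c \<inter> dom_chart d.
        let J = matrix (frechet_derivative (coord d \<circ> param c) (at (coord c x)))
        in G c x = transpose J ** G d x ** J)"

locale closed_riemannian_manifold =
  fixes A :: "('a::{t2_space, second_countable_topology}, 'n::finite) chart set"
    and G :: "('a, 'n) chart \<Rightarrow> 'a \<Rightarrow> real ^ 'n ^ 'n"
  assumes compact: "compact (UNIV :: 'a set)"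
    and atlas: "smooth_atlas A"
    and metric: "riemannian_metric A G"

definition smooth_fun :: "('a, 'n::finite) chart set \<Rightarrow> ('a \<Rightarrow> real) \<Rightarrow> bool" where
  "smooth_fun A h \<longleftrightarrow> (\<forall>c\<in>A. smooth_on (codom_chart c) (h \<circ> param c))"

definition smooth_fun_time ::
  "('a, 'n::finite) chart set \<Rightarrow> real set \<Rightarrow> ('a \<Rightarrow> real \<Rightarrow> real) \<Rightarrow> bool" where
  "smooth_fun_time A T u \<longleftrightarrow>
     (\<forall>c\<in>A. smooth_on (codom_chart c \<times> T) (\<lambda>(y, t). u (param c y) t))"


section \<open>Volume, gradient and divergence\<close>

definition vol_density :: "(('a, 'n::finite) chart \<Rightarrow> 'a \<Rightarrow> real ^ 'n ^ 'n) \<Rightarrow> ('a, 'n) chart \<Rightarrow> 'a \<Rightarrow> real"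
  where "vol_density G c x = sqrt (det (G c x))"

text \<open>The Riemannian volume is the Borel measure equal to \<open>\<surd>(det G) dy\<close> in every chart.\<close>

definition riemannian_volume ::
  "('a::topological_space, 'n::finite) chart set \<Rightarrow> (('a, 'n) chart \<Rightarrow> 'a \<Rightarrow> real ^ 'n ^ 'n) \<Rightarrow> 'a measure"
where
  "riemannian_volume A G = (THE \<nu>. sets \<nu> = sets borel \<and>
     (\<forall>c\<in>A. \<forall>B\<in>sets borel. B \<subseteq> dom_chart c \<longrightarrow>
        emeasure \<nu> B = (\<integral>\<^sup>+y\<in>coord c ` B. ennreal (vol_density G c (param c y)) \<partial>lborel)))"

definition weighted_volume ::
  "('a::topological_space, 'n::finite) chart set \<Rightarrow> (('a, 'n) chart \<Rightarrow> 'a \<Rightarrow> real ^ 'n ^ 'n) \<Rightarrow>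
     ('a \<Rightarrow> real) \<Rightarrow> 'a measure" where
  "weighted_volume A G f = density (riemannian_volume A G) (\<lambda>x. ennreal (exp (- f x)))"

text \<open>
  A vector field \<open>X\<close> is given by its components \<open>X c x\<close> in each chart \<open>c\<close>.
\<close>

definition grad :: "(('a, 'n::finite) chart \<Rightarrow> 'a \<Rightarrow> real ^ 'n ^ 'n) \<Rightarrow> ('a \<Rightarrow> real) \<Rightarrow>
    ('a, 'n) chart \<Rightarrow> 'a \<Rightarrow> real ^ 'n" where
  "grad G h c x = matrix_inv (G c x) *v
     (\<chi> i. frechet_derivative (h \<circ> param c) (at (coord c x)) (axis i 1))"

definition metric_norm :: "(('a, 'n::finite) chart \<Rightarrow> 'a \<Rightarrow> real ^ 'n ^ 'n) \<Rightarrow>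
    ('a, 'n) chart \<Rightarrow> 'a \<Rightarrow> real ^ 'n \<Rightarrow> real" where
  "metric_norm G c x v = sqrt (v \<bullet> (G c x *v v))"

text \<open>
  \<open>has_div A G X x l\<close>: in the coordinates of every chart around \<open>x\<close>, the field \<open>X\<close> is
  differentiable at \<open>x\<close> and its divergence
  \<open>(1 / \<surd>(det G)) \<Sum>i. \<partial>\<^sub>i (\<surd>(det G) X\<^sup>i)\<close> there is \<open>l\<close>.
  For fields obeying the transformation law of vectors neither the differentiability nor the
  value depends on the chart.
\<close>

definition has_div :: "('a, 'n::finite) chart set \<Rightarrow> (('a, 'n) chart \<Rightarrow> 'a \<Rightarrow> real ^ 'n ^ 'n) \<Rightarrow>
    (('a, 'n) chart \<Rightarrow> 'a \<Rightarrow> real ^ 'n) \<Rightarrow> 'a \<Rightarrow> real \<Rightarrow> bool" where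
  "has_div A G X x l \<longleftrightarrow> (\<forall>c\<in>A. x \<in> dom_chart c \<longrightarrow>
     (\<exists>D. ((\<lambda>y. vol_density G c (param c y) *\<^sub>R X c (param c y)) has_derivative D) (at (coord c x)) \<and>
          l = (\<Sum>i\<in>UNIV. D (axis i 1) $ i) / vol_density G c x))"

definition divergence :: "('a, 'n::finite) chart set \<Rightarrow> (('a, 'n) chart \<Rightarrow> 'a \<Rightarrow> real ^ 'n ^ 'n) \<Rightarrow>
    (('a, 'n) chart \<Rightarrow> 'a \<Rightarrow> real ^ 'n) \<Rightarrow> 'a \<Rightarrow> real" where
  "divergence A G X x = (THE l. has_div A G X x l)"


section \<open>The weighted p-Laplacian\<close>

text \<open>
  The field \<open>e\<^sup>-\<^sup>f |\<nabla>h|\<^sup>p\<^sup>-\<^sup>2 \<nabla>h\<close>; it vanishes where \<open>\<nabla>h = 0\<close>, whatever \<open>powr\<close> returns there.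
\<close>

definition weighted_flux :: "(('a, 'n::finite) chart \<Rightarrow> 'a \<Rightarrow> real ^ 'n ^ 'n) \<Rightarrow> ('a \<Rightarrow> real) \<Rightarrow> real \<Rightarrow>
    ('a \<Rightarrow> real) \<Rightarrow> ('a, 'n) chart \<Rightarrow> 'a \<Rightarrow> real ^ 'n" where
  "weighted_flux G f p h c x =
     (exp (- f x) * metric_norm G c x (grad G h c x) powr (p - 2)) *\<^sub>R grad G h c x"

definition p_laplacian_exists ::
  "('a, 'n::finite) chart set \<Rightarrow> (('a, 'n) chart \<Rightarrow> 'a \<Rightarrow> real ^ 'n ^ 'n) \<Rightarrow>
     ('a \<Rightarrow> real) \<Rightarrow> real \<Rightarrow> ('a \<Rightarrow> real) \<Rightarrow> 'a \<Rightarrow> bool" where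
  "p_laplacian_exists A G f p h x \<longleftrightarrow> (\<exists>l. has_div A G (weighted_flux G f p h) x l)"

definition p_laplacian ::
  "('a, 'n::finite) chart set \<Rightarrow> (('a, 'n) chart \<Rightarrow> 'a \<Rightarrow> real ^ 'n ^ 'n) \<Rightarrow>
     ('a \<Rightarrow> real) \<Rightarrow> real \<Rightarrow> ('a \<Rightarrow> real) \<Rightarrow> 'a \<Rightarrow> real" where
  "p_laplacian A G f p h x = exp (f x) * divergence A G (weighted_flux G f p h) x"

text \<open>
  The power \<open>|r|\<^sup>q\<close> with \<open>|0|\<^sup>0 = 1\<close>, whereas \<open>0 powr 0 = 0\<close>. Its value at \<open>r = 0\<close>, \<open>q < 0\<close> is
  meaningless.
\<close>

definition abs_powr :: "real \<Rightarrow> real \<Rightarrow> real"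
  where "abs_powr r q = (if q = 0 then 1 else \<bar>r\<bar> powr q)"

text \<open>
  The equation \<open>|u|\<^sup>p\<^sup>-\<^sup>2 u\<^sub>t - \<Delta>\<^sub>f\<^sub>,\<^sub>p u = \<eta> |u|\<^sup>p\<^sup>-\<^sup>2 u\<close> on \<open>M \<times> [a,b]\<close>, pointwise, with \<open>\<Delta>\<^sub>f\<^sub>,\<^sub>p u\<close>
  existing at every point. If \<open>p < 2\<close> then \<open>|u|\<^sup>p\<^sup>-\<^sup>2 u\<^sub>t\<close> is undefined where \<open>u = 0\<close>, and
  nothing but the existence of \<open>\<Delta>\<^sub>f\<^sub>,\<^sub>p u\<close> is required at such points; every way of giving the
  equation a meaning there is a stronger requirement.
\<close>

definition solves_p_equation ::
  "('a, 'n::finite) chart set \<Rightarrow> (('a, 'n) chart \<Rightarrow> 'a \<Rightarrow> real ^ 'n ^ 'n) \<Rightarrow>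
     ('a \<Rightarrow> real) \<Rightarrow> real \<Rightarrow> (real \<Rightarrow> real) \<Rightarrow> real \<Rightarrow> real \<Rightarrow> ('a \<Rightarrow> real \<Rightarrow> real) \<Rightarrow> bool" where
  "solves_p_equation A G f p \<eta> a b u \<longleftrightarrow> (\<forall>x. \<forall>t\<in>{a..b}.
     p_laplacian_exists A G f p (\<lambda>z. u z t) x \<and>
     (p \<ge> 2 \<or> u x t \<noteq> 0 \<longrightarrow>
        abs_powr (u x t) (p - 2) * vector_derivative (u x) (at t within {a..b})
          - p_laplacian A G f p (\<lambda>z. u z t) x
        = \<eta> t * (abs_powr (u x t) (p - 2) * u x t)))"


section \<open>The functionals\<close>

definition D_p :: "('a::topological_space, 'n::finite) chart set \<Rightarrow> (('a, 'n) chart \<Rightarrow> 'a \<Rightarrow> real ^ 'n ^ 'n) \<Rightarrow>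
    ('a \<Rightarrow> real) \<Rightarrow> real \<Rightarrow> ('a \<Rightarrow> real \<Rightarrow> real) \<Rightarrow> real \<Rightarrow> real" where
  "D_p A G f p u t =
     (LINT x|weighted_volume A G f. u x t * p_laplacian A G f p (\<lambda>z. u z t) x)"

definition I_p :: "('a::topological_space, 'n::finite) chart set \<Rightarrow> (('a, 'n) chart \<Rightarrow> 'a \<Rightarrow> real ^ 'n ^ 'n) \<Rightarrow>
    ('a \<Rightarrow> real) \<Rightarrow> real \<Rightarrow> ('a \<Rightarrow> real \<Rightarrow> real) \<Rightarrow> real \<Rightarrow> real" where
  "I_p A G f p u t = (LINT x|weighted_volume A G f. \<bar>u x t\<bar> powr p)"

definition U_p :: "('a::topological_space, 'n::finite) chart set \<Rightarrow> (('a, 'n) chart \<Rightarrow> 'a \<Rightarrow> real ^ 'n ^ 'n) \<Rightarrow>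
    ('a \<Rightarrow> real) \<Rightarrow> real \<Rightarrow> ('a \<Rightarrow> real \<Rightarrow> real) \<Rightarrow> real \<Rightarrow> real" where
  "U_p A G f p u t = D_p A G f p u t / I_p A G f p u t"

end

theory Submission
  imports Defs
begin

text \<open>
  Let \<open>F = exp (- f) |grad u|^(p-2) grad u\<close>, so that \<open>exp f * div F\<close> is the weighted p-Laplacian of
  \<open>u\<close>, and let \<open>I t\<close> and \<open>E t\<close> be the integrals of \<open>|u|^p\<close> and \<open>|grad u|^p\<close> against the weighted
  measure. With \<open>w = u_t - \<eta> u\<close> the equation says that the p-Laplacian of \<open>u\<close> is \<open>|u|^(p-2) w\<close>.
  Integrating by parts against \<open>u\<close> gives \<open>D_p = - E\<close>, hence \<open>I' = p (\<eta> I - E)\<close>. Integrating by parts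
  against \<open>u_t - (\<eta> + 2 \<kappa>) u = w - 2 \<kappa> u\<close>, with a real number \<open>\<kappa>\<close>, gives
  \<open>(\<eta> + 2 \<kappa>) E - E' / p\<close> as the integral of \<open>|u|^(p-2) (w^2 - 2 \<kappa> u w)\<close>, and this is at least
  \<open>- \<kappa>^2 I\<close> because \<open>(w - \<kappa> u)^2\<close> is nonnegative. The choice \<open>\<kappa> = - E / I\<close> turns this into
  \<open>E' \<le> p (\<eta> E - E^2 / I)\<close>, which says that \<open>E / I\<close> does not increase. Therefore
  \<open>(ln I)' = p (\<eta> - E / I)\<close> is at least \<open>p (\<eta> + U_p(a))\<close>, and integration yields the claim; the same
  bound keeps \<open>I\<close> away from 0 (\<open>ode_comparison\<close>).

  The integrations by parts are the difficulty. For \<open>p < 2\<close> the field \<open>F\<close> is merely differentiable at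
  every point, with a divergence that may be unbounded near the zeros of \<open>u\<close>, and at the zeros
  themselves the equation gives no value for it. Two facts overcome this.

  First, an inequality suffices in the second integration by parts, and it follows from a one-sided
  bound: if \<open>v * div F \<ge> g\<close> everywhere with \<open>g\<close> continuous, then the integral of \<open>g + dv(F)\<close> is at
  most 0 (\<open>divergence_inequality\<close>). On cubes this is Goursat's bisection argument
  (\<open>box_flux_ge_integral\<close>), and a partition of unity carries it to the manifold. The test function
  above is chosen so that the lower bound \<open>g = - \<kappa>^2 exp (- f) |u|^p\<close> is continuous.

  Second, \<open>w * div F \<ge> 0\<close> also holds where \<open>u = 0\<close> (\<open>divergence_sign_at_zero\<close>). If
  \<open>div F \<noteq> 0\<close> at a zero \<open>z\<close> of \<open>u\<close>, then \<open>u\<close> has no zero in a truncated cone with vertex \<open>z\<close>,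
  because \<open>F\<close> is to first order a linear field of nonzero trace (or is nonzero at \<open>z\<close>), and \<open>F\<close>
  points along the gradient of \<open>u\<close>. Cubes in this cone that shrink to \<open>z\<close> at the rate of their
  distance from \<open>z\<close> have a flux of the sign of \<open>w\<close>, and differentiability at \<open>z\<close> passes this sign on
  to \<open>div F\<close> at \<open>z\<close>.

  What remains is the Riemannian volume: it exists because the volume densities of two charts differ
  by the Jacobian of the transition map (\<open>chart_measure_agree\<close>), and it is unique and finite by
  compactness.
\<close>

section \<open>The divergence theorem on cubes as an inequality\<close>

definition set_coord :: "real ^ 'n \<Rightarrow> 'n \<Rightarrow> real \<Rightarrow> real ^ 'n" where
  "set_coord y i s = (\<chi> j. if j = i then s else y $ j)"

text \<open>
  The flux of \<open>Y\<close> out of the box. A face integral appears as the integral over the whole box of a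
  function that does not depend on the \<open>i\<close>-th coordinate, divided by the length of the \<open>i\<close>-th edge, so
  that all integrals are over boxes of full dimension.
\<close>

definition box_flux :: "(real ^ 'n::finite \<Rightarrow> real ^ 'n) \<Rightarrow> real ^ 'n \<Rightarrow> real ^ 'n \<Rightarrow> real" where
  "box_flux Y c d = (\<Sum>i\<in>UNIV. integral (cbox c d)
     (\<lambda>y. Y (set_coord y i (d $ i)) $ i - Y (set_coord y i (c $ i)) $ i) / (d $ i - c $ i))"

lemma set_coord_nth [simp]: "set_coord y i s $ j = (if j = i then s else y $ j)"
  by (simp add: set_coord_def)

lemma set_coord_in_cbox:
  fixes c d :: "real ^ 'n::finite"
  assumes "y \<in> cbox c d" "c $ i \<le> s" "s \<le> d $ i"
  shows "set_coord y i s \<in> cbox c d"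
  using assms by (auto simp: mem_box_cart)

lemma continuous_on_set_coord [continuous_intros]:
  fixes S :: "(real ^ 'n::finite) set"
  shows "continuous_on S (\<lambda>y. set_coord y i s)"
proof -
  have "continuous_on S (\<lambda>y. \<chi> j. if j = i then s else y $ j)"
  proof (intro continuous_on_vec_lambda)
    show "continuous_on S (\<lambda>y. if j = i then s else y $ j)" for j
      by (cases "j = i") (auto intro!: continuous_intros)
  qed
  then show ?thesis by (simp add: set_coord_def[abs_def])
qed

lemma continuous_on_face:
  fixes c d :: "real ^ 'n::finite"
  assumes "continuous_on (cbox c d) Y" "c $ i \<le> s" "s \<le> d $ i"
  shows "continuous_on (cbox c d) (\<lambda>y. Y (set_coord y i s) $ i)"
  by (intro continuous_intros continuous_on_compose2[OF assms(1)])
     (use assms set_coord_in_cbox in auto)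

lemma cbox_split_coord:
  fixes c d :: "real ^ 'n::finite"
  assumes "c $ j \<le> m" "m \<le> d $ j"
  shows "cbox c d \<inter> {x. x \<bullet> axis j 1 \<le> m} = cbox c (set_coord d j m)"
    and "cbox c d \<inter> {x. x \<bullet> axis j 1 \<ge> m} = cbox (set_coord c j m) d"
  using assms by (auto simp: mem_box_cart inner_axis split: if_splits) (force)+

lemma integral_split_coord:
  fixes c d :: "real ^ 'n::finite" and f :: "real ^ 'n \<Rightarrow> real"
  assumes "f integrable_on cbox c d" "c $ j \<le> m" "m \<le> d $ j"
  shows "integral (cbox c d) f =
    integral (cbox c (set_coord d j m)) f + integral (cbox (set_coord c j m) d) f"
  using integral_split[OF assms(1), of "axis j 1" m] cbox_split_coord[OF assms(2,3)]
  by (simp add: axis_in_Basis_iff)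

text \<open>
  The integrand does not depend on coordinate \<open>j\<close>, and a translation along that axis maps one half of
  the box onto the other.
\<close>

lemma integral_halves_eq:
  fixes c d :: "real ^ 'n::finite" and f :: "real ^ 'n \<Rightarrow> real"
  assumes m: "m = (c $ j + d $ j) / 2"
  shows "integral (cbox c (set_coord d j m)) (\<lambda>y. f (set_coord y j s)) =
         integral (cbox (set_coord c j m) d) (\<lambda>y. f (set_coord y j s))"
proof -
  let ?v = "axis j (m - c $ j) :: real ^ 'n"
  have 1: "c + ?v = set_coord c j m" "set_coord d j m + ?v = d"
    using m by (auto simp: vec_eq_iff axis_def field_simps)
  have "set_coord (?v + y) j s = set_coord y j s" for y :: "real ^ 'n"
    by (auto simp: vec_eq_iff axis_def)
  then have 2: "(\<lambda>y. f (set_coord y j s)) \<circ> (+) ?v = (\<lambda>y. f (set_coord y j s))"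
    by (simp add: o_def)
  show ?thesis
    using integral_shift_cbox_plus[of c "set_coord d j m" "\<lambda>y. f (set_coord y j s)" ?v]
    unfolding 1 2 by simp
qed

text \<open>
  In direction \<open>j\<close> the fluxes through the common face cancel, and for the two outer faces the integral
  over half the box is divided by half the edge length. In the other directions the integrals over the two
  halves add up.
\<close>

lemma box_flux_split:
  fixes c d :: "real ^ 'n::finite"
  assumes Y: "continuous_on (cbox c d) Y" and cd: "\<And>i. c $ i < d $ i"
    and m: "m = (c $ j + d $ j) / 2"
  shows "box_flux Y c d = box_flux Y c (set_coord d j m) + box_flux Y (set_coord c j m) d"
proof -
  let ?d = "set_coord d j m" and ?c = "set_coord c j m"
  have cm: "c $ j < m" "m < d $ j" using cd[of j] m by auto
  define T where "T c d i = integral (cbox c d)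
     (\<lambda>y. Y (set_coord y i (d $ i)) $ i - Y (set_coord y i (c $ i)) $ i) / (d $ i - c $ i)"
    for c d :: "real ^ 'n" and i
  have "T c d i = T c ?d i + T ?c d i" for i
  proof -
    define F where "F s = (\<lambda>y. Y (set_coord y i s) $ i)" for s
    have cont: "continuous_on (cbox c d) (F s)" if "c $ i \<le> s" "s \<le> d $ i" for s
      unfolding F_def by (rule continuous_on_face[OF Y that])
    have sub: "cbox c ?d \<subseteq> cbox c d" "cbox ?c d \<subseteq> cbox c d"
      using cbox_split_coord[of c j m d] cm by auto
    note int = integrable_continuous[OF cont] integrable_continuous[OF continuous_on_subset[OF cont sub(1)]]
      integrable_continuous[OF continuous_on_subset[OF cont sub(2)]]
    have ci: "c $ i \<le> d $ i" using cd[of i] by simp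
    show ?thesis
    proof (cases "i = j")
      case False
      have "integral (cbox c d) (\<lambda>y. F (d $ i) y - F (c $ i) y) =
            integral (cbox c ?d) (\<lambda>y. F (d $ i) y - F (c $ i) y)
          + integral (cbox ?c d) (\<lambda>y. F (d $ i) y - F (c $ i) y)"
        by (rule integral_split_coord) (use cm ci in \<open>auto intro!: integrable_diff int\<close>)
      then show ?thesis
        using False by (simp add: T_def F_def add_divide_distrib)
    next
      case True
      have half: "integral (cbox c ?d) (F s) = integral (cbox ?c d) (F s)" for s
        unfolding F_def True by (rule integral_halves_eq[OF m, of "\<lambda>z. Y z $ j"])
      have spl: "integral (cbox c d) (F s) = 2 * integral (cbox c ?d) (F s)"
        if "c $ i \<le> s" "s \<le> d $ i" for s
        using integral_split_coord[OF int(1)[OF that], of j m] cm half[of s] by simp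
      have A: "integral (cbox c d) (\<lambda>y. F (d $ i) y - F (c $ i) y)
          = 2 * (integral (cbox c ?d) (F (d $ i)) - integral (cbox c ?d) (F (c $ i)))"
        by (subst integral_diff) (use ci in \<open>auto intro!: int simp: spl\<close>)
      have B: "integral (cbox c ?d) (\<lambda>y. F m y - F (c $ i) y)
          = integral (cbox c ?d) (F m) - integral (cbox c ?d) (F (c $ i))"
        by (rule integral_diff) (use True cm ci in \<open>auto intro!: int\<close>)
      have C: "integral (cbox ?c d) (\<lambda>y. F (d $ i) y - F m y)
          = integral (cbox c ?d) (F (d $ i)) - integral (cbox c ?d) (F m)"
        unfolding half by (rule integral_diff) (use True cm ci in \<open>auto intro!: int\<close>)
      have D: "m - c $ i = (d $ i - c $ i) / 2" "d $ i - m = (d $ i - c $ i) / 2"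
        using m True by (auto simp: field_simps)
      show ?thesis
      proof -
        have "T c d i = integral (cbox c d) (\<lambda>y. F (d $ i) y - F (c $ i) y) / (d $ i - c $ i)"
          by (simp add: T_def F_def)
        moreover have "T c ?d i = integral (cbox c ?d) (\<lambda>y. F m y - F (c $ i) y) / ((d $ i - c $ i) / 2)"
          unfolding D(1)[symmetric] using True by (simp add: T_def F_def)
        moreover have "T ?c d i = integral (cbox ?c d) (\<lambda>y. F (d $ i) y - F m y) / ((d $ i - c $ i) / 2)"
          unfolding D(2)[symmetric] using True by (simp add: T_def F_def)
        ultimately show ?thesis
          unfolding A B C using cd[of i] by (simp add: add_divide_distrib[symmetric])
      qed
    qed
  qed
  then show ?thesis by (simp add: box_flux_def T_def sum.distrib)
qed

abbreviation cube :: "real ^ 'n::finite \<Rightarrow> real \<Rightarrow> (real ^ 'n) set" where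
  "cube c s \<equiv> cbox c (c + vec s)"

lemma norm_le_cube:
  fixes x y :: "real ^ 'n::finite"
  assumes "x \<in> cube c s" "y \<in> cube c s"
  shows "norm (x - y) \<le> real CARD('n) * s"
proof -
  have "norm (x - y) \<le> (\<Sum>i\<in>UNIV. \<bar>(x - y) $ i\<bar>)" by (rule norm_le_l1_cart)
  also have "\<dots> \<le> (\<Sum>i\<in>(UNIV::'n set). s)"
  proof (rule sum_mono)
    fix i :: 'n
    have "c $ i \<le> x $ i \<and> x $ i \<le> c $ i + s" "c $ i \<le> y $ i \<and> y $ i \<le> c $ i + s"
      using assms by (auto simp: mem_box_cart)
    then show "\<bar>(x - y) $ i\<bar> \<le> s" by auto
  qed
  finally show ?thesis by simp
qed

lemma content_cube:
  fixes c :: "real ^ 'n::finite"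
  assumes "0 \<le> s"
  shows "measure lborel (cube c s) = s ^ CARD('n)"
proof -
  have "cube c s \<noteq> {}" using assms by (auto simp: interval_ne_empty_cart)
  then show ?thesis by (simp add: content_cbox_cart)
qed

text \<open>
  Up to an error \<open>o(s)\<close> the field is affine on a cube of edge \<open>s\<close> whose points are at distance
  \<open>O(s)\<close> from \<open>z\<close>, and the flux of an affine field is its trace times the volume. The bound \<open>K * s\<close> on
  the distance is why the bisection below has to produce cubes and not boxes of arbitrary shape.
\<close>

lemma box_flux_at_differentiable:
  fixes Y :: "real ^ 'n::finite \<Rightarrow> real ^ 'n"
  assumes L: "(Y has_derivative L) (at z)" and e: "0 < e" and K: "0 \<le> K"
  shows "\<exists>\<delta>>0. \<forall>c s. 0 < s \<longrightarrow> s < \<delta> \<longrightarrow> continuous_on (cube c s) Y \<longrightarrow>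
       (\<forall>y\<in>cube c s. norm (y - z) \<le> K * s) \<longrightarrow>
       \<bar>box_flux Y c (c + vec s) - (\<Sum>i\<in>UNIV. L (axis i 1) $ i) * s ^ CARD('n)\<bar> \<le> e * s ^ CARD('n)"
proof -
  define N where "N = real CARD('n)"
  have N: "0 < N" by (simp add: N_def)
  define e' where "e' = e / (2 * N * (K + 1))"
  have e': "0 < e'" using e K N by (simp add: e'_def)
  obtain r where r: "0 < r" "\<And>y. norm (y - z) < r \<Longrightarrow> norm (Y y - Y z - L (y - z)) \<le> e' * norm (y - z)"
    using L e' unfolding has_derivative_at_alt by blast
  have lin: "linear L" using L by (rule has_derivative_linear)
  show ?thesis
  proof (intro exI[of _ "r / (K + 1)"] conjI allI impI)
    show "0 < r / (K + 1)" using r K by simp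
    fix c s assume s: "0 < s" "s < r / (K + 1)" and Y: "continuous_on (cube c s) Y"
      and near': "\<forall>y\<in>cube c s. norm (y - z) \<le> K * s"
    note near = bspec[OF near']
    let ?d = "c + vec s" and ?V = "s ^ CARD('n)"
    have "(K + 1) * s < r" using s K by (simp add: field_simps)
    then have Ksr: "K * s < r" using s(1) by (simp add: field_simps)
    have "\<bar>integral (cube c s) (\<lambda>y. Y (set_coord y i (?d $ i)) $ i - Y (set_coord y i (c $ i)) $ i) / (?d $ i - c $ i)
       - L (axis i 1) $ i * ?V\<bar> \<le> 2 * e' * K * ?V" for i
    proof -
      define f where "f y = Y (set_coord y i (?d $ i)) $ i - Y (set_coord y i (c $ i)) $ i" for y
      have fi: "f integrable_on cube c s"
        unfolding f_def by (intro integrable_continuous continuous_on_diff continuous_on_face Y) (use s in auto)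
      have pt: "\<bar>f y - s * L (axis i 1) $ i\<bar> \<le> 2 * e' * K * s" if y: "y \<in> cube c s" for y
      proof -
        let ?a = "set_coord y i (?d $ i)" and ?b = "set_coord y i (c $ i)"
        have ab: "?a \<in> cube c s" "?b \<in> cube c s" using y s by (auto intro!: set_coord_in_cbox)
        have err: "\<bar>(Y q - Y z - L (q - z)) $ i\<bar> \<le> e' * K * s" if "q \<in> cube c s" for q
        proof -
          have "\<bar>(Y q - Y z - L (q - z)) $ i\<bar> \<le> norm (Y q - Y z - L (q - z))"
            by (rule component_le_norm_cart)
          also have "\<dots> \<le> e' * norm (q - z)" using near[OF that] Ksr by (intro r(2)) auto
          also have "\<dots> \<le> e' * (K * s)" using near[OF that] e' by (intro mult_left_mono) auto
          finally show ?thesis by (simp add: mult.assoc)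
        qed
        have "?a - ?b = s *\<^sub>R axis i 1" by (auto simp: vec_eq_iff axis_def)
        then have "L (?a - z) - L (?b - z) = s *\<^sub>R L (axis i 1)"
          using linear_diff[OF lin, of "?a - z" "?b - z"] linear_cmul[OF lin, of s "axis i 1"] by simp
        then have "(L (?a - z) - L (?b - z)) $ i = s * L (axis i 1) $ i" by simp
        then have "f y - s * L (axis i 1) $ i = (Y ?a - Y z - L (?a - z)) $ i - (Y ?b - Y z - L (?b - z)) $ i"
          by (simp add: f_def)
        then show ?thesis using err[OF ab(1)] err[OF ab(2)] by linarith
      qed
      have "integral (cube c s) (\<lambda>y. f y - s * L (axis i 1) $ i)
          = integral (cube c s) f - s * L (axis i 1) $ i * ?V"
        using fi s by (subst integral_diff) (auto simp: content_cube)
      moreover have "norm (integral (cube c s) (\<lambda>y. f y - s * L (axis i 1) $ i)) \<le> (2 * e' * K * s) * measure lborel (cube c s)"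
      proof (rule integrable_bound)
        show "0 \<le> 2 * e' * K * s" using e' K s by simp
        show "(\<lambda>y. f y - s * L (axis i 1) $ i) integrable_on cube c s" using fi by (intro integrable_diff) auto
      qed (use pt in simp)
      ultimately have "\<bar>integral (cube c s) f - s * L (axis i 1) $ i * ?V\<bar> \<le> 2 * e' * K * s * ?V"
        using s by (simp add: content_cube)
      moreover have "integral (cube c s) f / s - L (axis i 1) $ i * ?V
         = (integral (cube c s) f - s * L (axis i 1) $ i * ?V) / s"
        using s by (simp add: field_simps)
      ultimately have "\<bar>integral (cube c s) f / s - L (axis i 1) $ i * ?V\<bar> \<le> 2 * e' * K * ?V"
        using s by (simp add: abs_divide field_simps)
      then show ?thesis by (simp add: f_def[abs_def])
    qed
    then have "\<bar>box_flux Y c ?d - (\<Sum>i\<in>UNIV. L (axis i 1) $ i) * ?V\<bar> \<le> (\<Sum>i\<in>(UNIV::'n set). 2 * e' * K * ?V)"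
      unfolding box_flux_def sum_distrib_right sum_subtractf[symmetric]
      by (intro order_trans[OF sum_abs] sum_mono) auto
    also have "\<dots> = 2 * N * K * e' * ?V" by (simp add: N_def)
    also have "\<dots> = (e * (K / (K + 1))) * ?V"
    proof -
      have "e' * (2 * N * (K + 1)) = e" using N K by (simp add: e'_def)
      then have "2 * N * K * e' = e * (K / (K + 1))" using K by (auto simp: field_simps)
      then show ?thesis by simp
    qed
    also have "\<dots> \<le> e * 1 * ?V"
      using e K s by (intro mult_right_mono mult_left_mono) auto
    finally show "\<bar>box_flux Y c ?d - (\<Sum>i\<in>UNIV. L (axis i 1) $ i) * ?V\<bar> \<le> e * ?V" by simp
  qed
qed

text \<open>
  The coordinates are halved one after the other, by induction on the set of those already halved; by
  additivity one of the two pieces keeps a negative value.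
\<close>

lemma box_bisection:
  fixes \<Psi> :: "real ^ 'n::finite \<Rightarrow> real ^ 'n \<Rightarrow> real"
  assumes add: "\<And>c d j m. cbox c d \<subseteq> Q \<Longrightarrow> (\<And>i. c $ i < d $ i) \<Longrightarrow> m = (c $ j + d $ j) / 2 \<Longrightarrow>
      \<Psi> c d = \<Psi> c (set_coord d j m) + \<Psi> (set_coord c j m) d"
    and neg: "\<Psi> c (c + vec s) < 0" and s: "0 < s" and Q: "cube c s \<subseteq> Q"
  obtains c' where "cube c' (s / 2) \<subseteq> cube c s" "\<Psi> c' (c' + vec (s / 2)) < 0"
proof -
  define w where "w T = (\<chi> i. if i \<in> T then s / 2 else s)" for T :: "'n set"
  have "\<exists>c'. cbox c' (c' + w T) \<subseteq> cube c s \<and> \<Psi> c' (c' + w T) < 0" for T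
    using finite[of T]
  proof (induction T rule: finite_induct)
    case empty
    have "w {} = vec s" by (simp add: w_def vec_eq_iff)
    then show ?case using neg by auto
  next
    case (insert j T)
    then obtain c' where c': "cbox c' (c' + w T) \<subseteq> cube c s" "\<Psi> c' (c' + w T) < 0" by blast
    let ?d = "c' + w T"
    define m where "m = (c' $ j + ?d $ j) / 2"
    have lt: "c' $ i < ?d $ i" for i using s by (simp add: w_def)
    have mid: "c' $ j < m" "m < ?d $ j" using lt[of j] by (auto simp: m_def)
    have "\<Psi> c' (set_coord ?d j m) + \<Psi> (set_coord c' j m) ?d < 0"
      using add[of c' ?d, OF _ lt m_def] c' Q by auto
    moreover have "set_coord ?d j m = c' + w (insert j T)" "set_coord c' j m + w (insert j T) = ?d"
      using insert.hyps by (auto simp: vec_eq_iff w_def m_def field_simps)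
    moreover have "cbox c' (set_coord ?d j m) \<subseteq> cbox c' ?d" "cbox (set_coord c' j m) ?d \<subseteq> cbox c' ?d"
      using cbox_split_coord[of c' j m ?d] mid by auto
    ultimately consider "\<Psi> c' (c' + w (insert j T)) < 0 \<and> cbox c' (c' + w (insert j T)) \<subseteq> cbox c' ?d"
      | "\<Psi> (set_coord c' j m) (set_coord c' j m + w (insert j T)) < 0 \<and>
         cbox (set_coord c' j m) (set_coord c' j m + w (insert j T)) \<subseteq> cbox c' ?d"
      by (metis add_nonneg_nonneg not_le)
    then show ?case using c'(1) by cases blast+
  qed
  from this[of UNIV] obtain c' where "cbox c' (c' + w UNIV) \<subseteq> cube c s" "\<Psi> c' (c' + w UNIV) < 0" by blast
  moreover have "w UNIV = vec (s / 2)" by (simp add: w_def vec_eq_iff)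
  ultimately show thesis using that by auto
qed

text \<open>
  Goursat's argument. If the inequality failed, repeated bisection would give nested cubes on each of
  which the flux is smaller than the integral of \<open>h - \<epsilon>\<close>. Differentiability at their common point \<open>z\<close>
  makes the flux through a small cube almost the trace at \<open>z\<close> times the volume, hence at least about
  \<open>h z\<close> times the volume, a contradiction. The continuous one-sided bound \<open>h\<close> takes the place of
  integrability of the divergence.
\<close>

theorem box_flux_ge_integral:
  fixes Y :: "real ^ 'n::finite \<Rightarrow> real ^ 'n"
  assumes s: "0 < s"
    and der: "\<And>y. y \<in> cube c s \<Longrightarrow> (Y has_derivative DY y) (at y)"
    and h: "continuous_on (cube c s) h"
    and le: "\<And>y. y \<in> cube c s \<Longrightarrow> h y \<le> (\<Sum>i\<in>UNIV. DY y (axis i 1) $ i)"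
  shows "integral (cube c s) h \<le> box_flux Y c (c + vec s)"
proof (rule ccontr)
  let ?Q = "cube c s"
  assume neg: "\<not> ?thesis"
  define gap where "gap = integral ?Q h - box_flux Y c (c + vec s)"
  have gap: "0 < gap" using neg by (simp add: gap_def)
  \<comment> \<open>Replacing \<open>h\<close> by \<open>h - \<epsilon>\<close> uses up half of the gap.\<close>
  define \<epsilon> where "\<epsilon> = gap / (2 * s ^ CARD('n))"
  have \<epsilon>: "0 < \<epsilon>" using gap s by (simp add: \<epsilon>_def)
  have Y: "continuous_on ?Q Y"
    using has_derivative_continuous[OF der] by (intro continuous_at_imp_continuous_on) auto
  define \<Psi> where "\<Psi> c d = box_flux Y c d - integral (cbox c d) (\<lambda>y. h y - \<epsilon>)" for c d
  have add: "\<Psi> c' d' = \<Psi> c' (set_coord d' j m) + \<Psi> (set_coord c' j m) d'"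
    if "cbox c' d' \<subseteq> ?Q" "\<And>i. c' $ i < d' $ i" "m = (c' $ j + d' $ j) / 2" for c' d' j m
  proof -
    have "integral (cbox c' d') (\<lambda>y. h y - \<epsilon>) = integral (cbox c' (set_coord d' j m)) (\<lambda>y. h y - \<epsilon>)
        + integral (cbox (set_coord c' j m) d') (\<lambda>y. h y - \<epsilon>)"
      by (rule integral_split_coord)
        (use that(2)[of j] that(3) in \<open>auto intro!: integrable_continuous continuous_intros
           continuous_on_subset[OF h that(1)]\<close>)
    then show ?thesis
      using box_flux_split[OF continuous_on_subset[OF Y that(1)] that(2,3)] by (simp add: \<Psi>_def)
  qed
  have "integral ?Q (\<lambda>y. h y - \<epsilon>) = integral ?Q h - \<epsilon> * s ^ CARD('n)"
    by (subst integral_diff) (use s h integrable_continuous in \<open>auto simp: content_cube\<close>)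
  also have "\<epsilon> * s ^ CARD('n) = gap / 2" using s by (simp add: \<epsilon>_def)
  finally have neg0: "\<Psi> c (c + vec s) < 0"
    using gap unfolding \<Psi>_def gap_def by (simp add: field_simps)
  define P where "P k x \<longleftrightarrow> cube x (s / 2 ^ k) \<subseteq> ?Q \<and> \<Psi> x (x + vec (s / 2 ^ k)) < 0" for k :: nat and x
  have "\<exists>x. \<forall>k. P k (x k) \<and> cube (x (Suc k)) (s / 2 ^ Suc k) \<subseteq> cube (x k) (s / 2 ^ k)"
  proof (rule dependent_nat_choice)
    show "\<exists>x. P 0 x" using neg0 by (auto simp: P_def)
    fix x k assume "P k x"
    then have *: "cube x (s / 2 ^ k) \<subseteq> ?Q" "\<Psi> x (x + vec (s / 2 ^ k)) < 0" "0 < s / 2 ^ k"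
      using s by (auto simp: P_def)
    obtain x' where "cube x' (s / 2 ^ k / 2) \<subseteq> cube x (s / 2 ^ k)" "\<Psi> x' (x' + vec (s / 2 ^ k / 2)) < 0"
      using box_bisection[OF add *(2,3,1)] by blast
    then show "\<exists>y. P (Suc k) y \<and> cube y (s / 2 ^ Suc k) \<subseteq> cube x (s / 2 ^ k)"
      using *(1) by (intro exI[of _ x']) (auto simp: P_def mult.commute)
  qed
  then obtain x where x: "\<And>k. P k (x k)"
      and nest: "\<And>k. cube (x (Suc k)) (s / 2 ^ Suc k) \<subseteq> cube (x k) (s / 2 ^ k)" by blast
  define C where "C k = cube (x k) (s / 2 ^ k)" for k
  have dec: "C n \<subseteq> C k" if "k \<le> n" for k n
    by (rule lift_Suc_antimono_le[of C, OF _ that]) (unfold C_def, rule nest)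
  have ne: "C k \<noteq> {}" for k using s by (auto simp: C_def interval_ne_empty_cart)
  have "\<Inter>(range C) \<noteq> {}"
    by (rule compact_nest) (use ne dec in \<open>auto simp: C_def\<close>)
  then obtain z where z: "\<And>k. z \<in> C k" by auto
  have zQ: "z \<in> ?Q" using z[of 0] x[of 0] by (auto simp: C_def P_def)
  define tr where "tr = (\<Sum>i\<in>UNIV. DY z (axis i 1) $ i)"
  have "0 < \<epsilon> / 4" "0 \<le> real CARD('n)" using \<epsilon> by auto
  from box_flux_at_differentiable[OF der[OF zQ] this, folded tr_def]
  obtain \<delta> where \<delta>: "0 < \<delta>" "\<forall>c s. 0 < s \<longrightarrow> s < \<delta> \<longrightarrow> continuous_on (cube c s) Y \<longrightarrow>
       (\<forall>y\<in>cube c s. norm (y - z) \<le> real CARD('n) * s) \<longrightarrow>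
       \<bar>box_flux Y c (c + vec s) - tr * s ^ CARD('n)\<bar> \<le> \<epsilon> / 4 * s ^ CARD('n)"
    by (elim exE conjE) (rule that)
  obtain \<rho> where \<rho>: "0 < \<rho>" "\<And>y. y \<in> ?Q \<Longrightarrow> dist y z < \<rho> \<Longrightarrow> dist (h y) (h z) < \<epsilon> / 4"
    using h zQ \<epsilon> unfolding continuous_on_iff by (metis divide_pos_pos zero_less_numeral)
  have lim: "(\<lambda>k. s / 2 ^ k) \<longlonglongrightarrow> 0"
    using LIMSEQ_divide_realpow_zero[of 2 s] by simp
  have "0 < min \<delta> (\<rho> / real CARD('n))" using \<delta> \<rho> by simp
  from eventually_happens'[OF sequentially_bot order_tendstoD(2)[OF lim this]]
  obtain k where k: "s / 2 ^ k < min \<delta> (\<rho> / real CARD('n))" by (elim exE)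
  define \<sigma> where "\<sigma> = s / 2 ^ k"
  have \<sigma>: "0 < \<sigma>" "\<sigma> < \<delta>" "real CARD('n) * \<sigma> < \<rho>"
    using s k by (auto simp: \<sigma>_def field_simps)
  let ?C = "cube (x k) \<sigma>" and ?V = "\<sigma> ^ CARD('n)"
  have CQ: "?C \<subseteq> ?Q" and neg: "\<Psi> (x k) (x k + vec \<sigma>) < 0" and zC: "z \<in> ?C"
    using x[of k] z[of k] by (auto simp: P_def \<sigma>_def C_def)
  have hC: "continuous_on ?C h" using h CQ by (rule continuous_on_subset)
  have "\<bar>box_flux Y (x k) (x k + vec \<sigma>) - tr * ?V\<bar> \<le> \<epsilon> / 4 * ?V"
    by (rule \<delta>(2)[rule_format]) (use \<sigma> zC continuous_on_subset[OF Y CQ] norm_le_cube in auto)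
  moreover have "integral ?C (\<lambda>y. h y - \<epsilon>) \<le> integral ?C (\<lambda>y. h z + \<epsilon> / 4 - \<epsilon>)"
  proof (rule integral_le)
    fix y assume y: "y \<in> ?C"
    have "dist y z < \<rho>" using norm_le_cube[OF y zC] \<sigma> by (simp add: dist_norm)
    then have "\<bar>h y - h z\<bar> < \<epsilon> / 4"
      using \<rho>(2)[OF subsetD[OF CQ y]] unfolding dist_real_def by blast
    then show "h y - \<epsilon> \<le> h z + \<epsilon> / 4 - \<epsilon>" by linarith
  qed (auto intro!: integrable_continuous continuous_intros hC)
  moreover have "integral ?C (\<lambda>y. h z + \<epsilon> / 4 - \<epsilon>) = (h z + \<epsilon> / 4 - \<epsilon>) * ?V"
    using \<sigma> by (simp add: content_cube)
  moreover have "(h z + \<epsilon> / 4 - \<epsilon>) * ?V = h z * ?V - 3 / 4 * (\<epsilon> * ?V)"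
    by (simp add: algebra_simps)
  moreover have "\<epsilon> / 4 * ?V = 1 / 4 * (\<epsilon> * ?V)" by simp
  moreover have "h z * ?V \<le> tr * ?V"
    using le[OF zQ] \<sigma> by (intro mult_right_mono) (auto simp: tr_def)
  moreover have "0 < \<epsilon> * ?V" using \<epsilon> \<sigma> by simp
  ultimately have "0 \<le> \<Psi> (x k) (x k + vec \<sigma>)"
    unfolding \<Psi>_def by linarith
  with neg show False by simp
qed

section \<open>The sign of the divergence at a zero of the potential\<close>

lemma trace_product_antisymmetric:
  fixes H A :: "real ^ 'n::finite ^ 'n"
  assumes "transpose H = H" "transpose A = - A"
  shows "trace (H ** A) = 0"
proof -
  have "trace (H ** A) = trace (transpose (H ** A))" by (simp add: trace_def transpose_def)
  also have "\<dots> = trace ((- A) ** H)" by (simp add: matrix_transpose_mul assms)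
  also have "\<dots> = - trace (A ** H)" by (simp add: trace_def matrix_matrix_mult_def sum_negf)
  also have "\<dots> = - trace (H ** A)" by (simp only: trace_mul_sym[of A H])
  finally show ?thesis by simp
qed

lemma posdef_invertible:
  fixes G :: "real ^ 'n::finite ^ 'n"
  assumes "\<And>v. v \<noteq> 0 \<Longrightarrow> 0 < v \<bullet> (G *v v)"
  shows "invertible G"
proof -
  have "\<exists>B. B ** G = mat 1"
    unfolding matrix_left_invertible_ker using assms by (metis inner_zero_right less_irrefl)
  then show ?thesis by (metis invertible_def matrix_left_right_inverse)
qed

lemma matrix_inv_inverse:
  assumes "invertible G"
  shows "G ** matrix_inv G = mat 1" "matrix_inv G ** G = mat 1"
  using someI_ex[OF assms[unfolded invertible_def]] by (auto simp: matrix_inv_def)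

lemma
  fixes G :: "real ^ 'n::finite ^ 'n"
  assumes sym: "transpose G = G" and pos: "\<And>v. v \<noteq> 0 \<Longrightarrow> 0 < v \<bullet> (G *v v)"
  shows transpose_matrix_inv_posdef: "transpose (matrix_inv G) = matrix_inv G"
    and matrix_inv_posdef: "v \<noteq> 0 \<Longrightarrow> 0 < v \<bullet> (matrix_inv G *v v)"
proof -
  let ?H = "matrix_inv G"
  have GH: "G ** ?H = mat 1" "?H ** G = mat 1"
    using matrix_inv_inverse[OF posdef_invertible[OF pos]] by auto
  have "transpose ?H = transpose ?H ** (G ** ?H)" by (simp add: GH)
  also have "\<dots> = transpose (G ** ?H) ** ?H"
    by (simp add: matrix_transpose_mul sym matrix_mul_assoc)
  finally show "transpose ?H = ?H" by (simp add: GH transpose_mat)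
  show "0 < v \<bullet> (?H *v v)" if v: "v \<noteq> 0"
  proof -
    have Gw: "G *v (?H *v v) = v" by (simp add: matrix_vector_mul_assoc GH)
    then have "?H *v v \<noteq> 0" using v by auto
    from pos[OF this] show ?thesis unfolding Gw by (simp add: inner_commute)
  qed
qed

text \<open>
  Otherwise \<open>G L\<close> would be antisymmetric, and \<open>L\<close>, its product with the symmetric matrix \<open>G\<close> inverse,
  would have trace 0.
\<close>

lemma exists_nonvanishing_form:
  fixes G :: "real ^ 'n::finite ^ 'n" and L :: "real ^ 'n \<Rightarrow> real ^ 'n"
  assumes L: "linear L" and tr: "(\<Sum>i\<in>UNIV. L (axis i 1) $ i) \<noteq> 0"
    and G: "transpose G = G" "\<And>v. v \<noteq> 0 \<Longrightarrow> 0 < v \<bullet> (G *v v)"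
  shows "\<exists>v. (G *v L v) \<bullet> v \<noteq> 0"
proof (rule ccontr)
  assume *: "\<not> ?thesis"
  define A where "A = G ** matrix L"
  have AL: "A *v v = G *v L v" for v
    by (simp add: A_def matrix_vector_mul_assoc[symmetric] L)
  have "(A *v x) \<bullet> y + (A *v y) \<bullet> x = 0" for x y
    using *[unfolded not_ex not_not, rule_format, folded AL, of x]
      *[unfolded not_ex not_not, rule_format, folded AL, of y]
      *[unfolded not_ex not_not, rule_format, folded AL, of "x + y"]
    by (simp add: matrix_vector_right_distrib inner_add_left inner_add_right)
  from this[of "axis j 1" "axis i 1" for i j]
  have anti0: "A $ j $ i = - A $ i $ j" for i j
    by (simp add: matrix_vector_mult_basis inner_axis column_def eq_neg_iff_add_eq_0 add.commute)
  have "transpose A $ i $ j = (- A) $ i $ j" for i j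
    using anti0[of j i] by (simp add: transpose_def)
  then have anti: "transpose A = - A" by (simp add: vec_eq_iff)
  define H where "H = matrix_inv G"
  have "transpose H = H" unfolding H_def by (rule transpose_matrix_inv_posdef[OF G])
  with anti have "trace (H ** A) = 0" by (intro trace_product_antisymmetric)
  moreover have "H ** A = matrix L"
    using matrix_inv_inverse(2)[OF posdef_invertible[OF G(2)]] by (simp add: A_def H_def matrix_mul_assoc)
  ultimately show False using tr by (simp add: trace_def matrix_def)
qed

text \<open>
  Along the ray from \<open>z\<close> in direction \<open>x\<close> the derivative of \<open>h\<close> has the sign of the form of \<open>G\<close> at
  \<open>(Y, x)\<close>. After rescaling \<open>Y\<close> by \<open>m s\<close> this form is close to the nonzero number for \<open>(q0, v)\<close> when \<open>x\<close>
  is close to \<open>v\<close>. So \<open>h\<close> is strictly monotone along all these rays and leaves the value 0 at once. The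
  rescaling covers the zeros of \<open>Y\<close>, with \<open>m s = 1 / s\<close>.
\<close>

lemma rays_into_nonzero_set:
  fixes Y :: "real ^ 'n::finite \<Rightarrow> real ^ 'n" and h :: "real ^ 'n \<Rightarrow> real"
  assumes U: "open U" "z \<in> U"
    and h': "\<And>y. y \<in> U \<Longrightarrow> (h has_derivative (\<lambda>v. k y * ((G y *v Y y) \<bullet> v))) (at y)"
    and k: "\<And>y. y \<in> U \<Longrightarrow> 0 < k y"
    and hz: "h z = 0"
    and G: "continuous (at z) G"
    and form: "(G z *v q0) \<bullet> v \<noteq> 0"
    and m: "\<And>s. 0 < s \<Longrightarrow> 0 < m s"
    and lim: "\<And>\<rho>. 0 < \<rho> \<Longrightarrow> \<exists>s0>0. \<exists>\<delta>>0. \<forall>s x. 0 < s \<and> s < s0 \<and> norm (x - v) < \<delta> \<longrightarrow>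
        norm (m s *\<^sub>R Y (z + s *\<^sub>R x) - q0) < \<rho>"
  obtains s0 \<delta> where "0 < s0" "0 < \<delta>"
    "\<And>s x. 0 < s \<Longrightarrow> s < s0 \<Longrightarrow> norm (x - v) < \<delta> \<Longrightarrow> z + s *\<^sub>R x \<in> U \<and> h (z + s *\<^sub>R x) \<noteq> 0"
proof -
  define \<sigma> where "\<sigma> = sgn ((G z *v q0) \<bullet> v)"
  have \<sigma>: "\<sigma> \<noteq> 0" "0 < \<sigma> * ((G z *v q0) \<bullet> v)" using form by (auto simp: \<sigma>_def sgn_if)
  have "((\<lambda>(y, q, x). \<sigma> * ((G y *v q) \<bullet> x)) \<longlongrightarrow> \<sigma> * ((G z *v q0) \<bullet> v)) (nhds z \<times>\<^sub>F nhds q0 \<times>\<^sub>F nhds v)"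
  proof -
    have Gz: "(G \<longlongrightarrow> G z) (nhds z)"
      using G by (simp add: continuous_at tendsto_nhds_iff)
    have 1: "((\<lambda>t. G (fst t)) \<longlongrightarrow> G z) (nhds z \<times>\<^sub>F nhds q0 \<times>\<^sub>F nhds v)"
      by (rule filterlim_compose[OF Gz filterlim_fst])
    have 2: "((\<lambda>t. fst (snd t)) \<longlongrightarrow> q0) (nhds z \<times>\<^sub>F nhds q0 \<times>\<^sub>F nhds v)"
      by (rule filterlim_compose[OF filterlim_fst filterlim_snd])
    have 3: "((\<lambda>t. snd (snd t)) \<longlongrightarrow> v) (nhds z \<times>\<^sub>F nhds q0 \<times>\<^sub>F nhds v)"
      by (rule filterlim_compose[OF filterlim_snd filterlim_snd])
    have "((\<lambda>t. G (fst t) *v fst (snd t)) \<longlongrightarrow> G z *v q0) (nhds z \<times>\<^sub>F nhds q0 \<times>\<^sub>F nhds v)"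
      unfolding matrix_vector_mult_def
      by (rule vec_tendstoI, simp only: vec_lambda_beta, intro tendsto_sum tendsto_mult tendsto_vec_nth 1 2)
    from tendsto_mult[OF tendsto_const[of \<sigma>] tendsto_inner[OF this 3]]
    show ?thesis by (simp add: case_prod_unfold)
  qed
  from order_tendstoD(1)[OF this \<sigma>(2)]
  have "\<exists>P Q. eventually P (nhds z) \<and> eventually Q (nhds q0 \<times>\<^sub>F nhds v) \<and>
      (\<forall>y t. P y \<longrightarrow> Q t \<longrightarrow> 0 < \<sigma> * ((G y *v fst t) \<bullet> snd t))"
    by (subst (asm) eventually_prod_filter) (simp add: case_prod_unfold)
  then obtain P Q where P: "eventually P (nhds z)" and Q: "eventually Q (nhds q0 \<times>\<^sub>F nhds v)"
    and PQ': "\<forall>y t. P y \<longrightarrow> Q t \<longrightarrow> 0 < \<sigma> * ((G y *v fst t) \<bullet> snd t)"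
    by (elim exE conjE) (rule that)
  from Q have "\<exists>Q1 Q2. eventually Q1 (nhds q0) \<and> eventually Q2 (nhds v) \<and>
      (\<forall>q x. Q1 q \<longrightarrow> Q2 x \<longrightarrow> Q (q, x))"
    by (subst (asm) eventually_prod_filter)
  then obtain Q1 Q2 where Q1: "eventually Q1 (nhds q0)" and Q2: "eventually Q2 (nhds v)"
    and Q12': "\<forall>q x. Q1 q \<longrightarrow> Q2 x \<longrightarrow> Q (q, x)"
    by (elim exE conjE) (rule that)
  note Q12 = Q12'[rule_format]
  have PQ: "0 < \<sigma> * ((G y *v q) \<bullet> x)" if "P y" "Q (q, x)" for y q x
    using PQ'[rule_format, of y "(q, x)"] that by simp
  have "eventually (\<lambda>y. P y \<and> y \<in> U) (nhds z)"
    using P U by (auto intro: eventually_conj eventually_nhds_in_open)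
  then obtain r where r: "0 < r" "\<And>y. dist y z < r \<Longrightarrow> P y \<and> y \<in> U"
    unfolding eventually_nhds_metric by blast
  obtain \<rho> where \<rho>: "0 < \<rho>" "\<And>q. dist q q0 < \<rho> \<Longrightarrow> Q1 q" using Q1 unfolding eventually_nhds_metric by blast
  obtain \<delta>1 where \<delta>1: "0 < \<delta>1" "\<And>x. dist x v < \<delta>1 \<Longrightarrow> Q2 x" using Q2 unfolding eventually_nhds_metric by blast
  obtain s1 \<delta>2 where s1: "0 < s1" "0 < \<delta>2" "\<And>s x. 0 < s \<Longrightarrow> s < s1 \<Longrightarrow> norm (x - v) < \<delta>2 \<Longrightarrow>
      norm (m s *\<^sub>R Y (z + s *\<^sub>R x) - q0) < \<rho>"
    using lim[OF \<rho>(1)] by blast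
  define \<delta> where "\<delta> = min \<delta>1 \<delta>2"
  define s0 where "s0 = min s1 (r / (norm v + \<delta>))"
  have \<delta>: "0 < \<delta>" using \<delta>1 s1 by (simp add: \<delta>_def)
  then have nv: "0 < norm v + \<delta>" by (simp add: add_nonneg_pos)
  have s0: "0 < s0" using s1 r nv by (simp add: s0_def)
  have inU: "z + s *\<^sub>R x \<in> U \<and> P (z + s *\<^sub>R x)" if "0 \<le> s" "s < s0" "norm (x - v) < \<delta>" for s x
  proof -
    have "norm x \<le> norm v + \<delta>" using that(3) norm_triangle_sub[of x v] by linarith
    then have "s * norm x \<le> s * (norm v + \<delta>)" using that by (intro mult_left_mono) auto
    also have "\<dots> < r" using that(2) nv by (simp add: s0_def field_simps)
    finally show ?thesis using r(2)[of "z + s *\<^sub>R x"] that(1) by (simp add: dist_norm)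
  qed
  have ne: "h (z + s *\<^sub>R x) \<noteq> 0" if s: "0 < s" "s < s0" and x: "norm (x - v) < \<delta>" for s x
  proof -
    have d: "((\<lambda>t. \<sigma> * h (z + t *\<^sub>R x)) has_real_derivative
        \<sigma> * (k (z + t *\<^sub>R x) * ((G (z + t *\<^sub>R x) *v Y (z + t *\<^sub>R x)) \<bullet> x))) (at t)"
      if "0 \<le> t" "t < s0" for t
    proof -
      have "((\<lambda>t. z + t *\<^sub>R x) has_derivative (\<lambda>t. t *\<^sub>R x)) (at t)"
        by (auto intro!: derivative_eq_intros)
      from has_derivative_compose[OF this h'] inU[OF that x]
      have "((\<lambda>t. h (z + t *\<^sub>R x)) has_derivative
          (\<lambda>r. k (z + t *\<^sub>R x) * ((G (z + t *\<^sub>R x) *v Y (z + t *\<^sub>R x)) \<bullet> (r *\<^sub>R x)))) (at t)"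
        by simp
      then have "((\<lambda>t. h (z + t *\<^sub>R x)) has_real_derivative
          (k (z + t *\<^sub>R x) * ((G (z + t *\<^sub>R x) *v Y (z + t *\<^sub>R x)) \<bullet> x))) (at t)"
        unfolding has_field_derivative_def by (rule has_derivative_eq_rhs) (simp add: fun_eq_iff)
      then show ?thesis by (rule DERIV_cmult)
    qed
    have "\<sigma> * h (z + 0 *\<^sub>R x) < \<sigma> * h (z + s *\<^sub>R x)"
    proof (rule DERIV_pos_imp_increasing_open[OF s(1)])
      fix t assume t: "0 < t" "t < s"
      have "norm (m t *\<^sub>R Y (z + t *\<^sub>R x) - q0) < \<rho>"
        using s1(3)[of t x] t s x by (simp add: s0_def \<delta>_def)
      then have "Q1 (m t *\<^sub>R Y (z + t *\<^sub>R x))" by (intro \<rho>(2)) (simp add: dist_norm)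
      moreover have "Q2 x" using x by (intro \<delta>1(2)) (simp add: dist_norm \<delta>_def)
      ultimately have "0 < \<sigma> * ((G (z + t *\<^sub>R x) *v (m t *\<^sub>R Y (z + t *\<^sub>R x))) \<bullet> x)"
        using inU[of t x] t s x by (intro PQ Q12) auto
      then have "0 < m t * (\<sigma> * ((G (z + t *\<^sub>R x) *v Y (z + t *\<^sub>R x)) \<bullet> x))"
        by (simp add: matrix_vector_mult_scaleR algebra_simps)
      then have "0 < \<sigma> * ((G (z + t *\<^sub>R x) *v Y (z + t *\<^sub>R x)) \<bullet> x)"
        using m[OF t(1)] by (simp add: zero_less_mult_iff)
      then have "0 < k (z + t *\<^sub>R x) * (\<sigma> * ((G (z + t *\<^sub>R x) *v Y (z + t *\<^sub>R x)) \<bullet> x))"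
        using k inU[of t x] t s x by simp
      then show "\<exists>y. ((\<lambda>t. \<sigma> * h (z + t *\<^sub>R x)) has_real_derivative y) (at t) \<and> 0 < y"
        using d[of t] t s by (intro exI conjI) (assumption | auto simp: mult.left_commute)+
    next
      show "continuous_on {0..s} (\<lambda>t. \<sigma> * h (z + t *\<^sub>R x))"
        using DERIV_isCont[OF d] s by (intro continuous_at_imp_continuous_on) auto
    qed
    then show ?thesis using hz by auto
  qed
  show thesis by (rule that[OF s0 \<delta>]) (use inU ne in \<open>auto simp: less_imp_le\<close>)
qed

text \<open>
  The hypothesis on the derivative of \<open>h\<close> says that \<open>Y\<close> is a positive multiple of the gradient of \<open>h\<close>
  with respect to \<open>G\<close>. If the trace at \<open>z\<close> were negative, there would be a cone with vertex \<open>z\<close> in which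
  \<open>h\<close> has no zero near \<open>z\<close>: around the direction \<open>Y z\<close> if that is nonzero, and otherwise around a
  direction given by \<open>exists_nonvanishing_form\<close> for the derivative of \<open>Y\<close>. Small cubes in this cone have
  nonnegative flux, but the quotient of their flux and their volume tends to the negative trace at \<open>z\<close>.
\<close>

theorem trace_nonneg_at_zero:
  fixes Y :: "real ^ 'n::finite \<Rightarrow> real ^ 'n" and h :: "real ^ 'n \<Rightarrow> real"
  assumes U: "open U" "z \<in> U"
    and h': "\<And>y. y \<in> U \<Longrightarrow> (h has_derivative (\<lambda>v. k y * ((G y *v Y y) \<bullet> v))) (at y)"
    and k: "\<And>y. y \<in> U \<Longrightarrow> 0 < k y"
    and hz: "h z = 0"
    and G: "continuous (at z) G" "transpose (G z) = G z" "\<And>v. v \<noteq> 0 \<Longrightarrow> 0 < v \<bullet> (G z *v v)"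
    and Y: "\<And>y. y \<in> U \<Longrightarrow> (Y has_derivative DY y) (at y)"
    and tr: "\<And>y. y \<in> U \<Longrightarrow> h y \<noteq> 0 \<Longrightarrow> 0 \<le> (\<Sum>i\<in>UNIV. DY y (axis i 1) $ i)"
  shows "0 \<le> (\<Sum>i\<in>UNIV. DY z (axis i 1) $ i)"
proof (rule ccontr)
  let ?L = "DY z" and ?t = "\<Sum>i\<in>UNIV. DY z (axis i 1) $ i"
  assume "\<not> 0 \<le> ?t"
  then have neg: "?t < 0" by simp
  have dYz: "(Y has_derivative ?L) (at z)" using Y U by blast
  then have lin: "linear ?L" and bl: "bounded_linear ?L"
    by (auto intro: has_derivative_linear has_derivative_bounded_linear)
  have "\<exists>q0 v m. (G z *v q0) \<bullet> v \<noteq> 0 \<and> (\<forall>s>0. 0 < m s) \<and> (\<forall>\<rho>>0. \<exists>s0>0. \<exists>\<delta>>0. \<forall>s x.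
      0 < s \<and> s < s0 \<and> norm (x - v) < \<delta> \<longrightarrow> norm (m s *\<^sub>R Y (z + s *\<^sub>R x) - q0) < (\<rho>::real))"
  proof (cases "Y z = 0")
    case False
    have "\<exists>s0>0. \<exists>\<delta>>0. \<forall>s x. 0 < s \<and> s < s0 \<and> norm (x - Y z) < \<delta> \<longrightarrow>
        norm (1 *\<^sub>R Y (z + s *\<^sub>R x) - Y z) < \<rho>" if \<rho>: "0 < \<rho>" for \<rho>
    proof -
      have "isCont Y z" using dYz by (rule has_derivative_continuous)
      then obtain r where r: "0 < r" "\<And>y. dist y z < r \<Longrightarrow> dist (Y y) (Y z) < \<rho>"
        using \<rho> unfolding continuous_at by (metis LIM_def dist_self)
      have n: "0 < norm (Y z) + 1" by (simp add: add_nonneg_pos)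
      show ?thesis
      proof (rule exI[of _ "r / (norm (Y z) + 1)"], rule conjI[OF _ exI[of _ "1::real"]], goal_cases)
        case 2
        show ?case
        proof (intro conjI allI impI)
        fix s x assume *: "0 < s \<and> s < r / (norm (Y z) + 1) \<and> norm (x - Y z) < 1"
        have "norm x \<le> norm (Y z) + 1" using * norm_triangle_sub[of x "Y z"] by linarith
        then have "s * norm x \<le> s * (norm (Y z) + 1)" using * by (intro mult_left_mono) auto
        also have "\<dots> < r" using * n by (simp add: field_simps)
        finally show "norm (1 *\<^sub>R Y (z + s *\<^sub>R x) - Y z) < \<rho>"
          using r(2)[of "z + s *\<^sub>R x"] * by (simp add: dist_norm)
        qed auto
      qed (use r n in auto)
    qed
    moreover have "(G z *v Y z) \<bullet> Y z \<noteq> 0"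
      using G(3)[OF False] by (simp add: inner_commute)
    ultimately show ?thesis
      by (intro exI[of _ "Y z"] exI[of _ "Y z"] exI[of _ "\<lambda>_. 1::real"]) simp
  next
    case True
    obtain v where v: "(G z *v ?L v) \<bullet> v \<noteq> 0"
      using exists_nonvanishing_form[OF lin _ G(2,3)] neg by auto
    have "\<exists>s0>0. \<exists>\<delta>>0. \<forall>s x. 0 < s \<and> s < s0 \<and> norm (x - v) < \<delta> \<longrightarrow>
        norm ((1 / s) *\<^sub>R Y (z + s *\<^sub>R x) - ?L v) < \<rho>" if \<rho>: "0 < \<rho>" for \<rho>
    proof -
      obtain B where B: "0 < B" "\<And>x. norm (?L x) \<le> norm x * B"
        using bounded_linear.pos_bounded[OF bl] by blast
      define n where "n = norm v + 1"
      have n: "0 < n" by (simp add: n_def add_nonneg_pos)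
      have e: "0 < \<rho> / (2 * n)" using \<rho> n by simp
      obtain r where r: "0 < r" "\<And>y. norm (y - z) < r \<Longrightarrow>
          norm (Y y - Y z - ?L (y - z)) \<le> \<rho> / (2 * n) * norm (y - z)"
        using dYz e unfolding has_derivative_at_alt by blast
      show ?thesis
      proof (rule exI[of _ "r / n"], rule conjI[OF _ exI[of _ "min 1 (\<rho> / (2 * B))"]], goal_cases)
        case 2
        show ?case
        proof (intro conjI allI impI)
        fix s x assume *: "0 < s \<and> s < r / n \<and> norm (x - v) < min 1 (\<rho> / (2 * B))"
        have x: "norm x \<le> n" using * norm_triangle_sub[of x v] by (simp add: n_def)
        then have sx: "s * norm x \<le> s * n" using * by (intro mult_left_mono) auto
        also have "\<dots> < r" using * n by (simp add: field_simps)
        finally have "norm (Y (z + s *\<^sub>R x) - s *\<^sub>R ?L x) \<le> \<rho> / (2 * n) * (s * norm x)"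
          using r(2)[of "z + s *\<^sub>R x"] * True linear_cmul[OF lin] by simp
        also have "\<dots> \<le> \<rho> / (2 * n) * (s * n)"
          using sx \<rho> n x * by (intro mult_left_mono) auto
        also have "\<dots> = s * (\<rho> / 2)" using n by simp
        finally have a: "norm (Y (z + s *\<^sub>R x) - s *\<^sub>R ?L x) \<le> s * (\<rho> / 2)" .
        have "(1 / s) *\<^sub>R Y (z + s *\<^sub>R x) - ?L x = (1 / s) *\<^sub>R (Y (z + s *\<^sub>R x) - s *\<^sub>R ?L x)"
          using * by (simp add: scaleR_diff_right)
        then have "norm ((1 / s) *\<^sub>R Y (z + s *\<^sub>R x) - ?L x) = norm (Y (z + s *\<^sub>R x) - s *\<^sub>R ?L x) / s"
          using * by simp
        also have "\<dots> \<le> \<rho> / 2" using a * by (simp add: field_simps)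
        finally have 1: "norm ((1 / s) *\<^sub>R Y (z + s *\<^sub>R x) - ?L x) \<le> \<rho> / 2" .
        have "norm (?L x - ?L v) \<le> norm (x - v) * B"
          using B(2)[of "x - v"] linear_diff[OF lin] by simp
        also have "\<dots> < \<rho> / 2" using * B(1) by (simp add: field_simps)
        finally have "norm (((1 / s) *\<^sub>R Y (z + s *\<^sub>R x) - ?L x) + (?L x - ?L v)) < \<rho>"
          using 1 norm_triangle_ineq[of "(1 / s) *\<^sub>R Y (z + s *\<^sub>R x) - ?L x" "?L x - ?L v"] by linarith
        then show "norm ((1 / s) *\<^sub>R Y (z + s *\<^sub>R x) - ?L v) < \<rho>" by simp
        qed (use B \<rho> in auto)
      qed (use r n in auto)
    qed
    with v show ?thesis
      by (intro exI[of _ "?L v"] exI[of _ v] exI[of _ "\<lambda>s. 1 / s"]) auto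
  qed
  then obtain q0 v m where q0: "(G z *v q0) \<bullet> v \<noteq> 0" "\<And>s. 0 < s \<Longrightarrow> 0 < m s"
    "\<And>\<rho>. 0 < \<rho> \<Longrightarrow> \<exists>s0>0. \<exists>\<delta>>0. \<forall>s x.
      0 < s \<and> s < s0 \<and> norm (x - v) < \<delta> \<longrightarrow> norm (m s *\<^sub>R Y (z + s *\<^sub>R x) - q0) < (\<rho>::real)"
    by blast
  obtain s0 \<delta> where s0: "0 < s0" and \<delta>: "0 < \<delta>" and
    ne: "\<And>s x. 0 < s \<Longrightarrow> s < s0 \<Longrightarrow> norm (x - v) < \<delta> \<Longrightarrow> z + s *\<^sub>R x \<in> U \<and> h (z + s *\<^sub>R x) \<noteq> 0"
    using rays_into_nonzero_set[OF U h' k hz G(1) q0] by blast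
  \<comment> \<open>The cube with corner \<open>z + s v\<close> and edge \<open>s \<tau>\<close> stays in the cone around \<open>v\<close> of opening \<open>\<delta>\<close>.\<close>
  define \<tau> where "\<tau> = \<delta> / (2 * real CARD('n))"
  have \<tau>: "0 < \<tau>" using \<delta> by (simp add: \<tau>_def)
  define K where "K = (norm v + \<delta>) / \<tau>"
  have K: "0 \<le> K" using \<tau> \<delta> by (simp add: K_def)
  have "0 < - ?t / 2" using neg by simp
  from box_flux_at_differentiable[OF dYz this K]
  obtain \<epsilon> where \<epsilon>: "0 < \<epsilon>" "\<forall>c s. 0 < s \<longrightarrow> s < \<epsilon> \<longrightarrow> continuous_on (cube c s) Y \<longrightarrow>
       (\<forall>y\<in>cube c s. norm (y - z) \<le> K * s) \<longrightarrow>
       \<bar>box_flux Y c (c + vec s) - ?t * s ^ CARD('n)\<bar> \<le> (- ?t / 2) * s ^ CARD('n)"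
    by (elim exE conjE) (rule that)
  define w where "w = min s0 (\<epsilon> / \<tau>)"
  have w: "0 < w" "w \<le> s0" "w \<le> \<epsilon> / \<tau>" using s0 \<epsilon> \<tau> by (auto simp: w_def)
  define s where "s = w / 2"
  have s: "0 < s" "s < s0" "s * \<tau> < \<epsilon>"
  proof -
    show "0 < s" "s < s0" using w by (auto simp: s_def)
    have "s < \<epsilon> / \<tau>" using w unfolding s_def by linarith
    then show "s * \<tau> < \<epsilon>" using \<tau> by (simp add: field_simps)
  qed
  let ?c = "z + s *\<^sub>R v" and ?\<sigma> = "s * \<tau>"
  have \<sigma>: "0 < ?\<sigma>" using s \<tau> by simp
  have pt: "y \<in> U \<and> h y \<noteq> 0 \<and> norm (y - z) \<le> K * ?\<sigma>" if y: "y \<in> cube ?c ?\<sigma>" for y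
  proof -
    define x where "x = (1 / s) *\<^sub>R (y - z)"
    have yx: "y = z + s *\<^sub>R x" using s by (simp add: x_def)
    have "?c \<in> cube ?c ?\<sigma>" using \<sigma> by (simp add: mem_box_cart)
    from norm_le_cube[OF y this] have "norm (s *\<^sub>R (x - v)) \<le> real CARD('n) * ?\<sigma>"
      by (simp add: yx scaleR_diff_right)
    then have "s * norm (x - v) \<le> s * (\<delta> / 2)" using s by (simp add: \<tau>_def)
    then have xv: "norm (x - v) \<le> \<delta> / 2" using s by simp
    then have "norm x \<le> norm v + \<delta>" using \<delta> norm_triangle_sub[of x v] by linarith
    then have "s * norm x \<le> s * (norm v + \<delta>)" using s by (intro mult_left_mono) auto
    also have "\<dots> = K * ?\<sigma>" using \<tau> by (simp add: K_def)
    finally show ?thesis using ne[OF s(1,2), of x] xv \<delta> s by (auto simp: yx)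
  qed
  have "continuous_on (cube ?c ?\<sigma>) Y"
    using pt by (intro continuous_at_imp_continuous_on ballI) (metis Y has_derivative_continuous)
  then have up: "box_flux Y ?c (?c + vec ?\<sigma>) \<le> (?t / 2) * ?\<sigma> ^ CARD('n)"
    using \<epsilon>(2)[rule_format, OF \<sigma> s(3), of ?c] pt by (simp add: abs_le_iff algebra_simps)
  have "integral (cube ?c ?\<sigma>) (\<lambda>_. 0) \<le> box_flux Y ?c (?c + vec ?\<sigma>)"
    by (rule box_flux_ge_integral[OF \<sigma>]) (use pt Y tr in auto)
  moreover have "(?t / 2) * ?\<sigma> ^ CARD('n) < 0"
    using neg \<sigma> by (intro mult_neg_pos) auto
  ultimately show False using up by simp
qed

section \<open>Images of Borel sets under differentiable maps\<close>

text \<open>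
  A copy of a finite type that carries a well-order, taken from an arbitrary enumeration. The change of
  variables formula \<open>has_measure_differentiable_image\<close> concerns index types with such an order.
\<close>

typedef 'n idx = "UNIV :: 'n set" by blast

definition idx_rank :: "'n::finite idx \<Rightarrow> nat" where
  "idx_rank = (SOME r. inj r)"

lemma finite_UNIV_idx: "finite (UNIV :: 'n::finite idx set)"
proof -
  have "(UNIV :: 'n idx set) = range Abs_idx" by (metis Rep_idx_inverse surj_def)
  moreover have "finite (range (Abs_idx :: 'n \<Rightarrow> _))" by (rule finite_imageI) simp
  ultimately show ?thesis by (rule ssubst)
qed

lemma inj_idx_rank: "inj (idx_rank :: 'n::finite idx \<Rightarrow> nat)"
proof -
  have "\<exists>r :: 'n idx \<Rightarrow> nat. inj r"
    using finite_imp_inj_to_nat_seg[OF finite_UNIV_idx] by blast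
  from someI_ex[OF this] show ?thesis unfolding idx_rank_def .
qed

instantiation idx :: (finite) "{finite, wellorder}"
begin
definition less_eq_idx :: "'a idx \<Rightarrow> 'a idx \<Rightarrow> bool" where "i \<le> j \<longleftrightarrow> idx_rank i \<le> idx_rank j"
definition less_idx :: "'a idx \<Rightarrow> 'a idx \<Rightarrow> bool" where "i < j \<longleftrightarrow> idx_rank i < idx_rank j"
instance
proof
  show "finite (UNIV :: 'a idx set)" by (rule finite_UNIV_idx)
  fix P :: "'a idx \<Rightarrow> bool" and i
  assume step: "\<And>x. (\<And>y. y < x \<Longrightarrow> P y) \<Longrightarrow> P x"
  show "P i"
  proof (induction "idx_rank i" arbitrary: i rule: less_induct)
    case less
    show ?case by (rule step) (rule less, simp add: less_idx_def)
  qed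
next
  fix i j :: "'a idx"
  assume "i \<le> j" "j \<le> i"
  then show "i = j" by (intro injD[OF inj_idx_rank]) (simp add: less_eq_idx_def)
qed (auto simp: less_eq_idx_def less_idx_def)
end

definition reindex :: "('m \<Rightarrow> 'n) \<Rightarrow> real ^ 'n \<Rightarrow> real ^ 'm" where
  "reindex f x = (\<chi> i. x $ f i)"

lemma reindex_nth [simp]: "reindex f x $ i = x $ f i"
  by (simp add: reindex_def)

lemma linear_reindex: "linear (reindex f :: real ^ 'n::finite \<Rightarrow> real ^ 'm::finite)"
  by (rule linearI) (auto simp: vec_eq_iff)

lemma bounded_linear_reindex:
  "bounded_linear (reindex f :: real ^ 'n::finite \<Rightarrow> real ^ 'm::finite)"
  using linear_reindex by (simp add: linear_conv_bounded_linear)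

lemma measurable_reindex [measurable]:
  "(reindex f :: real ^ 'n::finite \<Rightarrow> real ^ 'm::finite) \<in> borel_measurable borel"
  by (intro borel_measurable_continuous_onI linear_continuous_on bounded_linear_reindex)

lemma prod_Basis_cart:
  fixes x :: "real ^ 'n::finite"
  shows "(\<Prod>b\<in>Basis. x \<bullet> b) = (\<Prod>i\<in>UNIV. x $ i)"
proof -
  have B: "(Basis :: (real ^ 'n) set) = range (\<lambda>i. axis i 1)" by (auto simp: Basis_vec_def)
  have "inj (\<lambda>i::'n. axis i (1::real))" by (auto simp: inj_def axis_eq_axis)
  then show ?thesis unfolding B by (subst prod.reindex) (simp_all add: inner_axis)
qed

lemma lborel_reindex:
  fixes f :: "'m::finite \<Rightarrow> 'n::finite"
  assumes f: "bij f"
  shows "distr lborel borel (reindex f) = lborel"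
proof (rule lborel_eqI[symmetric])
  fix l u :: "real ^ 'm" assume le: "\<And>b. b \<in> Basis \<Longrightarrow> l \<bullet> b \<le> u \<bullet> b"
  let ?l = "reindex (inv f) l" and ?u = "reindex (inv f) u"
  have lu: "l $ i \<le> u $ i" for i using le[of "axis i 1"] by (simp add: inner_axis)
  have "reindex f -` box l u = box ?l ?u"
    using f by (auto simp: mem_box_cart bij_is_inj bij_is_surj surj_f_inv_f)
      (metis bij_is_surj surj_f_inv_f bij_is_inj inv_f_f)+
  moreover have "\<And>b. b \<in> Basis \<Longrightarrow> ?l \<bullet> b \<le> ?u \<bullet> b"
    using lu by (auto simp: Basis_vec_def inner_axis)
  ultimately have "emeasure (distr lborel borel (reindex f)) (box l u) = (\<Prod>b\<in>Basis. (?u - ?l) \<bullet> b)"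
    by (simp add: emeasure_distr)
  also have "(\<Prod>b\<in>Basis. (?u - ?l) \<bullet> b) = (\<Prod>b\<in>Basis. (u - l) \<bullet> b)"
    unfolding prod_Basis_cart
    by (simp add: prod.reindex_bij_betw[OF bij_imp_bij_inv[OF f], of "\<lambda>i. u $ i - l $ i"])
  finally show "emeasure (distr lborel borel (reindex f)) (box l u) = (\<Prod>b\<in>Basis. (u - l) \<bullet> b)" .
qed simp

text \<open>
  Conjugation by \<open>f\<close> is a bijection between the permutations of the two index types that preserves the
  sign.
\<close>

lemma det_reindex:
  fixes M :: "real ^ 'n::finite ^ 'n" and N :: "real ^ 'm::finite ^ 'm"
  assumes f: "bij f" and N: "\<And>i j. N $ i $ j = M $ f i $ f j"
  shows "det N = det M"
proof -
  have inj: "inj f" and surj: "surj f" using f by (auto simp: bij_is_inj bij_is_surj)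
  have map: "map_permutation UNIV f p = f \<circ> p \<circ> inv f" for p
    by (simp add: map_permutation_def surj restrict_id_def fun_eq_iff)
  have "det N = (\<Sum>p\<in>{p. p permutes (UNIV::'m set)}. of_int (sign p) * (\<Prod>i\<in>UNIV. M $ f i $ f (p i)))"
    by (simp add: det_def N)
  also have "\<dots> = (\<Sum>q\<in>{q. q permutes (UNIV::'n set)}. of_int (sign q) * (\<Prod>i\<in>UNIV. M $ i $ q i))"
  proof (rule sum.reindex_bij_witness[of _ "\<lambda>q. inv f \<circ> q \<circ> f" "\<lambda>p. f \<circ> p \<circ> inv f"])
    fix p :: "'m \<Rightarrow> 'm" assume p: "p \<in> {p. p permutes UNIV}"
    have "map_permutation UNIV f p permutes UNIV"
      by (rule map_permutation_permutes) (use f p in auto)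
    then show "f \<circ> p \<circ> inv f \<in> {q. q permutes UNIV}" by (simp add: map)
    show "inv f \<circ> (f \<circ> p \<circ> inv f) \<circ> f = p" by (simp add: fun_eq_iff inj)
    have "sign (f \<circ> p \<circ> inv f) = sign p"
      using sign_map_permutation[of f UNIV p] inj p by (simp add: map)
    moreover have "(\<Prod>i\<in>UNIV. M $ i $ (f \<circ> p \<circ> inv f) i) = (\<Prod>i\<in>UNIV. M $ f i $ (f \<circ> p \<circ> inv f) (f i))"
      by (rule prod.reindex_bij_betw[OF f, symmetric])
    ultimately show "of_int (sign (f \<circ> p \<circ> inv f)) * (\<Prod>i\<in>UNIV. M $ i $ (f \<circ> p \<circ> inv f) i) =
        of_int (sign p) * (\<Prod>i\<in>UNIV. M $ f i $ f (p i))"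
      by (simp add: inj)
  next
    fix q :: "'n \<Rightarrow> 'n" assume q: "q \<in> {q. q permutes UNIV}"
    have "map_permutation UNIV (inv f) q permutes UNIV"
      by (rule map_permutation_permutes) (use f q in \<open>auto simp: bij_imp_bij_inv\<close>)
    moreover have "map_permutation UNIV (inv f) q = inv f \<circ> q \<circ> f"
      by (simp add: map_permutation_def restrict_id_def fun_eq_iff f inv_inv_eq
          bij_is_surj[OF bij_imp_bij_inv[OF f]])
    ultimately show "inv f \<circ> q \<circ> f \<in> {p. p permutes UNIV}" by simp
    show "f \<circ> (inv f \<circ> q \<circ> f) \<circ> inv f = q" by (simp add: fun_eq_iff surj surj_f_inv_f)
  qed
  finally show ?thesis by (simp add: det_def)
qed

text \<open>
  The change of variables formula says, for each finite \<open>m\<close>, that one side equals \<open>m\<close> if and only if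
  the other does; so both sides are infinite together.
\<close>

lemma emeasure_differentiable_image_wellorder:
  fixes T :: "real ^ 'n::{finite, wellorder} \<Rightarrow> real ^ 'n::_"
  assumes B: "B \<in> sets borel" and TB: "T ` B \<in> sets borel"
    and der: "\<And>x. x \<in> B \<Longrightarrow> (T has_derivative T' x) (at x within B)"
    and inj: "inj_on T B"
    and g: "g \<in> borel_measurable borel" "\<And>x. x \<in> B \<Longrightarrow> g x = \<bar>det (matrix (T' x))\<bar>"
  shows "emeasure lborel (T ` B) = (\<integral>\<^sup>+x\<in>B. ennreal (g x) \<partial>lborel)"
proof -
  define D where "D x = (if x \<in> B then \<bar>det (matrix (T' x))\<bar> else 0)" for x
  have D: "D = (\<lambda>x. g x * indicator B x)" using g(2) by (auto simp: D_def fun_eq_iff)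
  have [measurable]: "D \<in> borel_measurable borel" unfolding D using B g(1) by measurable
  have nn: "(\<integral>\<^sup>+x\<in>B. ennreal (g x) \<partial>lborel) = integral\<^sup>N lborel D"
    unfolding D by (intro nn_integral_cong) (auto simp: indicator_def)
  have BL: "B \<in> sets lebesgue" using B by simp
  have eq: "emeasure lborel (T ` B) = ennreal m \<longleftrightarrow> integral\<^sup>N lborel D = ennreal m" if "0 \<le> m" for m
  proof -
    have "emeasure lborel (T ` B) = ennreal m \<longleftrightarrow> T ` B \<in> lmeasurable \<and> measure lebesgue (T ` B) = m"
    proof
      assume *: "emeasure lborel (T ` B) = ennreal m"
      then have "emeasure lebesgue (T ` B) = ennreal m" using TB by simp
      then show "T ` B \<in> lmeasurable \<and> measure lebesgue (T ` B) = m"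
        using TB that by (auto simp: fmeasurable_def measure_def)
    next
      assume "T ` B \<in> lmeasurable \<and> measure lebesgue (T ` B) = m"
      then have "emeasure lebesgue (T ` B) = ennreal m"
        by (metis emeasure_eq_measure2)
      then show "emeasure lborel (T ` B) = ennreal m" using TB by simp
    qed
    also have "\<dots> \<longleftrightarrow> ((\<lambda>x. \<bar>det (matrix (T' x))\<bar>) has_integral m) B"
      by (rule has_measure_differentiable_image[OF BL der inj])
    also have "\<dots> \<longleftrightarrow> (D has_integral m) UNIV"
      unfolding D_def[abs_def] by (simp add: has_integral_restrict_UNIV)
    also have "\<dots> \<longleftrightarrow> integral\<^sup>N lebesgue D = ennreal m"
    proof -
      have "D \<in> lebesgue \<rightarrow>\<^sub>M borel" by (simp add: measurable_completion)
      then show ?thesis using that by (subst has_integral_iff_nn_integral_lebesgue) (auto simp: D_def)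
    qed
    also have "integral\<^sup>N lebesgue D = integral\<^sup>N lborel D" by (rule nn_integral_completion)
    finally show ?thesis .
  qed
  show ?thesis unfolding nn
  proof (cases "emeasure lborel (T ` B)")
    case (real r) then show "emeasure lborel (T ` B) = integral\<^sup>N lborel D" using eq[of r] by simp
  next
    case top
    show "emeasure lborel (T ` B) = integral\<^sup>N lborel D"
    proof (cases "integral\<^sup>N lborel D")
      case (real r) then show ?thesis using eq[of r] by simp
    qed (use top in simp)
  qed
qed

theorem emeasure_differentiable_image:
  fixes T :: "real ^ 'n::finite \<Rightarrow> real ^ 'n"
  assumes B: "B \<in> sets borel" and TB: "T ` B \<in> sets borel"
    and der: "\<And>x. x \<in> B \<Longrightarrow> (T has_derivative T' x) (at x within B)"
    and inj: "inj_on T B"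
    and g: "g \<in> borel_measurable borel" "\<And>x. x \<in> B \<Longrightarrow> g x = \<bar>det (matrix (T' x))\<bar>"
  shows "emeasure lborel (T ` B) = (\<integral>\<^sup>+x\<in>B. ennreal (g x) \<partial>lborel)"
proof -
  define f where "f = (Rep_idx :: 'n idx \<Rightarrow> 'n)"
  have f: "bij f" unfolding f_def by (metis Abs_idx_inverse Rep_idx_inverse UNIV_I bijI')
  define R where "R = (reindex f :: real ^ 'n \<Rightarrow> real ^ 'n idx)"
  define S where "S = (reindex (inv f) :: real ^ 'n idx \<Rightarrow> real ^ 'n)"
  have RS [simp]: "R (S y) = y" "S (R x) = x" for x y
    using f by (auto simp: vec_eq_iff R_def S_def bij_is_inj bij_is_surj surj_f_inv_f)
  have RM [measurable]: "R \<in> borel_measurable borel" "S \<in> borel_measurable borel"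
    by (simp_all add: R_def S_def)
  have RD: "distr lborel borel R = lborel" "distr lborel borel S = lborel"
    unfolding R_def S_def by (intro lborel_reindex f bij_imp_bij_inv)+
  have Rimg: "R ` X = S -` X" for X by (auto simp: image_iff) (metis RS(1))
  have Rlin: "bounded_linear R" "bounded_linear S" by (simp_all add: R_def S_def bounded_linear_reindex)
  have Rsets: "R ` X \<in> sets borel" if "X \<in> sets borel" for X
    unfolding Rimg using measurable_sets[OF RM(2) that] by simp
  define T2 where "T2 = R \<circ> T \<circ> S"
  define D2 where "D2 y = R \<circ> T' (S y) \<circ> S" for y
  have img: "T2 ` (R ` B) = R ` (T ` B)" by (auto simp: T2_def image_image)
  have "emeasure lborel (T2 ` (R ` B)) = (\<integral>\<^sup>+y\<in>R ` B. ennreal (g (S y)) \<partial>lborel)"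
  proof (rule emeasure_differentiable_image_wellorder)
    show "R ` B \<in> sets borel" "T2 ` R ` B \<in> sets borel" unfolding img using B TB Rsets by auto
    show "(\<lambda>y. g (S y)) \<in> borel_measurable borel" using g(1) by measurable
    show "inj_on T2 (R ` B)" using inj by (auto simp: inj_on_def T2_def) (metis RS(2))
    fix y assume y: "y \<in> R ` B"
    then have Sy: "S y \<in> B" by auto
    have SB: "S ` (R ` B) = B" by (auto simp: image_image)
    have 1: "(S has_derivative S) (at y within R ` B)"
      by (rule bounded_linear_imp_has_derivative[OF Rlin(2)])
    have 2: "(T has_derivative T' (S y)) (at (S y) within S ` (R ` B))" unfolding SB by (rule der[OF Sy])
    have 3: "((T \<circ> S) has_derivative T' (S y) \<circ> S) (at y within R ` B)"
      by (rule diff_chain_within[OF 1 2])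
    have 4: "(R has_derivative R) (at ((T \<circ> S) y) within (T \<circ> S) ` (R ` B))"
      by (rule bounded_linear_imp_has_derivative[OF Rlin(1)])
    show "(T2 has_derivative D2 y) (at y within R ` B)"
      using diff_chain_within[OF 3 4] by (simp add: T2_def D2_def o_def)
    have "det (matrix (D2 y)) = det (matrix (T' (S y)))"
    proof (rule det_reindex[OF f])
      fix i j
      have "S (axis j 1) = axis (f j) 1"
        using f by (auto simp: vec_eq_iff S_def axis_def bij_is_inj bij_is_surj surj_f_inv_f)
          
      then show "matrix (D2 y) $ i $ j = matrix (T' (S y)) $ f i $ f j"
        by (simp add: matrix_def D2_def R_def)
    qed
    then show "g (S y) = \<bar>det (matrix (D2 y))\<bar>" using g(2)[OF Sy] by simp
  qed
  also have "(\<integral>\<^sup>+y\<in>R ` B. ennreal (g (S y)) \<partial>lborel) = (\<integral>\<^sup>+x\<in>B. ennreal (g x) \<partial>distr lborel borel S)"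
    using B g(1) by (subst nn_integral_distr) (auto simp: Rimg indicator_def intro!: nn_integral_cong)
  also have "\<dots> = (\<integral>\<^sup>+x\<in>B. ennreal (g x) \<partial>lborel)" by (simp only: RD)
  also have "emeasure lborel (T2 ` (R ` B)) = emeasure (distr lborel borel R) (R ` (T ` B))"
    by (simp only: img RD)
  also have "\<dots> = emeasure lborel (R -` (R ` (T ` B)))"
    using Rsets[OF TB] by (simp add: emeasure_distr)
  also have "R -` (R ` (T ` B)) = T ` B" by (auto) (metis RS(2) image_eqI)
  finally show ?thesis .
qed

section \<open>Charts and the Riemannian volume\<close>

lemma C_k_on_1D:
  assumes "smooth_on S h" "open S" "x \<in> S"
  shows "(h has_derivative frechet_derivative h (at x)) (at x)"
    and "continuous_on S (\<lambda>x. frechet_derivative h (at x) v)"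
proof -
  have *: "C_k_on (Suc 0) S h" using assms(1) unfolding smooth_on_def by blast
  note C1 = *[unfolded C_k_on.simps(2)]
  have 1: "\<forall>x\<in>S. h differentiable (at x within S)"
    and 2: "\<forall>v. C_k_on 0 S (\<lambda>x. frechet_derivative h (at x within S) v)"
    by (rule conjunct1[OF C1], rule conjunct2[OF C1])
  from 1 have "h differentiable (at x within S)" using assms(3) by blast
  then show "(h has_derivative frechet_derivative h (at x)) (at x)"
    unfolding at_within_open[OF assms(3,2)] frechet_derivative_works .
  have "continuous_on S (\<lambda>x. frechet_derivative h (at x within S) v)" using 2[rule_format, of v] by (simp only: C_k_on.simps(1))
  then show "continuous_on S (\<lambda>x. frechet_derivative h (at x) v)"
    by (rule continuous_on_eq) (simp add: at_within_open[OF _ assms(2)])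
qed

lemma smooth_on_imp_continuous_on: "smooth_on S h \<Longrightarrow> continuous_on S h"
  unfolding smooth_on_def by (metis C_k_on.simps(1))

text \<open>
  The determinant has no zero on the segment from the identity matrix to \<open>G\<close>, all of whose matrices
  are positive definite.
\<close>

lemma det_posdef:
  fixes G :: "real ^ 'n::finite ^ 'n"
  assumes G: "\<And>v. v \<noteq> 0 \<Longrightarrow> 0 < v \<bullet> (G *v v)"
  shows "0 < det G"
proof (rule ccontr)
  assume neg: "\<not> 0 < det G"
  define M where "M t = (1 - t) *\<^sub>R mat 1 + t *\<^sub>R G" for t
  have Mv: "M t *v v = (1 - t) *\<^sub>R v + t *\<^sub>R (G *v v)" for t v
    by (simp add: M_def matrix_vector_mult_add_rdistrib scaleR_matrix_vector_assoc[symmetric])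
  have nz: "det (M t) \<noteq> 0" if t: "0 \<le> t" "t \<le> 1" for t
  proof -
    have "0 < v \<bullet> (M t *v v)" if v: "v \<noteq> 0" for v
    proof (cases "t = 0")
      case True then show ?thesis using v by (simp add: Mv)
    next
      case False
      have "0 \<le> (1 - t) * (v \<bullet> v)" using t by simp
      moreover have "0 < t * (v \<bullet> (G *v v))" using False t G[OF v] by simp
      ultimately show ?thesis by (simp add: Mv inner_add_right)
    qed
    then show ?thesis using posdef_invertible invertible_det_nz by blast
  qed
  have "continuous_on {0..1} (\<lambda>t. det (M t))"
    unfolding det_def M_def by (intro continuous_intros)
  moreover have "M 0 = mat 1" "M 1 = G" by (auto simp: M_def)
  ultimately have "\<exists>t\<ge>0. t \<le> 1 \<and> det (M t) = 0"
    using neg IVT2'[of "\<lambda>t. det (M t)" 1 0 0] by auto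
  then show False using nz by auto
qed

context closed_riemannian_manifold
begin

abbreviation vol :: "'a measure" where "vol \<equiv> riemannian_volume A G"

definition dens :: "('a, 'n) chart \<Rightarrow> real ^ 'n \<Rightarrow> real" where
  "dens c y = vol_density G c (param c y)"

lemma open_dom: "c \<in> A \<Longrightarrow> open (dom_chart c)"
  and open_codom: "c \<in> A \<Longrightarrow> open (codom_chart c)"
  and homeo: "c \<in> A \<Longrightarrow> homeomorphism (dom_chart c) (codom_chart c) (coord c) (param c)"
  and charts_cover: "(\<Union>c\<in>A. dom_chart c) = UNIV"
  using atlas by (auto simp: smooth_atlas_def)

lemma param_coord [simp]: "c \<in> A \<Longrightarrow> x \<in> dom_chart c \<Longrightarrow> param c (coord c x) = x"
  and coord_param [simp]: "c \<in> A \<Longrightarrow> y \<in> codom_chart c \<Longrightarrow> coord c (param c y) = y"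
  and param_dom [simp]: "c \<in> A \<Longrightarrow> y \<in> codom_chart c \<Longrightarrow> param c y \<in> dom_chart c"
  and continuous_coord: "c \<in> A \<Longrightarrow> continuous_on (dom_chart c) (coord c)"
  and continuous_param: "c \<in> A \<Longrightarrow> continuous_on (codom_chart c) (param c)"
  using homeo[of c] by (auto simp: homeomorphism_def)

lemma obtain_chart: obtains c where "c \<in> A" "x \<in> dom_chart c"
  using charts_cover by blast

lemma coord_image_eq: "c \<in> A \<Longrightarrow> B \<subseteq> dom_chart c \<Longrightarrow> coord c ` B = {y \<in> codom_chart c. param c y \<in> B}"
  by (force simp: image_iff)

lemma open_param_image:
  assumes "c \<in> A" "open V" "V \<subseteq> codom_chart c"
  shows "open (param c ` V)"
proof -
  have "param c ` V = dom_chart c \<inter> coord c -` V"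
  proof (intro equalityI subsetI)
    fix x assume "x \<in> param c ` V"
    then show "x \<in> dom_chart c \<inter> coord c -` V" using assms by auto
  next
    fix x assume x: "x \<in> dom_chart c \<inter> coord c -` V"
    then show "x \<in> param c ` V" using assms(1) by (intro image_eqI[of _ _ "coord c x"]) auto
  qed
  then show ?thesis
    using continuous_on_open_vimage[OF open_dom[OF assms(1)]] continuous_coord[OF assms(1)] assms(2)
    by (metis Int_commute)
qed

lemma open_coord_image:
  assumes "c \<in> A" "open V" "V \<subseteq> dom_chart c"
  shows "open (coord c ` V)"
proof -
  have "coord c ` V = codom_chart c \<inter> param c -` V"
    using coord_image_eq[OF assms(1,3)] by auto
  then show ?thesis
    using continuous_on_open_vimage[OF open_codom[OF assms(1)]] continuous_param[OF assms(1)] assms(2)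
    by (metis Int_commute)
qed

lemma metric_sym: "c \<in> A \<Longrightarrow> x \<in> dom_chart c \<Longrightarrow> transpose (G c x) = G c x"
  and metric_pos: "c \<in> A \<Longrightarrow> x \<in> dom_chart c \<Longrightarrow> v \<noteq> 0 \<Longrightarrow> 0 < v \<bullet> (G c x *v v)"
  and metric_smooth: "c \<in> A \<Longrightarrow> smooth_on (codom_chart c) (\<lambda>y. G c (param c y))"
  using metric by (auto simp: riemannian_metric_def)

lemma continuous_metric: "c \<in> A \<Longrightarrow> continuous_on (codom_chart c) (\<lambda>y. G c (param c y))"
  by (rule smooth_on_imp_continuous_on[OF metric_smooth])

lemma vol_density_pos: "c \<in> A \<Longrightarrow> x \<in> dom_chart c \<Longrightarrow> 0 < vol_density G c x"
  unfolding vol_density_def using det_posdef[of "G c x"] metric_pos[of c x] by simp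

lemma dens_pos: "c \<in> A \<Longrightarrow> y \<in> codom_chart c \<Longrightarrow> 0 < dens c y"
  by (simp add: dens_def vol_density_pos)

lemma continuous_dens: "c \<in> A \<Longrightarrow> continuous_on (codom_chart c) (dens c)"
  unfolding dens_def[abs_def] vol_density_def det_def
  by (intro continuous_intros continuous_metric)

definition overlap :: "('a, 'n) chart \<Rightarrow> ('a, 'n) chart \<Rightarrow> (real ^ 'n) set" where
  "overlap c d = coord c ` (dom_chart c \<inter> dom_chart d)"

definition transition :: "('a, 'n) chart \<Rightarrow> ('a, 'n) chart \<Rightarrow> real ^ 'n \<Rightarrow> real ^ 'n" where
  "transition c d = coord d \<circ> param c"

definition chart_jacobian :: "('a, 'n) chart \<Rightarrow> ('a, 'n) chart \<Rightarrow> 'a \<Rightarrow> real ^ 'n ^ 'n" where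
  "chart_jacobian c d x = matrix (frechet_derivative (transition c d) (at (coord c x)))"

lemma open_overlap: "c \<in> A \<Longrightarrow> d \<in> A \<Longrightarrow> open (overlap c d)"
  unfolding overlap_def by (intro open_coord_image) (auto intro: open_dom)

lemma overlap_codom: "overlap c d \<subseteq> codom_chart c"
  by (auto simp: overlap_def)

lemma transition_derivative:
  assumes "c \<in> A" "d \<in> A" "y \<in> overlap c d"
  shows "(transition c d has_derivative (\<lambda>v. chart_jacobian c d (param c y) *v v)) (at y)"
    and "continuous_on (overlap c d) (\<lambda>y. frechet_derivative (transition c d) (at y) v)"
proof -
  have sm: "smooth_on (overlap c d) (transition c d)"
    using assms atlas by (auto simp: smooth_atlas_def overlap_def transition_def)
  have y: "y \<in> codom_chart c" using assms overlap_codom by blast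
  have d: "(transition c d has_derivative frechet_derivative (transition c d) (at y)) (at y)"
    by (rule C_k_on_1D(1)[OF sm open_overlap assms(3)]) fact+
  then show "(transition c d has_derivative (\<lambda>v. chart_jacobian c d (param c y) *v v)) (at y)"
    using has_derivative_linear[OF d] assms(1) y by (simp add: chart_jacobian_def)
  show "continuous_on (overlap c d) (\<lambda>y. frechet_derivative (transition c d) (at y) v)"
    by (rule C_k_on_1D(2)[OF sm open_overlap assms(3)]) fact+
qed

lemma metric_transform:
  assumes "c \<in> A" "d \<in> A" "x \<in> dom_chart c" "x \<in> dom_chart d"
  shows "G c x = transpose (chart_jacobian c d x) ** G d x ** chart_jacobian c d x"
proof -
  have "\<forall>c\<in>A. \<forall>d\<in>A. \<forall>x\<in>dom_chart c \<inter> dom_chart d.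
      let J = matrix (frechet_derivative (coord d \<circ> param c) (at (coord c x)))
      in G c x = transpose J ** G d x ** J"
    using metric unfolding riemannian_metric_def by (elim conjE)
  from bspec[OF bspec[OF bspec[OF this assms(1)] assms(2)] IntI[OF assms(3,4)]]
  show ?thesis unfolding chart_jacobian_def transition_def Let_def .
qed

lemma vol_density_transform:
  assumes "c \<in> A" "d \<in> A" "x \<in> dom_chart c" "x \<in> dom_chart d"
  shows "vol_density G c x = \<bar>det (chart_jacobian c d x)\<bar> * vol_density G d x"
proof -
  have "det (G c x) = (det (chart_jacobian c d x))\<^sup>2 * det (G d x)"
    by (subst metric_transform[OF assms]) (simp add: det_mul det_transpose power2_eq_square)
  then show ?thesis by (simp add: vol_density_def real_sqrt_mult)
qed

lemma transition_overlap:
  assumes "c \<in> A" "d \<in> A" "y \<in> overlap c d"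
  shows "transition c d y \<in> overlap d c"
    and "param d (transition c d y) = param c y"
    and "transition d c (transition c d y) = y"
  using assms by (auto simp: overlap_def transition_def)

lemma continuous_transition:
  assumes "c \<in> A" "d \<in> A"
  shows "continuous_on (overlap c d) (transition c d)"
  by (intro continuous_at_imp_continuous_on ballI)
    (rule has_derivative_continuous[OF transition_derivative(1)[OF assms]])

lemma transition_vimage:
  assumes cd: "c \<in> A" "d \<in> A" and y: "y \<in> overlap c d" and B: "B \<subseteq> dom_chart c \<inter> dom_chart d"
  shows "transition c d y \<in> coord d ` B \<longleftrightarrow> y \<in> coord c ` B"
proof -
  have "y \<in> codom_chart c" "transition c d y \<in> codom_chart d"
    using y transition_overlap(1)[OF cd y] overlap_codom by blast+
  then show ?thesis
    using coord_image_eq[of c B] coord_image_eq[of d B] cd B transition_overlap(2)[OF cd y] by auto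
qed

text \<open>
  The parametrization and the density are extended to Borel functions on the whole space. Since
  \<open>dens0\<close> vanishes outside the chart, the default value of \<open>param0\<close> does not matter.
\<close>

definition param0 :: "('a, 'n) chart \<Rightarrow> real ^ 'n \<Rightarrow> 'a" where
  "param0 c y = (if y \<in> codom_chart c then param c y else undefined)"

definition dens0 :: "('a, 'n) chart \<Rightarrow> real ^ 'n \<Rightarrow> real" where
  "dens0 c y = (if y \<in> codom_chart c then dens c y else 0)"

definition chart_measure :: "('a, 'n) chart \<Rightarrow> 'a measure" where
  "chart_measure c = distr (density lborel (\<lambda>y. ennreal (dens0 c y))) borel (param0 c)"

lemma measurable_param0 [measurable]: "c \<in> A \<Longrightarrow> param0 c \<in> borel_measurable borel"
  unfolding param0_def[abs_def]
  by (intro borel_measurable_continuous_on_if continuous_param continuous_intros borel_open open_codom)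

lemma measurable_dens0 [measurable]: "c \<in> A \<Longrightarrow> dens0 c \<in> borel_measurable borel"
  unfolding dens0_def[abs_def]
  by (intro borel_measurable_continuous_on_if continuous_dens continuous_intros borel_open open_codom)

lemma dens0_nonneg: "c \<in> A \<Longrightarrow> 0 \<le> dens0 c y"
  by (simp add: dens0_def dens_pos less_imp_le)

lemma sets_chart_measure [simp]: "sets (chart_measure c) = sets borel"
  by (simp add: chart_measure_def)

lemma coord_image_borel:
  assumes "c \<in> A" "B \<in> sets borel" "B \<subseteq> dom_chart c"
  shows "coord c ` B \<in> sets borel"
proof -
  have "coord c ` B = codom_chart c \<inter> (param0 c -` B \<inter> space borel)"
    using coord_image_eq[OF assms(1,3)] by (auto simp: param0_def)
  then show ?thesis
    using measurable_sets[OF measurable_param0[OF assms(1)] assms(2)] open_codom[OF assms(1)] by simp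
qed

lemma emeasure_chart_measure:
  assumes c: "c \<in> A" and B: "B \<in> sets borel" "B \<subseteq> dom_chart c"
  shows "emeasure (chart_measure c) B = (\<integral>\<^sup>+y\<in>coord c ` B. ennreal (vol_density G c (param c y)) \<partial>lborel)"
proof -
  have "emeasure (chart_measure c) B
      = (\<integral>\<^sup>+y. ennreal (dens0 c y) * indicator (param0 c -` B \<inter> space borel) y \<partial>lborel)"
    using c B measurable_sets[OF measurable_param0[OF c] B(1)]
    by (simp add: chart_measure_def emeasure_distr emeasure_density)
  also have "\<dots> = (\<integral>\<^sup>+y\<in>coord c ` B. ennreal (vol_density G c (param c y)) \<partial>lborel)"
    by (intro nn_integral_cong)
      (auto simp: indicator_def coord_image_eq[OF c B(2)] dens0_def param0_def dens_def)
  finally show ?thesis .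
qed

text \<open>
  The transition map sends the measure with density \<open>|det J|\<close> on the overlap to Lebesgue measure, by
  \<open>emeasure_differentiable_image\<close>, and \<open>|det J|\<close> is the quotient of the two volume densities.
\<close>

lemma chart_measure_agree:
  assumes c: "c \<in> A" and d: "d \<in> A" and B: "B \<in> sets borel" "B \<subseteq> dom_chart c \<inter> dom_chart d"
  shows "emeasure (chart_measure c) B = emeasure (chart_measure d) B"
proof -
  let ?W = "overlap c d" and ?V = "overlap d c"
  define \<tau> where "\<tau> y = (if y \<in> ?W then transition c d y else 0)" for y
  define g where "g y = (if y \<in> ?W then dens c y / dens d (transition c d y) else 0)" for y
  have W: "open ?W" "open ?V" by (intro open_overlap c d)+
  have [measurable]: "\<tau> \<in> borel_measurable borel"
    unfolding \<tau>_def[abs_def]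
    by (intro borel_measurable_continuous_on_if continuous_transition continuous_intros borel_open W c d)
  have Wc: "?W \<subseteq> codom_chart c" "?V \<subseteq> codom_chart d" by (rule overlap_codom)+
  have tV: "transition c d y \<in> codom_chart d" if "y \<in> ?W" for y
    using transition_overlap(1)[OF c d that] Wc by blast
  have [measurable]: "g \<in> borel_measurable borel"
    unfolding g_def[abs_def]
    by (intro borel_measurable_continuous_on_if continuous_intros borel_open W
        continuous_on_subset[OF continuous_dens[OF c] Wc(1)]
        continuous_on_compose2[OF continuous_dens[OF d] continuous_transition[OF c d]])
      (use tV dens_pos[OF d] in \<open>auto simp: less_imp_neq[THEN not_sym]\<close>)
  have g0: "0 \<le> g y" for y
    using dens_pos[OF c, of y] dens_pos[OF d, OF tV[of y]] Wc by (auto simp: g_def less_imp_le)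
  have gdet: "g y = \<bar>det (matrix (\<lambda>v. chart_jacobian c d (param c y) *v v))\<bar>" if y: "y \<in> ?W" for y
  proof -
    have "param c y \<in> dom_chart c" "param c y \<in> dom_chart d"
      using y c by (auto simp: overlap_def)
    from vol_density_transform[OF c d this] show ?thesis
      using y dens_pos[OF d tV[OF y]] transition_overlap(2)[OF c d y]
      by (simp add: g_def dens_def field_simps)
  qed
  define M where "M = density lborel (\<lambda>y. ennreal (g y))"
  have image: "distr M borel \<tau> = density lborel (indicator ?V)"
  proof (rule measure_eqI)
    show "sets (distr M borel \<tau>) = sets (density lborel (indicator ?V))" by simp
    fix E assume "E \<in> sets (distr M borel \<tau>)"
    then have E [measurable]: "E \<in> sets borel" by simp
    let ?C = "?W \<inter> (\<tau> -` E \<inter> space borel)"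
    have C: "?C \<in> sets borel" using W measurable_sets[OF \<open>\<tau> \<in> borel_measurable borel\<close> E] by auto
    have img: "transition c d ` ?C = ?V \<inter> E"
    proof
      show "transition c d ` ?C \<subseteq> ?V \<inter> E" using transition_overlap(1)[OF c d] by (auto simp: \<tau>_def)
      show "?V \<inter> E \<subseteq> transition c d ` ?C"
      proof
        fix z assume z: "z \<in> ?V \<inter> E"
        have "transition d c z \<in> ?W" "transition c d (transition d c z) = z"
          using transition_overlap[OF d c, of z] z by auto
        then show "z \<in> transition c d ` ?C" using z by (auto simp: \<tau>_def intro!: image_eqI[of _ _ "transition d c z"])
      qed
    qed
    have "emeasure (distr M borel \<tau>) E = (\<integral>\<^sup>+y. ennreal (g y) * indicator (\<tau> -` E \<inter> space borel) y \<partial>lborel)"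
      using measurable_sets[OF \<open>\<tau> \<in> borel_measurable borel\<close> E]
      by (simp add: M_def emeasure_distr emeasure_density)
    also have "\<dots> = (\<integral>\<^sup>+y\<in>?C. ennreal (g y) \<partial>lborel)"
      by (intro nn_integral_cong) (auto simp: indicator_def g_def)
    also have "\<dots> = emeasure lborel (transition c d ` ?C)"
    proof (rule emeasure_differentiable_image[symmetric])
      show "transition c d ` ?C \<in> sets borel" unfolding img using W by auto
      show "(transition c d has_derivative (\<lambda>v. chart_jacobian c d (param c y) *v v)) (at y within ?C)"
        if "y \<in> ?C" for y
        using transition_derivative(1)[OF c d, of y] that by (auto intro: has_derivative_at_withinI)
      show "inj_on (transition c d) ?C"
        using transition_overlap(3)[OF c d] by (intro inj_on_inverseI[of _ "transition d c"]) blast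
    qed (use C gdet in auto)
    also have "\<dots> = emeasure (density lborel (indicator ?V)) E"
      unfolding img using W by (subst emeasure_restricted) auto
    finally show "emeasure (distr M borel \<tau>) E = emeasure (density lborel (indicator ?V)) E" .
  qed
  have Bc: "B \<subseteq> dom_chart c" "B \<subseteq> dom_chart d" using B by auto
  have dB [measurable]: "coord d ` B \<in> sets borel" by (rule coord_image_borel[OF d B(1) Bc(2)])
  have dBV: "coord d ` B \<subseteq> ?V" using B by (auto simp: overlap_def)
  have cBW: "coord c ` B \<subseteq> ?W" using B by (auto simp: overlap_def)
  define F where "F y = ennreal (dens0 d y) * indicator (coord d ` B) y" for y
  have [measurable]: "F \<in> borel_measurable borel" unfolding F_def using d by measurable
  have "emeasure (chart_measure d) B = (\<integral>\<^sup>+y. F y \<partial>lborel)"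
    unfolding emeasure_chart_measure[OF d B(1) Bc(2)]
    using coord_image_eq[OF d Bc(2)]
    by (intro nn_integral_cong) (auto simp: indicator_def F_def dens0_def dens_def)
  also have "\<dots> = (\<integral>\<^sup>+y. F y \<partial>density lborel (indicator ?V))"
    using W dBV[unfolded image_subset_iff] by (subst nn_integral_density) (auto simp: F_def indicator_def intro!: nn_integral_cong)
  also have "\<dots> = (\<integral>\<^sup>+y. F (\<tau> y) \<partial>M)"
    unfolding image[symmetric] by (subst nn_integral_distr) (auto simp: M_def)
  also have "\<dots> = (\<integral>\<^sup>+y. ennreal (g y) * F (\<tau> y) \<partial>lborel)"
    unfolding M_def by (subst nn_integral_density) auto
  also have "\<dots> = (\<integral>\<^sup>+y\<in>coord c ` B. ennreal (vol_density G c (param c y)) \<partial>lborel)"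
  proof (intro nn_integral_cong)
    fix y
    show "ennreal (g y) * F (\<tau> y) = ennreal (vol_density G c (param c y)) * indicator (coord c ` B) y"
    proof (cases "y \<in> ?W")
      case True
      have "g y * dens d (transition c d y) = dens c y"
        using True dens_pos[OF d tV[OF True]] by (simp add: g_def)
      then have "ennreal (g y) * ennreal (dens d (transition c d y)) = ennreal (dens c y)"
        using g0 by (simp flip: ennreal_mult')
      then show ?thesis
        using transition_vimage[OF c d True B(2)] True tV[OF True]
        by (auto simp: F_def \<tau>_def dens0_def indicator_def dens_def)
    next
      case False
      then show ?thesis using cBW by (auto simp: g_def indicator_def)
    qed
  qed
  also have "\<dots> = emeasure (chart_measure c) B"
    by (rule emeasure_chart_measure[OF c B(1) Bc(1), symmetric])
  finally show ?thesis by simp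
qed

definition is_volume :: "'a measure \<Rightarrow> bool" where
  "is_volume \<nu> \<longleftrightarrow> sets \<nu> = sets borel \<and>
     (\<forall>c\<in>A. \<forall>B\<in>sets borel. B \<subseteq> dom_chart c \<longrightarrow>
        emeasure \<nu> B = (\<integral>\<^sup>+y\<in>coord c ` B. ennreal (vol_density G c (param c y)) \<partial>lborel))"

lemma finite_partition_into_charts:
  obtains N :: nat and C :: "nat \<Rightarrow> ('a, 'n) chart" and P :: "nat \<Rightarrow> 'a set"
  where "\<And>i. i < N \<Longrightarrow> C i \<in> A" "\<And>i. i < N \<Longrightarrow> P i \<subseteq> dom_chart (C i)" "\<And>i. P i \<in> sets borel"
    "disjoint_family P" "(\<Union>i<N. P i) = UNIV"
proof -
  obtain F where F: "F \<subseteq> A" "finite F" "UNIV \<subseteq> (\<Union>c\<in>F. dom_chart c)"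
    by (rule compactE_image[OF compact, of A dom_chart]) (use open_dom charts_cover in auto)
  obtain cs where cs: "set cs = F" using finite_list[OF F(2)] by blast
  define D where "D i = (if i < length cs then dom_chart (cs ! i) else {})" for i
  have csA: "cs ! i \<in> A" if "i < length cs" for i using cs F(1) that nth_mem by blast
  show thesis
  proof (rule that[of "length cs" "\<lambda>i. cs ! i" "disjointed D"])
    show "\<And>i. i < length cs \<Longrightarrow> cs ! i \<in> A" by (rule csA)
    show "disjointed D i \<subseteq> dom_chart (cs ! i)" if "i < length cs" for i
      using disjointed_subset[of D i] that by (simp add: D_def)
    have "D i \<in> sets borel" for i using open_dom[OF csA] by (simp add: D_def)
    then have "range D \<subseteq> sets borel" by blast
    from sets.range_disjointed_sets[OF this] show "\<And>i. disjointed D i \<in> sets borel" by auto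
    show "disjoint_family (disjointed D)" by (rule disjoint_family_disjointed)
    have "x \<in> (\<Union>i<length cs. disjointed D i)" for x
    proof -
      have "x \<in> (\<Union>i. D i)" using F(3) cs by (force simp: D_def in_set_conv_nth)
      then have "x \<in> (\<Union>i. disjointed D i)" by (simp add: UN_disjointed_eq)
      then obtain i where i: "x \<in> disjointed D i" by blast
      then have "x \<in> D i" using disjointed_subset[of D i] by blast
      then show ?thesis using i by (auto simp: D_def split: if_splits)
    qed
    then show "(\<Union>i<length cs. disjointed D i) = UNIV" by blast
  qed
qed

lemma emeasure_partition:
  fixes N :: nat
  assumes P: "\<And>i. P i \<in> sets borel" "disjoint_family P" "(\<Union>i<N. P i) = UNIV"
    and m: "sets m = sets borel" and B: "B \<in> sets borel"
  shows "emeasure m B = (\<Sum>i<N. emeasure m (B \<inter> P i))"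
proof -
  have "B = (\<Union>i<N. B \<inter> P i)" using P(3) by blast
  moreover have "(\<Sum>i<N. emeasure m (B \<inter> P i)) = emeasure m (\<Union>i<N. B \<inter> P i)"
    by (rule sum_emeasure) (use P m B in \<open>auto simp: disjoint_family_on_def\<close>)
  ultimately show ?thesis by simp
qed

lemma is_volumeD:
  assumes "is_volume m" "c \<in> A" "B \<in> sets borel" "B \<subseteq> dom_chart c"
  shows "emeasure m B = (\<integral>\<^sup>+y\<in>coord c ` B. ennreal (vol_density G c (param c y)) \<partial>lborel)"
  using assms unfolding is_volume_def by blast

lemma is_volume_unique:
  assumes "is_volume m" "is_volume m'"
  shows "m = m'"
proof (rule measure_eqI)
  obtain N C P where P: "\<And>i. i < N \<Longrightarrow> C i \<in> A" "\<And>i. i < N \<Longrightarrow> P i \<subseteq> dom_chart (C i)"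
    "\<And>i. P i \<in> sets borel" "disjoint_family P" "(\<Union>i<(N::nat). P i) = UNIV"
    by (rule finite_partition_into_charts) (rule that)
  have s: "sets m = sets borel" "sets m' = sets borel" using assms by (auto simp: is_volume_def)
  then show "sets m = sets m'" by simp
  fix B assume "B \<in> sets m"
  then have B: "B \<in> sets borel" using s by simp
  have "emeasure m (B \<inter> P i) = emeasure m' (B \<inter> P i)" if "i < N" for i
  proof -
    have "C i \<in> A" "B \<inter> P i \<in> sets borel" "B \<inter> P i \<subseteq> dom_chart (C i)" using P that B by auto
    then show ?thesis using is_volumeD[OF assms(1)] is_volumeD[OF assms(2)] by simp
  qed
  then show "emeasure m B = emeasure m' B"
    using emeasure_partition[OF P(3-5) s(1) B] emeasure_partition[OF P(3-5) s(2) B] by simp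
qed

text \<open>
  Finitely many chart measures are glued along a Borel partition into subsets of chart domains. On the
  domain of any further chart the glued measure is the measure of that chart by \<open>chart_measure_agree\<close>.
\<close>

lemma is_volume_exists: "\<exists>m. is_volume m"
proof -
  obtain N C P where P: "\<And>i. i < N \<Longrightarrow> C i \<in> A" "\<And>i. i < N \<Longrightarrow> P i \<subseteq> dom_chart (C i)"
    "\<And>i. P i \<in> sets borel" "disjoint_family P" "(\<Union>i<(N::nat). P i) = UNIV"
    by (rule finite_partition_into_charts) (rule that)
  define \<mu> where "\<mu> B = (\<Sum>i<N. emeasure (chart_measure (C i)) (B \<inter> P i))" for B
  define m where "m = measure_of UNIV (sets borel) \<mu>"
  have sets_m: "sets m = sets borel" unfolding m_def
    by (metis sets.sets_measure_of_eq space_borel)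
  have em: "emeasure m B = \<mu> B" if "B \<in> sets borel" for B
    unfolding m_def
  proof (rule emeasure_measure_of_sigma)
    show "sigma_algebra UNIV (sets (borel :: 'a measure))"
      using sets.sigma_algebra_axioms[of "borel :: 'a measure"] by simp
    show "positive (sets borel) \<mu>" by (simp add: positive_def \<mu>_def)
    show "countably_additive (sets borel) \<mu>"
    proof (rule countably_additiveI)
      fix F :: "nat \<Rightarrow> 'a set" assume F: "range F \<subseteq> sets borel" "disjoint_family F"
      have "(\<Sum>k. \<mu> (F k)) = (\<Sum>i<N. \<Sum>k. emeasure (chart_measure (C i)) (F k \<inter> P i))"
        unfolding \<mu>_def by (rule suminf_sum) (rule summableI)
      also have "\<dots> = (\<Sum>i<N. emeasure (chart_measure (C i)) (\<Union>k. F k \<inter> P i))"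
        using F P(3) by (intro sum.cong refl suminf_emeasure) (auto simp: disjoint_family_on_def)
      also have "\<dots> = \<mu> (\<Union> (range F))" unfolding \<mu>_def by simp
      finally show "(\<Sum>k. \<mu> (F k)) = \<mu> (\<Union> (range F))" .
    qed
  qed (rule that)
  have "emeasure m B = (\<integral>\<^sup>+y\<in>coord c ` B. ennreal (vol_density G c (param c y)) \<partial>lborel)"
    if c: "c \<in> A" and B: "B \<in> sets borel" "B \<subseteq> dom_chart c" for c B
  proof -
    have "emeasure m B = (\<Sum>i<N. emeasure (chart_measure (C i)) (B \<inter> P i))"
      using em[OF B(1)] by (simp add: \<mu>_def)
    also have "\<dots> = (\<Sum>i<N. emeasure (chart_measure c) (B \<inter> P i))"
    proof (rule sum.cong[OF refl])
      fix i assume "i \<in> {..<N}"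
      then have "C i \<in> A" "B \<inter> P i \<in> sets borel" "B \<inter> P i \<subseteq> dom_chart (C i) \<inter> dom_chart c"
        using P(1-3)[of i] B by auto
      then show "emeasure (chart_measure (C i)) (B \<inter> P i) = emeasure (chart_measure c) (B \<inter> P i)"
        using chart_measure_agree[OF _ c] by blast
    qed
    also have "\<dots> = emeasure (chart_measure c) B"
      using emeasure_partition[OF P(3-5) sets_chart_measure B(1), of c] by simp
    finally show ?thesis using emeasure_chart_measure[OF c B] by simp
  qed
  then show ?thesis using sets_m unfolding is_volume_def by blast
qed

lemma is_volume_vol: "is_volume vol"
proof -
  have "vol = (THE m. is_volume m)" unfolding riemannian_volume_def is_volume_def ..
  moreover have "is_volume (THE m. is_volume m)"
    using is_volume_exists is_volume_unique by (metis theI)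
  ultimately show ?thesis by simp
qed

lemma sets_vol [simp, measurable_cong]: "sets vol = sets borel"
  and emeasure_vol: "c \<in> A \<Longrightarrow> B \<in> sets borel \<Longrightarrow> B \<subseteq> dom_chart c \<Longrightarrow>
    emeasure vol B = emeasure (chart_measure c) B"
  using is_volume_vol emeasure_chart_measure by (auto simp: is_volume_def)

lemma space_vol [simp]: "space vol = UNIV"
  using sets_eq_imp_space_eq[OF sets_vol] by simp

lemma finite_measure_vol: "finite_measure vol"
proof
  have "\<exists>U. open U \<and> x \<in> U \<and> emeasure vol U < \<infinity>" for x
  proof -
    obtain c where c: "c \<in> A" "x \<in> dom_chart c" by (rule obtain_chart)
    let ?y = "coord c x"
    obtain r where r: "0 < r" "cball ?y r \<subseteq> codom_chart c"
      using open_codom[OF c(1)] c(2) open_contains_cball[of "codom_chart c"] by blast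
    have "bounded (dens c ` cball ?y r)"
      by (intro compact_imp_bounded compact_continuous_image continuous_on_subset[OF continuous_dens r(2)] c)
        auto
    then obtain K where K': "\<forall>y\<in>cball ?y r. \<bar>dens c y\<bar> \<le> K"
      unfolding bounded_iff by auto
    then have K: "dens c y \<le> K" if "y \<in> ball ?y r" for y
      using that by (force simp: abs_le_iff)
    let ?U = "param c ` ball ?y r"
    have sub: "ball ?y r \<subseteq> codom_chart c" using r(2) ball_subset_cball by blast
    have U: "open ?U" by (rule open_param_image[OF c(1) _ sub]) simp
    have Ud: "?U \<subseteq> dom_chart c" using sub c(1) by auto
    have cU: "coord c ` ?U = ball ?y r" using sub c(1) by (force simp: image_iff)
    have "x \<in> ?U" using c r(1) by (intro image_eqI[of _ _ ?y]) auto
    have "emeasure vol ?U = (\<integral>\<^sup>+y\<in>ball ?y r. ennreal (dens c y) \<partial>lborel)"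
      using emeasure_vol[OF c(1) _ Ud] emeasure_chart_measure[OF c(1) _ Ud] U by (simp add: cU dens_def)
    also have "\<dots> \<le> (\<integral>\<^sup>+y. ennreal K * indicator (ball ?y r) y \<partial>lborel)"
      by (intro nn_integral_mono) (auto simp: indicator_def intro!: ennreal_leI K)
    also have "\<dots> = ennreal K * emeasure lborel (ball ?y r)" by (simp add: nn_integral_cmult_indicator)
    also have "\<dots> < \<infinity>" using emeasure_lborel_ball_finite[of ?y r] by (simp add: ennreal_mult_less_top)
    finally show ?thesis using U \<open>x \<in> ?U\<close> by blast
  qed
  then obtain U where U: "\<And>x. open (U x)" "\<And>x. x \<in> U x" "\<And>x. emeasure vol (U x) < \<infinity>" by metis
  obtain X where X: "finite X" "UNIV \<subseteq> (\<Union>x\<in>X. U x)"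
    by (rule compactE_image[OF compact, of UNIV U]) (use U in auto)
  have "emeasure vol UNIV \<le> emeasure vol (\<Union>x\<in>X. U x)" using X(2) by (simp add: top.extremum_unique)
  also have "\<dots> \<le> (\<Sum>x\<in>X. emeasure vol (U x))"
    by (rule emeasure_subadditive_finite) (use X U in auto)
  also have "\<dots> < \<infinity>" using U(3) X(1) by (simp add: less_top)
  finally show "emeasure vol (space vol) \<noteq> \<infinity>" by simp
qed

lemma emeasure_vol_open_pos:
  assumes "open U" "U \<noteq> {}"
  shows "emeasure vol U \<noteq> 0"
proof
  assume 0: "emeasure vol U = 0"
  obtain x where x: "x \<in> U" using assms by blast
  obtain c where c: "c \<in> A" "x \<in> dom_chart c" by (rule obtain_chart)
  let ?V = "U \<inter> dom_chart c"
  have V: "open ?V" "?V \<subseteq> dom_chart c" using assms open_dom[OF c(1)] by auto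
  have cV: "open (coord c ` ?V)" "coord c ` ?V \<noteq> {}"
    using open_coord_image[OF c(1) V] x c by auto
  have sub: "coord c ` ?V \<subseteq> codom_chart c" by blast
  have "emeasure vol ?V \<le> emeasure vol U" by (rule emeasure_mono) (use assms in auto)
  then have "emeasure vol ?V = 0" using 0 by simp
  then have "(\<integral>\<^sup>+y\<in>coord c ` ?V. ennreal (dens0 c y) \<partial>lborel) = 0"
  proof -
    have "(\<integral>\<^sup>+y\<in>coord c ` ?V. ennreal (dens0 c y) \<partial>lborel) = emeasure vol ?V"
      using emeasure_vol[OF c(1) _ V(2)] emeasure_chart_measure[OF c(1) _ V(2)] V(1) sub
      by (auto simp: indicator_def dens0_def dens_def intro!: nn_integral_cong)
    then show ?thesis using \<open>emeasure vol ?V = 0\<close> by simp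
  qed
  then have "AE y in lborel. ennreal (dens0 c y) * indicator (coord c ` ?V) y = 0"
    using c(1) cV(1) by (subst (asm) nn_integral_0_iff_AE) auto
  then have "AE y in lborel. y \<notin> coord c ` ?V"
  proof eventually_elim
    case (elim y)
    show ?case
    proof
      assume y: "y \<in> coord c ` ?V"
      then have "0 < dens0 c y" using sub dens_pos[OF c(1)] by (auto simp: dens0_def)
      then show False using elim y by (simp add: indicator_def)
    qed
  qed
  then have "coord c ` ?V \<in> null_sets lborel"
    using cV(1) by (subst AE_iff_null_sets) auto
  then have "negligible (coord c ` ?V)"
    unfolding negligible_iff_null_sets by (rule null_sets_completionI)
  then show False using open_not_negligible[OF cV] by simp
qed

text \<open>
  The restriction of the volume to a chart domain is the chart measure, the image of a measure with a
  density.
\<close>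

lemma integral_vol_chart:
  fixes F :: "'a \<Rightarrow> real"
  assumes c: "c \<in> A" and F [measurable]: "F \<in> borel_measurable borel"
    and supp: "\<And>x. x \<notin> dom_chart c \<Longrightarrow> F x = 0"
  shows "integral\<^sup>L vol F = (LINT y|lborel. dens0 c y * F (param0 c y))"
proof -
  have dc [measurable]: "dom_chart c \<in> sets borel" using open_dom[OF c] by simp
  have [measurable]: "param0 c \<in> borel_measurable borel" "dens0 c \<in> borel_measurable borel"
    using c by measurable
  have "density vol (indicator (dom_chart c)) = chart_measure c"
  proof (rule measure_eqI)
    show "sets (density vol (indicator (dom_chart c))) = sets (chart_measure c)" by simp
    fix B assume "B \<in> sets (density vol (indicator (dom_chart c)))"
    then have B [measurable]: "B \<in> sets borel" by simp
    have 1: "emeasure (density vol (indicator (dom_chart c))) B = emeasure vol (dom_chart c \<inter> B)"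
      by (rule emeasure_restricted) simp_all
    have 2: "emeasure (chart_measure c) (B - dom_chart c) = 0"
    proof -
      have "emeasure (chart_measure c) (B - dom_chart c)
          = (\<integral>\<^sup>+y\<in>param0 c -` (B - dom_chart c). ennreal (dens0 c y) \<partial>lborel)"
        using measurable_sets[OF measurable_param0[OF c], of "B - dom_chart c"]
        by (simp add: chart_measure_def emeasure_distr emeasure_density)
      also have "\<dots> = (\<integral>\<^sup>+y. 0 \<partial>(lborel :: (real ^ 'n) measure))"
        by (intro nn_integral_cong) (auto simp: indicator_def dens0_def param0_def c)
      finally show ?thesis by simp
    qed
    have "emeasure (chart_measure c) B = emeasure (chart_measure c) ((dom_chart c \<inter> B) \<union> (B - dom_chart c))"
      by (rule arg_cong[where f = "emeasure _"]) blast
    also have "\<dots> = emeasure (chart_measure c) (dom_chart c \<inter> B) + emeasure (chart_measure c) (B - dom_chart c)"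
      by (rule plus_emeasure[symmetric]) auto
    finally show "emeasure (density vol (indicator (dom_chart c))) B = emeasure (chart_measure c) B"
      using 1 2 emeasure_vol[OF c, of "dom_chart c \<inter> B"] by simp
  qed
  then have "integral\<^sup>L (chart_measure c) F = integral\<^sup>L (density vol (\<lambda>x. ennreal (indicator (dom_chart c) x))) F"
    by (simp add: ennreal_indicator)
  also have "\<dots> = (LINT x|vol. indicator (dom_chart c) x *\<^sub>R F x)"
    by (rule integral_density) auto
  also have "\<dots> = integral\<^sup>L vol F"
    by (rule Bochner_Integration.integral_cong) (auto simp: indicator_def supp)
  also have "integral\<^sup>L (chart_measure c) F = (LINT y|density lborel (\<lambda>y. ennreal (dens0 c y)). F (param0 c y))"
    unfolding chart_measure_def by (rule integral_distr) auto
  also have "\<dots> = (LINT y|lborel. dens0 c y * F (param0 c y))"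
    using dens0_nonneg[OF c] by (subst integral_density) auto
  finally show ?thesis by simp
qed

end

section \<open>Continuously differentiable functions and the divergence inequality\<close>

lemma linear_functional_eq_inner:
  fixes f :: "real ^ 'n::finite \<Rightarrow> real"
  assumes "linear f"
  shows "f v = (\<chi> i. f (axis i 1)) \<bullet> v"
proof -
  have "f v = f (\<Sum>i\<in>UNIV. v $ i *\<^sub>R axis i 1)"
    using basis_expansion[of v] unfolding scalar_mult_eq_scaleR by simp
  also have "\<dots> = (\<Sum>i\<in>UNIV. v $ i * f (axis i 1))"
    by (simp add: linear_sum[OF assms] linear_cmul[OF assms])
  finally show ?thesis by (simp add: inner_vec_def mult.commute)
qed

text \<open>
  The radial profile of the bump functions below, which have to be continuously differentiable only
  once.
\<close>

lemma has_derivative_plus_part_square: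
  "((\<lambda>s::real. (max 0 s)\<^sup>2) has_real_derivative 2 * max 0 s) (at s)"
proof (cases s "0::real" rule: linorder_cases)
  case less
  have "((\<lambda>s::real. 0) has_real_derivative 2 * max 0 s) (at s)" using less by simp
  then show ?thesis
    by (rule has_field_derivative_transform_within_open[of _ _ _ "{..<0}"]) (use less in auto)
next
  case greater
  have "((\<lambda>s::real. s\<^sup>2) has_real_derivative 2 * max 0 s) (at s)"
    using greater by (auto intro!: derivative_eq_intros)
  then show ?thesis
    by (rule has_field_derivative_transform_within_open[of _ _ _ "{0<..}"]) (use greater in auto)
next
  case equal
  have "((\<lambda>y::real. (max 0 y)\<^sup>2 / y) \<longlongrightarrow> 0) (at 0)"
  proof (rule Lim_null_comparison)
    show "((\<lambda>y::real. \<bar>y\<bar>) \<longlongrightarrow> 0) (at 0)" by (auto intro!: tendsto_eq_intros)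
    show "\<forall>\<^sub>F y::real in at 0. norm ((max 0 y)\<^sup>2 / y) \<le> \<bar>y\<bar>"
      by (rule always_eventually) (auto simp: max_def power2_eq_square)
  qed
  then show ?thesis using equal by (simp add: has_field_derivative_iff)
qed

text \<open>
  A cube that contains the support in its interior has no flux.
\<close>

lemma integral_le_0_of_le_trace:
  fixes Y :: "real ^ 'n::finite \<Rightarrow> real ^ 'n"
  assumes K: "compact K"
    and Y: "\<And>y. (Y has_derivative DY y) (at y)" "\<And>y. y \<notin> K \<Longrightarrow> Y y = 0"
    and h: "continuous_on UNIV h" "\<And>y. y \<notin> K \<Longrightarrow> h y = 0"
    and le: "\<And>y. h y \<le> (\<Sum>i\<in>UNIV. DY y (axis i 1) $ i)"
  shows "(LINT y|lborel. h y) \<le> 0"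
proof -
  obtain M where M: "0 < M" "K \<subseteq> ball 0 M"
    using bounded_subset_ballD[OF compact_imp_bounded[OF K], of 0] by auto
  define c :: "real ^ 'n" where "c = - vec M"
  define d where "d = c + vec (2 * M)"
  have c: "c $ i = - M" "d $ i = M" for i by (auto simp: c_def d_def)
  have face: "Y (set_coord y i s) = 0" if "\<bar>s\<bar> = M" for y i s
  proof (rule Y(2))
    have "\<bar>set_coord y i s $ i\<bar> \<le> norm (set_coord y i s)" by (rule component_le_norm_cart)
    then show "set_coord y i s \<notin> K" using that M by auto
  qed
  have flux: "box_flux Y c d = 0"
    using M by (simp add: box_flux_def c face)
  have KQ: "y \<in> cbox c d" if "y \<in> K" for y
  proof -
    have "\<bar>y $ i\<bar> \<le> M" for i
      using component_le_norm_cart[of y i] M(2) that by (force simp: less_imp_le)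
    then show ?thesis by (auto simp: mem_box_cart c abs_le_iff minus_le_iff)
  qed
  have hQ: "continuous_on (cbox c d) h" using h(1) by (rule continuous_on_subset) simp
  have "integral (cbox c d) h \<le> box_flux Y c d"
    unfolding d_def by (rule box_flux_ge_integral) (use M Y le hQ in \<open>auto simp: d_def\<close>)
  moreover have "set_integrable lborel (cbox c d) h"
    unfolding set_integrable_def by (rule borel_integrable_compact) (use hQ in auto)
  then have "(LINT y:cbox c d|lborel. h y) = integral (cbox c d) h"
    by (rule set_borel_integral_eq_integral)
  moreover have "(LINT y:cbox c d|lborel. h y) = (LINT y|lborel. h y)"
    unfolding set_lebesgue_integral_def
    by (rule Bochner_Integration.integral_cong) (use h(2) KQ in \<open>auto simp: indicator_def\<close>)
  ultimately show ?thesis using flux by simp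
qed

context closed_riemannian_manifold
begin

lemma continuous_on_chartsI:
  assumes "\<And>c. c \<in> A \<Longrightarrow> continuous_on (codom_chart c) (\<lambda>y. F (param c y))"
  shows "continuous_on UNIV F"
proof -
  have "continuous_on (dom_chart c) F" if c: "c \<in> A" for c
  proof -
    have "continuous_on (dom_chart c) (\<lambda>x. F (param c (coord c x)))"
      by (rule continuous_on_compose2[OF assms[OF c] continuous_coord[OF c]]) auto
    then show ?thesis by (rule continuous_on_eq) (use c in auto)
  qed
  then have "continuous_on (\<Union>c\<in>A. dom_chart c) F"
    by (intro continuous_on_open_UN) (auto intro: open_dom)
  then show ?thesis by (simp add: charts_cover)
qed

lemma continuous_on_param:
  "continuous_on UNIV F \<Longrightarrow> c \<in> A \<Longrightarrow> continuous_on (codom_chart c) (\<lambda>y. F (param c y))"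
  by (rule continuous_on_compose2[OF _ continuous_param]) auto

lemma integrable_vol_continuous:
  fixes F :: "'a \<Rightarrow> real"
  assumes "continuous_on UNIV F"
  shows "integrable vol F"
proof -
  interpret finite_measure vol by (rule finite_measure_vol)
  have "bounded (F ` UNIV)" by (intro compact_imp_bounded compact_continuous_image assms compact)
  then obtain B where "\<forall>x\<in>UNIV. norm (F x) \<le> B" unfolding bounded_iff by auto
  then show ?thesis
    by (intro integrable_const_bound[of _ B] AE_I2) (use borel_measurable_continuous_onI[OF assms] in auto)
qed

text \<open>
  The differential of \<open>\<phi>\<close> at \<open>x\<close> in the coordinates of the chart \<open>c\<close>.
\<close>

definition dcoord :: "('a, 'n) chart \<Rightarrow> ('a \<Rightarrow> real) \<Rightarrow> 'a \<Rightarrow> real ^ 'n" where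
  "dcoord c \<phi> x = (\<chi> i. frechet_derivative (\<phi> \<circ> param c) (at (coord c x)) (axis i 1))"

definition C1_fun :: "('a \<Rightarrow> real) \<Rightarrow> bool" where
  "C1_fun \<phi> \<longleftrightarrow> (\<forall>c\<in>A. (\<forall>y\<in>codom_chart c. (\<phi> \<circ> param c) differentiable (at y)) \<and>
     continuous_on (codom_chart c) (\<lambda>y. dcoord c \<phi> (param c y)))"

lemma dcoord_eqI:
  assumes "c \<in> A" "y \<in> codom_chart c" "((\<lambda>y. \<phi> (param c y)) has_derivative (\<lambda>v. w \<bullet> v)) (at y)"
  shows "dcoord c \<phi> (param c y) = w"
proof -
  have "((\<phi> \<circ> param c) has_derivative (\<lambda>v. w \<bullet> v)) (at (coord c (param c y)))"
    using assms by (simp add: o_def)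
  then have "(\<lambda>v. w \<bullet> v) = frechet_derivative (\<phi> \<circ> param c) (at (coord c (param c y)))"
    by (rule frechet_derivative_at)
  then show ?thesis
    unfolding dcoord_def by (simp add: vec_eq_iff inner_axis flip: \<open>(\<lambda>v. w \<bullet> v) = _\<close>)
qed

lemma C1_has_derivative:
  assumes "C1_fun \<phi>" "c \<in> A" "y \<in> codom_chart c"
  shows "((\<lambda>y. \<phi> (param c y)) has_derivative (\<lambda>v. dcoord c \<phi> (param c y) \<bullet> v)) (at y)"
proof -
  have "(\<phi> \<circ> param c) differentiable (at y)" using assms by (auto simp: C1_fun_def)
  then have d: "((\<phi> \<circ> param c) has_derivative frechet_derivative (\<phi> \<circ> param c) (at y)) (at y)"
    using frechet_derivative_works by blast
  have "frechet_derivative (\<phi> \<circ> param c) (at y) = (\<lambda>v. dcoord c \<phi> (param c y) \<bullet> v)"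
  proof
    show "frechet_derivative (\<phi> \<circ> param c) (at y) v = dcoord c \<phi> (param c y) \<bullet> v" for v
      using linear_functional_eq_inner[OF has_derivative_linear[OF d], of v] assms
      by (simp add: dcoord_def)
  qed
  with d show ?thesis by (simp add: o_def)
qed

lemma C1_continuous_dcoord:
  "C1_fun \<phi> \<Longrightarrow> c \<in> A \<Longrightarrow> continuous_on (codom_chart c) (\<lambda>y. dcoord c \<phi> (param c y))"
  by (simp add: C1_fun_def)

lemma C1_I:
  assumes D: "\<And>c y. c \<in> A \<Longrightarrow> y \<in> codom_chart c \<Longrightarrow>
      ((\<lambda>y. \<phi> (param c y)) has_derivative (\<lambda>v. D c y \<bullet> v)) (at y)"
    and cont: "\<And>c. c \<in> A \<Longrightarrow> continuous_on (codom_chart c) (D c)"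
  shows "C1_fun \<phi>"
  unfolding C1_fun_def
proof (intro ballI conjI)
  fix c assume c: "c \<in> A"
  show "(\<phi> \<circ> param c) differentiable (at y)" if "y \<in> codom_chart c" for y
    using D[OF c that] unfolding differentiable_def o_def by blast
  show "continuous_on (codom_chart c) (\<lambda>y. dcoord c \<phi> (param c y))"
    by (rule continuous_on_eq[OF cont[OF c]]) (rule dcoord_eqI[OF c _ D[OF c], symmetric])
qed

lemma C1_continuous: "C1_fun \<phi> \<Longrightarrow> continuous_on UNIV \<phi>"
  by (intro continuous_on_chartsI continuous_at_imp_continuous_on ballI)
    (rule has_derivative_continuous[OF C1_has_derivative])

lemma
  assumes "C1_fun \<phi>" "C1_fun \<psi>"
  shows C1_add: "C1_fun (\<lambda>x. \<phi> x + \<psi> x)"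
    and dcoord_add: "c \<in> A \<Longrightarrow> x \<in> dom_chart c \<Longrightarrow>
      dcoord c (\<lambda>x. \<phi> x + \<psi> x) x = dcoord c \<phi> x + dcoord c \<psi> x"
    and C1_mult: "C1_fun (\<lambda>x. \<phi> x * \<psi> x)"
    and C1_divide: "(\<And>x. \<psi> x \<noteq> 0) \<Longrightarrow> C1_fun (\<lambda>x. \<phi> x / \<psi> x)"
proof -
  note d = C1_has_derivative[OF assms(1)] C1_has_derivative[OF assms(2)]
  note cont = C1_continuous_dcoord[OF assms(1)] C1_continuous_dcoord[OF assms(2)]
    continuous_on_param[OF C1_continuous[OF assms(1)]] continuous_on_param[OF C1_continuous[OF assms(2)]]
  have add: "((\<lambda>y. \<phi> (param c y) + \<psi> (param c y)) has_derivative
      (\<lambda>v. (dcoord c \<phi> (param c y) + dcoord c \<psi> (param c y)) \<bullet> v)) (at y)"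
    if "c \<in> A" "y \<in> codom_chart c" for c y
    using has_derivative_add[OF d(1)[OF that] d(2)[OF that]] by (simp add: inner_add_left)
  show "C1_fun (\<lambda>x. \<phi> x + \<psi> x)"
    by (rule C1_I[OF add]) (auto intro!: continuous_intros cont)
  show "dcoord c (\<lambda>x. \<phi> x + \<psi> x) x = dcoord c \<phi> x + dcoord c \<psi> x" if "c \<in> A" "x \<in> dom_chart c"
    using dcoord_eqI[of c "coord c x" "\<lambda>x. \<phi> x + \<psi> x", OF _ _ add] that by simp
  show "C1_fun (\<lambda>x. \<phi> x * \<psi> x)"
  proof (rule C1_I)
    show "((\<lambda>y. \<phi> (param c y) * \<psi> (param c y)) has_derivative
      (\<lambda>v. (\<phi> (param c y) *\<^sub>R dcoord c \<psi> (param c y) + \<psi> (param c y) *\<^sub>R dcoord c \<phi> (param c y)) \<bullet> v)) (at y)"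
      if "c \<in> A" "y \<in> codom_chart c" for c y
      using has_derivative_mult[OF d(1)[OF that] d(2)[OF that]]
      by (rule has_derivative_eq_rhs) (simp add: fun_eq_iff inner_add_left algebra_simps)
  qed (auto intro!: continuous_intros cont)
  show "C1_fun (\<lambda>x. \<phi> x / \<psi> x)" if nz: "\<And>x. \<psi> x \<noteq> 0"
  proof (rule C1_I)
    show "((\<lambda>y. \<phi> (param c y) / \<psi> (param c y)) has_derivative
      (\<lambda>v. ((1 / \<psi> (param c y)) *\<^sub>R dcoord c \<phi> (param c y)
        - (\<phi> (param c y) / (\<psi> (param c y))\<^sup>2) *\<^sub>R dcoord c \<psi> (param c y)) \<bullet> v)) (at y)"
      if "c \<in> A" "y \<in> codom_chart c" for c y
      using has_derivative_divide'[OF d(1)[OF that] d(2)[OF that] nz]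
      by (rule has_derivative_eq_rhs)
        (simp add: fun_eq_iff inner_diff_left power2_eq_square divide_simps nz)
  qed (use nz in \<open>auto intro!: continuous_intros cont\<close>)
qed

lemma
  assumes "C1_fun \<phi>"
  shows C1_scale: "C1_fun (\<lambda>x. k * \<phi> x)"
    and dcoord_scale: "c \<in> A \<Longrightarrow> x \<in> dom_chart c \<Longrightarrow> dcoord c (\<lambda>x. k * \<phi> x) x = k *\<^sub>R dcoord c \<phi> x"
proof -
  have scale: "((\<lambda>y. k * \<phi> (param c y)) has_derivative (\<lambda>v. (k *\<^sub>R dcoord c \<phi> (param c y)) \<bullet> v)) (at y)"
    if "c \<in> A" "y \<in> codom_chart c" for c y
    using has_derivative_mult_right[OF C1_has_derivative[OF assms that], of k] by simp
  show "C1_fun (\<lambda>x. k * \<phi> x)"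
    by (rule C1_I[OF scale]) (auto intro!: continuous_intros C1_continuous_dcoord assms)
  show "dcoord c (\<lambda>x. k * \<phi> x) x = k *\<^sub>R dcoord c \<phi> x" if "c \<in> A" "x \<in> dom_chart c"
    using dcoord_eqI[of c "coord c x" "\<lambda>x. k * \<phi> x", OF _ _ scale] that by simp
qed

lemma
  shows C1_zero: "C1_fun (\<lambda>x. 0)"
    and dcoord_zero: "c \<in> A \<Longrightarrow> x \<in> dom_chart c \<Longrightarrow> dcoord c (\<lambda>x. 0) x = 0"
proof -
  have d: "((\<lambda>y. 0::real) has_derivative (\<lambda>v. (0 :: real ^ 'n) \<bullet> v)) (at y)" for y :: "real ^ 'n"
    by simp
  show "C1_fun (\<lambda>x. 0)" by (rule C1_I[OF d]) auto
  show "dcoord c (\<lambda>x. 0) x = 0" if "c \<in> A" "x \<in> dom_chart c"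
    using dcoord_eqI[of c "coord c x" "\<lambda>x. 0", OF _ _ d] that by simp
qed

lemma
  assumes "finite I" "\<And>i. i \<in> I \<Longrightarrow> C1_fun (\<phi> i)"
  shows C1_sum: "C1_fun (\<lambda>x. \<Sum>i\<in>I. \<phi> i x)"
    and dcoord_sum: "c \<in> A \<Longrightarrow> x \<in> dom_chart c \<Longrightarrow> dcoord c (\<lambda>x. \<Sum>i\<in>I. \<phi> i x) x = (\<Sum>i\<in>I. dcoord c (\<phi> i) x)"
proof -
  have "C1_fun (\<lambda>x. \<Sum>i\<in>I. \<phi> i x) \<and> (\<forall>c\<in>A. \<forall>x\<in>dom_chart c.
      dcoord c (\<lambda>x. \<Sum>i\<in>I. \<phi> i x) x = (\<Sum>i\<in>I. dcoord c (\<phi> i) x))"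
    using assms
  proof (induction I rule: finite_induct)
    case empty then show ?case by (simp add: C1_zero dcoord_zero)
  next
    case (insert i I)
    then have "C1_fun (\<phi> i)" "C1_fun (\<lambda>x. \<Sum>i\<in>I. \<phi> i x)" by auto
    from C1_add[OF this] dcoord_add[OF this] insert show ?case by simp
  qed
  then show "C1_fun (\<lambda>x. \<Sum>i\<in>I. \<phi> i x)"
    "c \<in> A \<Longrightarrow> x \<in> dom_chart c \<Longrightarrow> dcoord c (\<lambda>x. \<Sum>i\<in>I. \<phi> i x) x = (\<Sum>i\<in>I. dcoord c (\<phi> i) x)"
    by auto
qed

lemma dcoord_eq_0:
  assumes c: "c \<in> A" "x \<in> dom_chart c" and U: "open U" "x \<in> U" "\<And>z. z \<in> U \<Longrightarrow> \<phi> z = 0"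
  shows "dcoord c \<phi> x = 0"
proof -
  let ?V = "coord c ` (U \<inter> dom_chart c)"
  have V: "open ?V" by (rule open_coord_image[OF c(1)]) (use U open_dom[OF c(1)] in auto)
  have d: "((\<lambda>y. 0::real) has_derivative (\<lambda>v. (0 :: real ^ 'n) \<bullet> v)) (at (coord c x))" by simp
  have "((\<lambda>y. \<phi> (param c y)) has_derivative (\<lambda>v. 0 \<bullet> v)) (at (coord c x))"
    by (rule has_derivative_transform_within_open[OF d V]) (use c U in auto)
  from dcoord_eqI[OF c(1) _ this] show ?thesis using c by simp
qed

lemma dcoord_transform:
  assumes \<phi>: "C1_fun \<phi>" and cd: "c \<in> A" "d \<in> A" "x \<in> dom_chart c" "x \<in> dom_chart d"
  shows "dcoord c \<phi> x = transpose (chart_jacobian c d x) *v dcoord d \<phi> x"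
proof -
  let ?y = "coord c x" and ?J = "chart_jacobian c d x"
  have y: "?y \<in> overlap c d" "?y \<in> codom_chart c" using cd by (auto simp: overlap_def)
  have ty: "transition c d ?y = coord d x" using cd by (simp add: transition_def)
  have "((\<lambda>y. \<phi> (param d y)) has_derivative (\<lambda>v. dcoord d \<phi> x \<bullet> v)) (at (transition c d ?y))"
    using C1_has_derivative[OF \<phi> cd(2), of "coord d x"] cd unfolding ty by simp
  from has_derivative_compose[OF transition_derivative(1)[OF cd(1,2) y(1)] this]
  have "((\<lambda>y. \<phi> (param d (transition c d y))) has_derivative (\<lambda>v. dcoord d \<phi> x \<bullet> (?J *v v))) (at ?y)"
    using cd by simp
  then have "((\<lambda>y. \<phi> (param c y)) has_derivative (\<lambda>v. dcoord d \<phi> x \<bullet> (?J *v v))) (at ?y)"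
    by (rule has_derivative_transform_within_open[OF _ open_overlap[OF cd(1,2)] y(1)])
      (simp add: transition_overlap(2)[OF cd(1,2)])
  then have "((\<lambda>y. \<phi> (param c y)) has_derivative (\<lambda>v. (transpose ?J *v dcoord d \<phi> x) \<bullet> v)) (at ?y)"
    by (simp add: dot_lmul_matrix transpose_matrix_vector)
  from dcoord_eqI[OF cd(1) y(2) this] show ?thesis using cd by simp
qed

text \<open>
  In the chart \<open>c\<close> the function is \<open>(max 0 (r^2 - |y - y0|^2))^2\<close>, and it is 0 outside the chart domain.
  Its support is compact, hence closed, so in every other chart the function is 0 near the points outside
  the domain of \<open>c\<close>.
\<close>

lemma exists_bump:
  assumes c: "c \<in> A" and x: "x \<in> dom_chart c"
  shows "\<exists>\<phi> K. C1_fun \<phi> \<and> (\<forall>z. 0 \<le> \<phi> z) \<and> 0 < \<phi> x \<and> compact K \<and> K \<subseteq> codom_chart c \<and>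
    (\<forall>z. z \<notin> param c ` K \<longrightarrow> \<phi> z = 0)"
proof -
  define y0 where "y0 = coord c x"
  obtain r where r: "0 < r" "cball y0 r \<subseteq> codom_chart c"
    using open_codom[OF c] x open_contains_cball[of "codom_chart c"] unfolding y0_def by blast
  define q where "q y = r\<^sup>2 - (y - y0) \<bullet> (y - y0)" for y
  define b where "b y = (max 0 (q y))\<^sup>2" for y
  define Db where "Db y = (- 4 * max 0 (q y)) *\<^sub>R (y - y0)" for y
  have b: "(b has_derivative (\<lambda>v. Db y \<bullet> v)) (at y)" for y
  proof -
    have "(q has_derivative (\<lambda>v. - ((y - y0) \<bullet> v + v \<bullet> (y - y0)))) (at y)"
      unfolding q_def[abs_def] by (auto intro!: derivative_eq_intros)
    from has_derivative_compose[OF this has_derivative_plus_part_square[unfolded has_field_derivative_def]]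
    show ?thesis unfolding b_def[abs_def]
      by (rule has_derivative_eq_rhs) (simp add: fun_eq_iff Db_def inner_commute)
  qed
  have Dbc: "continuous_on UNIV Db" unfolding Db_def[abs_def] q_def by (intro continuous_intros)
  have qneg: "q y \<le> 0" if "y \<notin> cball y0 r" for y
  proof -
    have "r < norm (y - y0)" using that by (simp add: dist_norm norm_minus_commute)
    then have "r\<^sup>2 \<le> (norm (y - y0))\<^sup>2" using r(1) by (intro power_mono) auto
    then show ?thesis by (simp add: q_def power2_norm_eq_inner)
  qed
  define \<phi> where "\<phi> z = (if z \<in> dom_chart c then b (coord c z) else 0)" for z
  define S where "S = param c ` cball y0 r"
  have Scl: "closed S" unfolding S_def
    by (intro compact_imp_closed compact_continuous_image continuous_on_subset[OF continuous_param[OF c] r(2)]) simp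
  have Sdom: "S \<subseteq> dom_chart c" using r(2) c by (auto simp: S_def)
  have \<phi>0: "\<phi> z = 0" if "z \<notin> S" for z
  proof (cases "z \<in> dom_chart c")
    case True
    then have "coord c z \<notin> cball y0 r" using that c by (force simp: S_def image_iff)
    then show ?thesis using qneg by (simp add: \<phi>_def b_def)
  qed (simp add: \<phi>_def)
  define D where "D d y = (if y \<in> overlap d c
      then transpose (chart_jacobian d c (param d y)) *v Db (transition d c y) else 0)" for d y
  have "C1_fun \<phi>"
  proof (rule C1_I)
    fix d assume d: "d \<in> A"
    let ?O = "{y \<in> codom_chart d. param d y \<notin> S}"
    have "codom_chart d \<inter> param d -` (- S) = ?O" by auto
    moreover have "open (codom_chart d \<inter> param d -` (- S))"
      using continuous_on_open_vimage[OF open_codom[OF d]] continuous_param[OF d] Scl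
      by (metis Int_commute open_Compl)
    ultimately have O: "open ?O" by simp
    have un: "codom_chart d = overlap d c \<union> ?O"
      using Sdom d by (auto simp: overlap_def image_iff)
    have DO: "D d y = 0" if "y \<in> ?O" for y
    proof (cases "y \<in> overlap d c")
      case True
      have "transition d c y \<notin> cball y0 r"
      proof
        assume "transition d c y \<in> cball y0 r"
        then have "param c (transition d c y) \<in> S" unfolding S_def by (rule imageI)
        then show False using that transition_overlap(2)[OF d c True] by simp
      qed
      then have "Db (transition d c y) = 0" using qneg by (simp add: Db_def)
      then show ?thesis by (simp add: D_def)
    qed (simp add: D_def)
    show "((\<lambda>y. \<phi> (param d y)) has_derivative (\<lambda>v. D d y \<bullet> v)) (at y)" if y: "y \<in> codom_chart d" for y
    proof (cases "y \<in> overlap d c")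
      case True
      let ?J = "chart_jacobian d c (param d y)"
      have "((\<lambda>y. b (transition d c y)) has_derivative (\<lambda>v. Db (transition d c y) \<bullet> (?J *v v))) (at y)"
        by (rule has_derivative_compose[OF transition_derivative(1)[OF d c True] b])
      then have "((\<lambda>y. b (transition d c y)) has_derivative (\<lambda>v. D d y \<bullet> v)) (at y)"
        using True by (simp add: D_def dot_lmul_matrix transpose_matrix_vector)
      then show ?thesis
        by (rule has_derivative_transform_within_open[OF _ open_overlap[OF d c] True])
          (use d in \<open>auto simp: \<phi>_def overlap_def transition_def\<close>)
    next
      case False
      then have yO: "y \<in> ?O" using un y by blast
      have "((\<lambda>y. 0::real) has_derivative (\<lambda>v. D d y \<bullet> v)) (at y)" using DO[OF yO] by simp
      then show ?thesis
        by (rule has_derivative_transform_within_open[OF _ O yO]) (simp add: \<phi>0)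
    qed
    have "continuous_on (overlap d c) (\<lambda>y. transpose (chart_jacobian d c (param d y)) *v Db (transition d c y))"
    proof -
      have cJ: "continuous_on (overlap d c) (\<lambda>y. chart_jacobian d c (param d y) $ i $ j)" for i j
      proof -
        have "continuous_on (overlap d c) (\<lambda>y. frechet_derivative (transition d c) (at y) (axis j 1) $ i)"
        proof (cases "overlap d c = {}")
          case False
          then obtain y0 where "y0 \<in> overlap d c" by blast
          from continuous_on_component[OF transition_derivative(2)[OF d c this]] show ?thesis .
        qed simp
        then show ?thesis
          by (rule continuous_on_eq) (use d in \<open>auto simp: chart_jacobian_def matrix_def overlap_def\<close>)
      qed
      have cD: "continuous_on (overlap d c) (\<lambda>y. Db (transition d c y))"
        by (rule continuous_on_compose2[OF Dbc continuous_transition[OF d c]]) auto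
      show ?thesis
        unfolding matrix_vector_mult_def transpose_def
        by (intro continuous_on_vec_lambda continuous_on_sum continuous_on_mult)
          (auto intro!: cJ continuous_intros cD)
    qed
    then have 1: "continuous_on (overlap d c) (D d)"
      by (rule continuous_on_eq) (simp add: D_def)
    have 2: "continuous_on ?O (D d)"
      by (rule continuous_on_eq[OF continuous_on_const[of _ 0]]) (simp add: DO)
    show "continuous_on (codom_chart d) (D d)"
      by (subst un, rule continuous_on_open_Un[OF open_overlap[OF d c] O 1 2])
  qed
  moreover have "0 < \<phi> x" using x r(1) by (simp add: \<phi>_def b_def q_def y0_def max_def)
  ultimately show ?thesis using r(2) \<phi>0
    by (intro exI[of _ \<phi>] exI[of _ "cball y0 r"]) (auto simp: \<phi>_def b_def S_def)
qed

definition vector_field :: "(('a, 'n) chart \<Rightarrow> 'a \<Rightarrow> real ^ 'n) \<Rightarrow> bool" where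
  "vector_field X \<longleftrightarrow> (\<forall>c\<in>A. continuous_on (codom_chart c) (\<lambda>y. X c (param c y))) \<and>
     (\<forall>c\<in>A. \<forall>d\<in>A. \<forall>x\<in>dom_chart c \<inter> dom_chart d. X d x = chart_jacobian c d x *v X c x)"

text \<open>
  The derivative of \<open>\<phi>\<close> in direction \<open>X\<close>, computed in an arbitrary chart; for a \<open>vector_field\<close> the
  choice has no influence, by \<open>deriv_along_eq\<close>.
\<close>

definition deriv_along :: "(('a, 'n) chart \<Rightarrow> 'a \<Rightarrow> real ^ 'n) \<Rightarrow> ('a \<Rightarrow> real) \<Rightarrow> 'a \<Rightarrow> real" where
  "deriv_along X \<phi> x = (let c = (SOME c. c \<in> A \<and> x \<in> dom_chart c) in dcoord c \<phi> x \<bullet> X c x)"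

lemma vector_field_transform:
  "vector_field X \<Longrightarrow> c \<in> A \<Longrightarrow> d \<in> A \<Longrightarrow> x \<in> dom_chart c \<Longrightarrow> x \<in> dom_chart d \<Longrightarrow>
    X d x = chart_jacobian c d x *v X c x"
  unfolding vector_field_def by blast

lemma vector_field_continuous:
  "vector_field X \<Longrightarrow> c \<in> A \<Longrightarrow> continuous_on (codom_chart c) (\<lambda>y. X c (param c y))"
  unfolding vector_field_def by blast

lemma deriv_along_eq:
  assumes X: "vector_field X" and \<phi>: "C1_fun \<phi>" and c: "c \<in> A" "x \<in> dom_chart c"
  shows "deriv_along X \<phi> x = dcoord c \<phi> x \<bullet> X c x"
proof -
  define d where "d = (SOME c. c \<in> A \<and> x \<in> dom_chart c)"
  have d: "d \<in> A" "x \<in> dom_chart d"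
    using someI[of "\<lambda>c. c \<in> A \<and> x \<in> dom_chart c" c] c unfolding d_def by auto
  have "dcoord c \<phi> x \<bullet> X c x = dcoord d \<phi> x \<bullet> (chart_jacobian c d x *v X c x)"
    by (simp add: dcoord_transform[OF \<phi> c(1) d(1) c(2) d(2)] dot_lmul_matrix transpose_matrix_vector)
  also have "\<dots> = deriv_along X \<phi> x"
    using vector_field_transform[OF X c(1) d(1) c(2) d(2)]
    by (simp add: deriv_along_def d_def[symmetric])
  finally show ?thesis by simp
qed

lemma continuous_deriv_along:
  assumes X: "vector_field X" and \<phi>: "C1_fun \<phi>"
  shows "continuous_on UNIV (deriv_along X \<phi>)"
proof (rule continuous_on_chartsI)
  fix c assume c: "c \<in> A"
  have "continuous_on (codom_chart c) (\<lambda>y. dcoord c \<phi> (param c y) \<bullet> X c (param c y))"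
    by (intro continuous_on_inner C1_continuous_dcoord[OF \<phi> c] vector_field_continuous[OF X c])
  then show "continuous_on (codom_chart c) (\<lambda>y. deriv_along X \<phi> (param c y))"
    by (rule continuous_on_eq) (simp add: deriv_along_eq[OF X \<phi> c] c)
qed

lemma has_div_in_chart:
  assumes div: "\<And>x. has_div A G X x (l x)" and c: "c \<in> A"
  shows "\<exists>DZ. \<forall>y\<in>codom_chart c.
    ((\<lambda>y. dens c y *\<^sub>R X c (param c y)) has_derivative DZ y) (at y) \<and>
    l (param c y) = (\<Sum>i\<in>UNIV. DZ y (axis i 1) $ i) / dens c y"
proof (rule bchoice, rule ballI)
  fix y assume y: "y \<in> codom_chart c"
  show "\<exists>D. ((\<lambda>y. dens c y *\<^sub>R X c (param c y)) has_derivative D) (at y) \<and>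
      l (param c y) = (\<Sum>i\<in>UNIV. D (axis i 1) $ i) / dens c y"
    using bspec[OF div[unfolded has_div_def, of "param c y"] c] c y
    unfolding dens_def by simp
qed

text \<open>
  In the coordinates of \<open>c\<close> the field \<open>w X\<close>, multiplied by the volume density and extended by 0, is
  differentiable everywhere, and the product rule bounds its trace below by the density times
  \<open>g + dw(X)\<close>.
\<close>

lemma divergence_inequality_in_chart:
  assumes X: "vector_field X" and div: "\<And>x. has_div A G X x (l x)"
    and c: "c \<in> A" and K: "compact K" "K \<subseteq> codom_chart c"
    and w: "C1_fun w" "\<And>z. z \<notin> param c ` K \<Longrightarrow> w z = 0"
    and g: "continuous_on UNIV g" "\<And>z. z \<notin> param c ` K \<Longrightarrow> g z = 0"
    and le: "\<And>x. g x \<le> w x * l x"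
  shows "(LINT x|vol. g x + deriv_along X w x) \<le> 0"
proof -
  define S where "S = param c ` K"
  have S: "closed S" unfolding S_def
    by (intro compact_imp_closed compact_continuous_image continuous_on_subset[OF continuous_param[OF c] K(2)] K)
  have Sdom: "S \<subseteq> dom_chart c" using K c by (auto simp: S_def)
  have inK: "y \<in> K" if "y \<in> codom_chart c" "param c y \<in> S" for y
    using that K(2) c by (auto simp: S_def)
  have da0: "deriv_along X w z = 0" if z: "z \<notin> S" for z
  proof -
    obtain d where d: "d \<in> A" "z \<in> dom_chart d" by (rule obtain_chart)
    have "dcoord d w z = 0"
      by (rule dcoord_eq_0[OF d, of "- S"]) (use S z w(2) in \<open>auto simp: S_def\<close>)
    then show ?thesis by (simp add: deriv_along_eq[OF X w(1) d])
  qed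
  define F where "F x = g x + deriv_along X w x" for x
  have F: "continuous_on UNIV F" unfolding F_def[abs_def]
    by (intro continuous_intros g continuous_deriv_along X w)
  have F0: "F z = 0" if "z \<notin> S" for z using that g(2) da0 by (simp add: F_def S_def)
  define h where "h y = dens0 c y * F (param0 c y)" for y
  define Z where "Z y = dens c y *\<^sub>R X c (param c y)" for y
  define Y where "Y y = (if y \<in> codom_chart c then w (param c y) *\<^sub>R Z y else 0)" for y
  from has_div_in_chart[OF div c, folded Z_def]
  obtain DZ where DZ': "\<forall>y\<in>codom_chart c. (Z has_derivative DZ y) (at y) \<and>
      l (param c y) = (\<Sum>i\<in>UNIV. DZ y (axis i 1) $ i) / dens c y"
    by (elim exE) (rule that)
  note DZ = bspec[OF DZ', THEN conjunct1] and lZ = bspec[OF DZ', THEN conjunct2]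
  define DY where "DY y = (if y \<in> codom_chart c
      then (\<lambda>v. w (param c y) *\<^sub>R DZ y v + (dcoord c w (param c y) \<bullet> v) *\<^sub>R Z y) else (\<lambda>v. 0))" for y
  have Y0: "Y y = 0" if "y \<notin> K" for y
    using that inK[of y] w(2)[of "param c y"] unfolding Y_def S_def by (cases "y \<in> codom_chart c") auto
  have DY: "(Y has_derivative DY y) (at y)" for y
  proof (cases "y \<in> codom_chart c")
    case True
    have "((\<lambda>y. w (param c y) *\<^sub>R Z y) has_derivative
        (\<lambda>v. w (param c y) *\<^sub>R DZ y v + (dcoord c w (param c y) \<bullet> v) *\<^sub>R Z y)) (at y)"
      by (rule has_derivative_scaleR[OF C1_has_derivative[OF w(1) c True] DZ[OF True]])
    then have "(Y has_derivative (\<lambda>v. w (param c y) *\<^sub>R DZ y v + (dcoord c w (param c y) \<bullet> v) *\<^sub>R Z y)) (at y)"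
      by (rule has_derivative_transform_within_open[OF _ open_codom[OF c] True]) (simp add: Y_def)
    then show ?thesis using True by (simp add: DY_def)
  next
    case False
    then have y: "y \<in> - K" using K by blast
    have "((\<lambda>y. 0) has_derivative DY y) (at y)" using False by (simp add: DY_def)
    then show ?thesis
      by (rule has_derivative_transform_within_open[OF _ open_Compl[OF compact_imp_closed[OF K(1)]] y])
        (simp add: Y0)
  qed
  have h0: "h y = 0" if "y \<notin> K" for y
    using that F0 inK by (auto simp: h_def dens0_def param0_def)
  have "continuous_on UNIV h"
  proof -
    have 1: "continuous_on (codom_chart c) h"
      by (rule continuous_on_eq[OF continuous_on_mult[OF continuous_dens[OF c] continuous_on_param[OF F c]]])
        (simp add: h_def dens0_def param0_def)
    have 2: "continuous_on (- K) h"
      by (rule continuous_on_eq[OF continuous_on_const[of _ 0]]) (simp add: h0)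
    have "continuous_on (codom_chart c \<union> - K) h"
      by (rule continuous_on_open_Un[OF open_codom[OF c] open_Compl[OF compact_imp_closed[OF K(1)]] 1 2])
    moreover have "codom_chart c \<union> - K = UNIV" using K by blast
    ultimately show ?thesis by simp
  qed
  moreover have "h y \<le> (\<Sum>i\<in>UNIV. DY y (axis i 1) $ i)" for y
  proof (cases "y \<in> codom_chart c")
    case True
    let ?x = "param c y"
    have tr: "(\<Sum>i\<in>UNIV. DZ y (axis i 1) $ i) = dens c y * l ?x"
      using lZ[OF True] dens_pos[OF c True] by simp
    have "(\<Sum>i\<in>UNIV. DY y (axis i 1) $ i)
        = w ?x * (\<Sum>i\<in>UNIV. DZ y (axis i 1) $ i) + (\<Sum>i\<in>UNIV. dcoord c w ?x $ i * Z y $ i)"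
      using True by (simp add: DY_def inner_axis sum.distrib sum_distrib_left)
    also have "(\<Sum>i\<in>UNIV. dcoord c w ?x $ i * Z y $ i) = dcoord c w ?x \<bullet> Z y"
      by (simp add: inner_vec_def)
    also have "\<dots> = dens c y * deriv_along X w ?x"
      using True c by (simp add: Z_def deriv_along_eq[OF X w(1) c])
    finally have "(\<Sum>i\<in>UNIV. DY y (axis i 1) $ i) = dens c y * (w ?x * l ?x + deriv_along X w ?x)"
      unfolding tr by (simp add: algebra_simps)
    moreover have "h y \<le> dens c y * (w ?x * l ?x + deriv_along X w ?x)"
      using le[of ?x] dens_pos[OF c True] True by (simp add: h_def dens0_def param0_def F_def)
    ultimately show ?thesis by simp
  next
    case False
    then show ?thesis by (simp add: DY_def h_def dens0_def)
  qed
  ultimately have "(LINT y|lborel. h y) \<le> 0"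
    by (intro integral_le_0_of_le_trace[OF K(1) DY Y0 _ h0])
  moreover have "integral\<^sup>L vol F = (LINT y|lborel. h y)"
    unfolding h_def
    by (rule integral_vol_chart[OF c borel_measurable_continuous_onI[OF F]]) (use F0 Sdom in blast)
  ultimately show ?thesis unfolding F_def[abs_def] by simp
qed

text \<open>
  A partition of unity \<open>\<phi> / S\<close> made of bump functions reduces the claim to charts: the functions
  \<open>w x = \<phi> x * v / S\<close> and \<open>k x = \<phi> x * g / S\<close> add up to \<open>v\<close> and \<open>g\<close>, and \<open>k x \<le> w x * l\<close> because
  \<open>\<phi> x / S\<close> is nonnegative.
\<close>

theorem divergence_inequality:
  assumes X: "vector_field X" and div: "\<And>x. has_div A G X x (l x)"
    and v: "C1_fun v" and g: "continuous_on UNIV g" and le: "\<And>x. g x \<le> v x * l x"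
  shows "(LINT x|vol. g x + deriv_along X v x) \<le> 0"
proof -
  let ?bump = "\<lambda>x c \<phi> K. c \<in> A \<and> C1_fun \<phi> \<and> (\<forall>z. 0 \<le> \<phi> z) \<and> 0 < \<phi> x \<and> compact K \<and>
    K \<subseteq> codom_chart c \<and> (\<forall>z. z \<notin> param c ` K \<longrightarrow> \<phi> z = 0)"
  have "\<exists>c \<phi> K. ?bump x c \<phi> K" for x
  proof -
    obtain c where c: "c \<in> A" "x \<in> dom_chart c" by (rule obtain_chart)
    show ?thesis using exists_bump[OF c] by (intro exI[of _ c]) (simp only: c(1) simp_thms)
  qed
  then have "\<forall>x. \<exists>c \<phi> K. ?bump x c \<phi> K" by (rule allI)
  from choice[OF this] obtain C where "\<forall>x. \<exists>\<phi> K. ?bump x (C x) \<phi> K" by (elim exE) (rule that)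
  from choice[OF this] obtain \<phi> where "\<forall>x. \<exists>K. ?bump x (C x) (\<phi> x) K" by (elim exE) (rule that)
  from choice[OF this] obtain K where bump: "\<forall>x. ?bump x (C x) (\<phi> x) (K x)" by (elim exE) (rule that)
  have C: "\<And>x. C x \<in> A" and \<phi>: "\<And>x. C1_fun (\<phi> x)" "\<And>x z. 0 \<le> \<phi> x z" "\<And>x. 0 < \<phi> x x"
    and K: "\<And>x. compact (K x)" "\<And>x. K x \<subseteq> codom_chart (C x)"
    "\<And>x z. z \<notin> param (C x) ` K x \<Longrightarrow> \<phi> x z = 0"
    using bump by (simp_all del: split_paired_All)
  have op: "open {z. 0 < \<phi> x z}" for x
    using open_vimage[OF open_greaterThan[of 0] C1_continuous[OF \<phi>(1)[of x]]] by (simp add: vimage_def)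
  obtain I where I: "finite I" "UNIV \<subseteq> (\<Union>x\<in>I. {z. 0 < \<phi> x z})"
    by (rule compactE_image[OF compact, of UNIV "\<lambda>x. {z. 0 < \<phi> x z}"]) (use op \<phi>(3) in auto)
  define S where "S z = (\<Sum>x\<in>I. \<phi> x z)" for z
  have S: "0 < S z" for z
  proof -
    obtain x where "x \<in> I" "0 < \<phi> x z" using I(2) by blast
    then show ?thesis unfolding S_def using I(1) \<phi>(2) by (intro sum_pos2[of _ x]) auto
  qed
  have SC: "C1_fun S" unfolding S_def[abs_def] by (rule C1_sum[OF I(1) \<phi>(1)])
  define w where "w x z = \<phi> x z * (v z / S z)" for x z
  define k where "k x z = \<phi> x z * (g z / S z)" for x z
  have w: "C1_fun (w x)" for x
    unfolding w_def by (intro C1_mult \<phi> C1_divide v SC) (use S in \<open>auto simp: less_imp_neq[THEN not_sym]\<close>)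
  have k: "continuous_on UNIV (k x)" for x
    unfolding k_def[abs_def] by (intro continuous_intros C1_continuous \<phi> g SC)
      (use S in \<open>auto simp: less_imp_neq[THEN not_sym]\<close>)
  have step: "(LINT z|vol. k x z + deriv_along X (w x) z) \<le> 0" for x
  proof (rule divergence_inequality_in_chart[OF X div C[of x] K(1,2)[of x] w _ k])
    show "k x z \<le> w x z * l z" for z
    proof -
      have "\<phi> x z / S z * g z \<le> \<phi> x z / S z * (v z * l z)"
        using le[of z] \<phi>(2)[of x z] S[of z] by (intro mult_left_mono) auto
      then show ?thesis by (simp add: k_def w_def mult.assoc)
    qed
  qed (auto simp: w_def k_def K(3))
  have sumw: "(\<Sum>x\<in>I. w x z) = v z" and sumk: "(\<Sum>x\<in>I. k x z) = g z" for z
    using S[of z] unfolding w_def k_def sum_distrib_right[symmetric] S_def[symmetric] by auto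
  have sumd: "(\<Sum>x\<in>I. deriv_along X (w x) z) = deriv_along X v z" for z
  proof -
    obtain d where d: "d \<in> A" "z \<in> dom_chart d" by (rule obtain_chart)
    have "deriv_along X v z = dcoord d (\<lambda>z. \<Sum>x\<in>I. w x z) z \<bullet> X d z"
      unfolding sumw using deriv_along_eq[OF X v d] by simp
    also have "\<dots> = (\<Sum>x\<in>I. dcoord d (w x) z \<bullet> X d z)"
      by (simp add: dcoord_sum[OF I(1) w d] inner_sum_left)
    also have "\<dots> = (\<Sum>x\<in>I. deriv_along X (w x) z)"
      by (intro sum.cong refl) (simp add: deriv_along_eq[OF X w d])
    finally show ?thesis by simp
  qed
  have "(LINT z|vol. g z + deriv_along X v z) = (LINT z|vol. (\<Sum>x\<in>I. k x z + deriv_along X (w x) z))"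
    by (simp add: sum.distrib sumk sumd)
  also have "\<dots> = (\<Sum>x\<in>I. (LINT z|vol. k x z + deriv_along X (w x) z))"
    by (rule Bochner_Integration.integral_sum)
      (intro integrable_vol_continuous continuous_intros k continuous_deriv_along X w)
  also have "\<dots> \<le> 0" by (intro sum_nonpos step)
  finally show ?thesis .
qed

end

section \<open>The weighted flux\<close>

lemma continuous_on_det:
  fixes M :: "'b::topological_space \<Rightarrow> real ^ 'n::finite ^ 'n"
  assumes "\<And>i j. continuous_on S (\<lambda>s. M s $ i $ j)"
  shows "continuous_on S (\<lambda>s. det (M s))"
  unfolding det_def by (intro continuous_intros assms)

text \<open>
  By Cramer's rule.
\<close>

lemma continuous_on_matrix_inv_mult:
  fixes M :: "'b::topological_space \<Rightarrow> real ^ 'n::finite ^ 'n"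
  assumes M: "continuous_on S M" and \<xi>: "continuous_on S \<xi>"
    and pos: "\<And>s v. s \<in> S \<Longrightarrow> v \<noteq> 0 \<Longrightarrow> 0 < v \<bullet> (M s *v v)"
  shows "continuous_on S (\<lambda>s. matrix_inv (M s) *v \<xi> s)"
proof -
  define C where "C s = (\<chi> k. det (\<chi> i j. if j = k then \<xi> s $ i else M s $ i $ j) / det (M s))" for s
  have nz: "det (M s) \<noteq> 0" if "s \<in> S" for s
    using det_posdef[of "M s"] pos[OF that] by fastforce
  have "continuous_on S C"
    unfolding C_def[abs_def]
  proof (intro continuous_on_vec_lambda continuous_on_divide continuous_on_det)
    show "continuous_on S (\<lambda>s. (\<chi> i j. if j = k then \<xi> s $ i else M s $ i $ j) $ i $ j)" for i j k
      using M \<xi> by (cases "j = k") (auto intro!: continuous_intros)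
  qed (use M nz in \<open>auto intro!: continuous_intros\<close>)
  moreover have "C s = matrix_inv (M s) *v \<xi> s" if s: "s \<in> S" for s
  proof -
    have inv: "M s ** matrix_inv (M s) = mat 1"
      by (rule matrix_inv_inverse) (rule posdef_invertible[OF pos[OF s]])
    have "M s *v (matrix_inv (M s) *v \<xi> s) = \<xi> s"
      by (simp add: matrix_vector_mul_assoc inv)
    then show ?thesis
      using cramer[OF nz[OF s], of "matrix_inv (M s) *v \<xi> s" "\<xi> s"] unfolding C_def by simp
  qed
  ultimately show ?thesis by (rule continuous_on_eq)
qed

text \<open>
  Half of the minimum of the form of \<open>M0\<close> on the unit sphere is a lower bound once the entries of
  \<open>M s\<close> are close to those of \<open>M0\<close>.
\<close>

lemma eventually_uniformly_posdef:
  fixes M :: "'b \<Rightarrow> real ^ 'n::finite ^ 'n"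
  assumes M: "(M \<longlongrightarrow> M0) F" and pos: "\<And>v. v \<noteq> 0 \<Longrightarrow> 0 < v \<bullet> (M0 *v v)"
  shows "\<exists>\<kappa>>0. eventually (\<lambda>s. \<forall>v. \<kappa> * (v \<bullet> v) \<le> v \<bullet> (M s *v v)) F"
proof -
  let ?S = "sphere (0 :: real ^ 'n) 1"
  have "\<exists>v\<in>?S. \<forall>w\<in>?S. v \<bullet> (M0 *v v) \<le> w \<bullet> (M0 *v w)"
  proof (rule continuous_attains_inf)
    show "?S \<noteq> {}" by (auto intro: exI[of _ "axis undefined 1"])
    show "continuous_on ?S (\<lambda>v. v \<bullet> (M0 *v v))"
      by (intro continuous_on_inner continuous_on_id linear_continuous_on matrix_vector_mul_bounded_linear)
  qed simp
  then obtain v0 where v0: "norm v0 = 1" "\<And>w. norm w = 1 \<Longrightarrow> v0 \<bullet> (M0 *v v0) \<le> w \<bullet> (M0 *v w)"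
    by auto
  define a where "a = v0 \<bullet> (M0 *v v0)"
  have a: "0 < a" unfolding a_def using v0(1) by (intro pos) auto
  have low: "a * (v \<bullet> v) \<le> v \<bullet> (M0 *v v)" for v
  proof (cases "v = 0")
    case False
    define w where "w = v /\<^sub>R norm v"
    have "a \<le> w \<bullet> (M0 *v w)" unfolding a_def by (rule v0(2)) (use False in \<open>simp add: w_def\<close>)
    moreover have "v = norm v *\<^sub>R w" using False by (simp add: w_def)
    then have "v \<bullet> (M0 *v v) = (norm v)\<^sup>2 * (w \<bullet> (M0 *v w))"
      by (metis inner_scaleR_left inner_scaleR_right matrix_vector_mult_scaleR mult.assoc power2_eq_square)
    ultimately show ?thesis
      using mult_right_mono[of a "w \<bullet> (M0 *v w)" "(norm v)\<^sup>2"]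
      by (simp add: mult.commute flip: power2_norm_eq_inner)
  qed simp
  define e where "e s = (\<Sum>i\<in>UNIV. \<Sum>j\<in>UNIV. \<bar>M s $ i $ j - M0 $ i $ j\<bar>)" for s
  have "(e \<longlongrightarrow> (\<Sum>i\<in>(UNIV::'n set). \<Sum>j\<in>(UNIV::'n set). \<bar>M0 $ i $ j - M0 $ i $ j\<bar>)) F"
    unfolding e_def[abs_def] by (intro tendsto_intros M)
  then have e: "eventually (\<lambda>s. e s < a / 2) F"
    using a by (intro order_tendstoD(2)[of e 0]) auto
  have err: "\<bar>v \<bullet> (M s *v v) - v \<bullet> (M0 *v v)\<bar> \<le> e s * (v \<bullet> v)" for s v
  proof -
    have "v \<bullet> (M s *v v) - v \<bullet> (M0 *v v) = (\<Sum>i\<in>UNIV. \<Sum>j\<in>UNIV. (M s $ i $ j - M0 $ i $ j) * (v $ i * v $ j))"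
      by (simp add: inner_vec_def matrix_vector_mult_def sum_subtractf[symmetric] sum_distrib_left algebra_simps)
    also have "\<bar>\<dots>\<bar> \<le> (\<Sum>i\<in>UNIV. \<Sum>j\<in>UNIV. \<bar>(M s $ i $ j - M0 $ i $ j) * (v $ i * v $ j)\<bar>)"
      by (intro order_trans[OF sum_abs] sum_mono sum_abs)
    also have "\<dots> \<le> (\<Sum>i\<in>UNIV. \<Sum>j\<in>UNIV. \<bar>M s $ i $ j - M0 $ i $ j\<bar> * (v \<bullet> v))"
    proof (intro sum_mono)
      fix i j
      have "\<bar>v $ i\<bar> * \<bar>v $ j\<bar> \<le> norm v * norm v"
        by (intro mult_mono component_le_norm_cart) auto
      then show "\<bar>(M s $ i $ j - M0 $ i $ j) * (v $ i * v $ j)\<bar> \<le> \<bar>M s $ i $ j - M0 $ i $ j\<bar> * (v \<bullet> v)"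
        by (simp add: abs_mult mult_left_mono dot_square_norm power2_eq_square)
    qed
    finally show ?thesis by (simp add: e_def sum_distrib_right)
  qed
  have "eventually (\<lambda>s. \<forall>v. a / 2 * (v \<bullet> v) \<le> v \<bullet> (M s *v v)) F"
    using e
  proof eventually_elim
    case (elim s)
    show ?case
    proof
      fix v :: "real ^ 'n"
      have "e s * (v \<bullet> v) \<le> a / 2 * (v \<bullet> v)" using elim by (intro mult_right_mono) auto
      then show "a / 2 * (v \<bullet> v) \<le> v \<bullet> (M s *v v)"
        using err[of v s] low[of v] by (simp add: abs_le_iff)
    qed
  qed
  then show ?thesis using a by (intro exI[of _ "a / 2"]) simp
qed

text \<open>
  Only a zero of \<open>g\<close> needs care when \<open>p < 2\<close>. Near it \<open>|g|\<close> is at most a constant times the norm \<open>m\<close>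
  given by \<open>M\<close>, so the function is at most a constant times \<open>m powr (p - 1)\<close>, which tends to 0.
\<close>

lemma continuous_on_power_flux:
  fixes M :: "'b::topological_space \<Rightarrow> real ^ 'n::finite ^ 'n"
  assumes M: "continuous_on S M" and g: "continuous_on S g"
    and pos: "\<And>s v. s \<in> S \<Longrightarrow> v \<noteq> 0 \<Longrightarrow> 0 < v \<bullet> (M s *v v)" and p: "1 < p"
  shows "continuous_on S (\<lambda>s. sqrt (g s \<bullet> (M s *v g s)) powr (p - 2) *\<^sub>R g s)"
  unfolding continuous_on_def
proof
  fix s0 assume s0: "s0 \<in> S"
  let ?F = "at s0 within S"
  define m where "m s = sqrt (g s \<bullet> (M s *v g s))" for s
  have Mlim: "(M \<longlongrightarrow> M s0) ?F" and glim: "(g \<longlongrightarrow> g s0) ?F"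
    using M g s0 by (auto simp: continuous_on_def)
  have "((\<lambda>s. M s *v g s) \<longlongrightarrow> M s0 *v g s0) ?F"
    unfolding matrix_vector_mult_def
    by (rule vec_tendstoI, simp only: vec_lambda_beta, intro tendsto_sum tendsto_mult tendsto_vec_nth Mlim glim)
  then have mlim: "(m \<longlongrightarrow> m s0) ?F"
    unfolding m_def[abs_def] by (intro tendsto_real_sqrt tendsto_inner glim)
  show "((\<lambda>s. sqrt (g s \<bullet> (M s *v g s)) powr (p - 2) *\<^sub>R g s) \<longlongrightarrow>
      sqrt (g s0 \<bullet> (M s0 *v g s0)) powr (p - 2) *\<^sub>R g s0) ?F"
  proof (cases "g s0 = 0")
    case False
    then have "m s0 \<noteq> 0" using pos[OF s0 False] by (simp add: m_def)
    then show ?thesis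
      unfolding m_def[symmetric] by (intro tendsto_scaleR tendsto_powr mlim glim tendsto_const)
  next
    case True
    have m0: "(m \<longlongrightarrow> 0) ?F" using mlim True by (simp add: m_def)
    obtain a where a: "0 < a" "eventually (\<lambda>s. \<forall>v. a * (v \<bullet> v) \<le> v \<bullet> (M s *v v)) ?F"
      using eventually_uniformly_posdef[OF Mlim pos[OF s0]] by blast
    have "((\<lambda>s. m s powr (p - 2) *\<^sub>R g s) \<longlongrightarrow> 0) ?F"
    proof (rule Lim_null_comparison)
      have "eventually (\<lambda>s. 0 \<le> m s) ?F"
        using a(2)
      proof eventually_elim
        case (elim s)
        have "0 \<le> a * (g s \<bullet> g s)" using a(1) by simp
        also have "\<dots> \<le> g s \<bullet> (M s *v g s)" using elim by blast
        finally show ?case by (simp add: m_def)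
      qed
      then have "((\<lambda>s. m s powr (p - 1)) \<longlongrightarrow> 0) ?F"
        by (intro tendsto_zero_powrI[OF m0 tendsto_const]) (use p in auto)
      then have "((\<lambda>s. m s powr (p - 1) / sqrt a) \<longlongrightarrow> 0 / sqrt a) ?F"
        by (intro tendsto_divide tendsto_const) (use a in auto)
      then show "((\<lambda>s. m s powr (p - 1) / sqrt a) \<longlongrightarrow> 0) ?F" by simp
      show "\<forall>\<^sub>F s in ?F. norm (m s powr (p - 2) *\<^sub>R g s) \<le> m s powr (p - 1) / sqrt a"
        using a(2)
      proof eventually_elim
        case (elim s)
        have "a * (g s \<bullet> g s) \<le> g s \<bullet> (M s *v g s)" using elim by blast
        then have "sqrt (a * (g s \<bullet> g s)) \<le> m s" unfolding m_def by simp
        then have le: "sqrt a * norm (g s) \<le> m s" by (simp add: real_sqrt_mult norm_eq_sqrt_inner)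
        have "0 \<le> sqrt a * norm (g s)" using a by simp
        then have m0: "0 \<le> m s" using le by linarith
        have "m s powr (p - 2) * norm (g s) \<le> m s powr (p - 2) * (m s / sqrt a)"
          using le a by (intro mult_left_mono) (auto simp: field_simps)
        also have "m s powr (p - 2) * m s = m s powr (p - 1)"
        proof (cases "m s = 0")
          case False
          then show ?thesis using powr_add[of "m s" "p - 2" 1] m0 by simp
        qed simp
        then have "m s powr (p - 2) * (m s / sqrt a) = m s powr (p - 1) / sqrt a" by simp
        finally show ?case by simp
      qed
    qed
    then show ?thesis using True by (simp add: m_def)
  qed
qed

context closed_riemannian_manifold
begin

lemma grad_eq: "grad G h c x = matrix_inv (G c x) *v dcoord c h x"
  by (simp add: grad_def dcoord_def)

lemma metric_grad:
  assumes "c \<in> A" "x \<in> dom_chart c"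
  shows "G c x *v grad G h c x = dcoord c h x"
proof -
  have "G c x ** matrix_inv (G c x) = mat 1"
    by (rule matrix_inv_inverse) (rule posdef_invertible[OF metric_pos[OF assms]])
  then show ?thesis by (simp add: grad_eq matrix_vector_mul_assoc)
qed

lemma metric_norm_sq:
  assumes "c \<in> A" "x \<in> dom_chart c"
  shows "(metric_norm G c x v)\<^sup>2 = v \<bullet> (G c x *v v)" and "0 \<le> metric_norm G c x v"
proof -
  have "0 \<le> v \<bullet> (G c x *v v)" using metric_pos[OF assms, of v] by (cases "v = 0") auto
  then show "(metric_norm G c x v)\<^sup>2 = v \<bullet> (G c x *v v)" "0 \<le> metric_norm G c x v"
    by (auto simp: metric_norm_def)
qed

lemma metric_norm_eq_0:
  assumes "c \<in> A" "x \<in> dom_chart c"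
  shows "metric_norm G c x v = 0 \<longleftrightarrow> v = 0"
  using metric_pos[OF assms, of v] by (cases "v = 0") (auto simp: metric_norm_def)

lemma chart_jacobian_metric_mult:
  assumes cd: "c \<in> A" "d \<in> A" "x \<in> dom_chart c" "x \<in> dom_chart d"
  shows "G c x *v v = transpose (chart_jacobian c d x) *v (G d x *v (chart_jacobian c d x *v v))"
  by (subst metric_transform[OF cd]) (simp add: matrix_vector_mul_assoc matrix_mul_assoc)

lemma grad_transform:
  assumes h: "C1_fun h" and cd: "c \<in> A" "d \<in> A" "x \<in> dom_chart c" "x \<in> dom_chart d"
  shows "grad G h d x = chart_jacobian c d x *v grad G h c x"
proof -
  let ?J = "chart_jacobian c d x" and ?g = "grad G h c x"
  have eq: "transpose ?J *v (G d x *v (?J *v ?g)) = transpose ?J *v dcoord d h x"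
    using metric_grad[OF cd(1,3), of h] dcoord_transform[OF h cd] chart_jacobian_metric_mult[OF cd] by simp
  have "det (transpose ?J) \<noteq> 0"
    using vol_density_transform[OF cd] vol_density_pos[OF cd(1,3)] by (auto simp: det_transpose)
  then have "inj ((*v) (transpose ?J))"
    using inj_matrix_vector_mult invertible_det_nz by blast
  from injD[OF this eq] have *: "G d x *v (?J *v ?g) = dcoord d h x" .
  have "matrix_inv (G d x) ** G d x = mat 1"
    by (rule matrix_inv_inverse) (rule posdef_invertible[OF metric_pos[OF cd(2,4)]])
  then have "matrix_inv (G d x) *v (G d x *v (?J *v ?g)) = ?J *v ?g"
    by (simp add: matrix_vector_mul_assoc matrix_mul_assoc)
  then show ?thesis unfolding * by (simp add: grad_eq)
qed

lemma metric_norm_transform: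
  assumes cd: "c \<in> A" "d \<in> A" "x \<in> dom_chart c" "x \<in> dom_chart d"
  shows "metric_norm G d x (chart_jacobian c d x *v v) = metric_norm G c x v"
proof -
  have "v \<bullet> (transpose J *v w) = (J *v v) \<bullet> w" for J :: "real ^ 'n ^ 'n" and w
    by (simp add: transpose_matrix_vector inner_commute[of v] dot_lmul_matrix inner_commute[of w])
  then show ?thesis unfolding metric_norm_def chart_jacobian_metric_mult[OF cd, of v] by simp
qed

lemma smooth_fun_continuous: "smooth_fun A f \<Longrightarrow> continuous_on UNIV f"
  by (rule continuous_on_chartsI) (auto simp: smooth_fun_def o_def dest!: smooth_on_imp_continuous_on)

lemma continuous_grad:
  "C1_fun h \<Longrightarrow> c \<in> A \<Longrightarrow> continuous_on (codom_chart c) (\<lambda>y. grad G h c (param c y))"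
  unfolding grad_eq
  by (rule continuous_on_matrix_inv_mult[OF continuous_metric C1_continuous_dcoord]) (auto intro: metric_pos)

lemma vector_field_weighted_flux:
  assumes f: "continuous_on UNIV f" and h: "C1_fun h" and p: "1 < p"
  shows "vector_field (weighted_flux G f p h)"
  unfolding vector_field_def
proof (intro conjI ballI)
  fix c assume c: "c \<in> A"
  have "continuous_on (codom_chart c) (\<lambda>y. exp (- f (param c y)) *\<^sub>R
      (sqrt (grad G h c (param c y) \<bullet> (G c (param c y) *v grad G h c (param c y))) powr (p - 2)
        *\<^sub>R grad G h c (param c y)))"
    by (rule continuous_on_scaleR[OF continuous_on_exp[OF continuous_on_minus[OF continuous_on_param[OF f c]]]
        continuous_on_power_flux[OF continuous_metric[OF c] continuous_grad[OF h c] _ p]])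
      (auto intro: metric_pos simp: c)
  then show "continuous_on (codom_chart c) (\<lambda>y. weighted_flux G f p h c (param c y))"
    by (simp add: weighted_flux_def metric_norm_def)
next
  fix c d x assume "c \<in> A" "d \<in> A" "x \<in> dom_chart c \<inter> dom_chart d"
  then have cd: "c \<in> A" "d \<in> A" "x \<in> dom_chart c" "x \<in> dom_chart d" by auto
  show "weighted_flux G f p h d x = chart_jacobian c d x *v weighted_flux G f p h c x"
    unfolding weighted_flux_def grad_transform[OF h cd] metric_norm_transform[OF cd]
    by (simp add: matrix_vector_mult_scaleR)
qed

text \<open>
  In a chart this is \<open>trace_nonneg_at_zero\<close> for \<open>\<sigma> h\<close> and for \<open>\<sigma>\<close> times the flux, weighted with the
  volume density. Where the gradient is nonzero this field is the gradient times the positive factor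
  \<open>1 / k\<close>.
\<close>

lemma divergence_sign_at_zero:
  assumes h: "C1_fun h" and div: "\<And>x. has_div A G (weighted_flux G f p h) x (l x)"
    and x0: "h x0 = 0" and W: "open W" "x0 \<in> W"
    and sgn: "\<And>x. x \<in> W \<Longrightarrow> h x \<noteq> 0 \<Longrightarrow> 0 \<le> \<sigma> * l x" and \<sigma>: "\<bar>\<sigma>\<bar> = 1"
  shows "0 \<le> \<sigma> * l x0"
proof -
  obtain c where c: "c \<in> A" "x0 \<in> dom_chart c" by (rule obtain_chart)
  define U where "U = coord c ` (W \<inter> dom_chart c)"
  let ?z = "coord c x0"
  have U: "open U" "?z \<in> U" "U \<subseteq> codom_chart c"
    using open_coord_image[OF c(1), of "W \<inter> dom_chart c"] W open_dom[OF c(1)] c by (auto simp: U_def)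
  have UW: "param c y \<in> W" if "y \<in> U" for y using that c(1) by (auto simp: U_def)
  let ?F = "weighted_flux G f p h c"
  define Z where "Z y = dens c y *\<^sub>R ?F (param c y)" for y
  from has_div_in_chart[OF div c(1), folded Z_def]
  obtain DZ where DZ': "\<forall>y\<in>codom_chart c. (Z has_derivative DZ y) (at y) \<and>
      l (param c y) = (\<Sum>i\<in>UNIV. DZ y (axis i 1) $ i) / dens c y"
    by (elim exE) (rule that)
  note DZ = bspec[OF DZ', THEN conjunct1] and lZ = bspec[OF DZ', THEN conjunct2]
  have tr: "(\<Sum>i\<in>UNIV. (\<sigma> *\<^sub>R DZ y (axis i 1)) $ i) = dens c y * (\<sigma> * l (param c y))"
    if "y \<in> codom_chart c" for y
    using lZ[OF that] dens_pos[OF c(1) that] by (simp flip: sum_distrib_left)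
  define k where "k y = (let g = grad G h c (param c y) in if g = 0 then 1
    else inverse (dens c y * (exp (- f (param c y)) * metric_norm G c (param c y) g powr (p - 2))))" for y
  have "0 \<le> (\<Sum>i\<in>UNIV. (\<lambda>v. \<sigma> *\<^sub>R DZ ?z v) (axis i 1) $ i)"
  proof (rule trace_nonneg_at_zero[OF U(1,2)])
    fix y assume y: "y \<in> U"
    then have yc: "y \<in> codom_chart c" using U by blast
    then have x: "param c y \<in> dom_chart c" using c by simp
    let ?x = "param c y"
    let ?g = "grad G h c ?x"
    have m: "?g \<noteq> 0 \<Longrightarrow> 0 < metric_norm G c ?x ?g"
      using metric_norm_sq(2)[OF c(1) x] metric_norm_eq_0[OF c(1) x] by (metis less_le)
    show "0 < k y" 
    proof (cases "?g = 0")
      case False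
      then show ?thesis using m[OF False] dens_pos[OF c(1) yc] by (simp add: k_def Let_def)
    qed (simp add: k_def)
    have "k y *\<^sub>R Z y = ?g"
    proof (cases "?g = 0")
      case False
      define q where "q = dens c y * (exp (- f ?x) * metric_norm G c ?x ?g powr (p - 2))"
      have "0 < q" using m[OF False] dens_pos[OF c(1) yc] by (simp add: q_def)
      moreover have "k y = inverse q" using False by (simp add: k_def q_def)
      moreover have "Z y = q *\<^sub>R ?g" by (simp add: Z_def weighted_flux_def q_def)
      ultimately show ?thesis by simp
    qed (simp add: Z_def weighted_flux_def)
    then have kG: "k y *\<^sub>R (G c ?x *v Z y) = dcoord c h ?x"
      by (metis matrix_vector_mult_scaleR metric_grad[OF c(1) x])
    have "k y * ((G c ?x *v (\<sigma> *\<^sub>R Z y)) \<bullet> v) = \<sigma> * (dcoord c h ?x \<bullet> v)" for v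
      by (simp add: matrix_vector_mult_scaleR flip: kG)
    then show "((\<lambda>y. \<sigma> * h (param c y)) has_derivative
        (\<lambda>v. k y * ((G c (param c y) *v (\<sigma> *\<^sub>R Z y)) \<bullet> v))) (at y)"
      using has_derivative_mult_right[OF C1_has_derivative[OF h c(1) yc], of \<sigma>] by simp
    show "((\<lambda>y. \<sigma> *\<^sub>R Z y) has_derivative (\<lambda>v. \<sigma> *\<^sub>R DZ y v)) (at y)"
      by (rule has_derivative_scaleR_right[OF DZ[OF yc]])
    assume "\<sigma> * h (param c y) \<noteq> 0"
    then show "0 \<le> (\<Sum>i\<in>UNIV. (\<sigma> *\<^sub>R DZ y (axis i 1)) $ i)"
      unfolding tr[OF yc] using sgn[OF UW[OF y]] dens_pos[OF c(1) yc] by simp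
  next
    show "\<sigma> * h (param c ?z) = 0" using x0 c by simp
    show "continuous (at ?z) (\<lambda>y. G c (param c y))"
      using continuous_metric[OF c(1)] open_codom[OF c(1)] c(2) by (simp add: continuous_on_eq_continuous_at)
    show "transpose (G c (param c ?z)) = G c (param c ?z)" using metric_sym[OF c] c by simp
    show "0 < v \<bullet> (G c (param c ?z) *v v)" if "v \<noteq> 0" for v using metric_pos[OF c that] c by simp
  qed
  then show ?thesis
    using tr[of ?z] U dens_pos[OF c(1), of ?z] c by (auto simp: zero_le_mult_iff)
qed

end

section \<open>Derivatives in time\<close>

text \<open>
  The last of the four derivatives states that the time derivative and the spatial differential
  commute. It comes from \<open>w y t - w y a\<close>, the integral of the time derivative: differentiation under the
  integral sign in \<open>y\<close> gives \<open>Dx y t - Dx y a\<close> as the integral of \<open>Dxt y\<close>, which is then differentiated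
  in \<open>t\<close>. All time derivatives are one-sided at the ends of the interval.
\<close>

lemma mixed_derivatives:
  fixes w :: "real ^ 'n::finite \<Rightarrow> real \<Rightarrow> real"
  assumes V: "open V" and ab: "a < b" and w: "smooth_on (V \<times> {a..b}) (\<lambda>(y, t). w y t)"
  shows "\<exists>Dx wt Dxt. (\<forall>y\<in>V. \<forall>t\<in>{a..b}.
      ((\<lambda>y. w y t) has_derivative (\<lambda>v. Dx y t \<bullet> v)) (at y) \<and>
      (w y has_real_derivative wt y t) (at t within {a..b}) \<and>
      ((\<lambda>y. wt y t) has_derivative (\<lambda>v. Dxt y t \<bullet> v)) (at y) \<and>
      (Dx y has_vector_derivative Dxt y t) (at t within {a..b})) \<and>
    continuous_on (V \<times> {a..b}) (\<lambda>(y, t). Dx y t) \<and>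
    continuous_on (V \<times> {a..b}) (\<lambda>(y, t). wt y t) \<and>
    continuous_on (V \<times> {a..b}) (\<lambda>(y, t). Dxt y t)"
proof -
  let ?T = "{a..b}" and ?S = "V \<times> {a..b}" and ?w = "\<lambda>(y, t). w y t"
  define P where "P v z = frechet_derivative ?w (at z within ?S) v" for v z
  define wt where "wt y t = P (0, 1) (y, t)" for y t
  define Q where "Q v z = frechet_derivative (P (0, 1)) (at z within ?S) v" for v z
  define Dx where "Dx y t = (\<chi> i. P (axis i 1, 0) (y, t))" for y t
  define Dxt where "Dxt y t = (\<chi> i. Q (axis i 1, 0) (y, t))" for y t
  have C2: "C_k_on (Suc (Suc 0)) ?S ?w" using w unfolding smooth_on_def by (rule spec)
  note C2' = C2[unfolded C_k_on.simps(2)[of "Suc 0"]]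
  have dw: "(?w has_derivative (\<lambda>v. P v z)) (at z within ?S)" if "z \<in> ?S" for z
    using bspec[OF conjunct1[OF C2'] that] unfolding P_def frechet_derivative_works .
  have C1: "C_k_on (Suc 0) ?S (P v)" for v
    using conjunct2[OF C2', THEN spec, of v] unfolding P_def[abs_def] .
  note C1' = C1[unfolded C_k_on.simps(2)[of 0]]
  have dP: "(P (0, 1) has_derivative (\<lambda>v. Q v z)) (at z within ?S)" if "z \<in> ?S" for z
    using bspec[OF conjunct1[OF C1'] that] unfolding Q_def frechet_derivative_works .
  have cQ: "continuous_on ?S (Q v)" for v
    using conjunct2[OF C1', of "(0, 1)", THEN spec, of v] unfolding Q_def[abs_def] C_k_on.simps(1) .
  have cP: "continuous_on ?S (P v)" for v
    using conjunct1[OF C1', of v] by (intro differentiable_imp_continuous_on) (simp add: differentiable_on_def)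
  have slice: "((\<lambda>y. g (y, t)) has_derivative (\<lambda>v. (\<chi> i. g' (axis i 1, 0)) \<bullet> v)) (at y)"
    if g: "(g has_derivative g') (at (y, t) within ?S)" and y: "y \<in> V" and t: "t \<in> ?T"
    for g :: "(real ^ 'n) \<times> real \<Rightarrow> real" and g' y t
  proof -
    have 1: "((\<lambda>y. (y, t)) has_derivative (\<lambda>v. (v, 0))) (at y within V)"
      by (auto intro!: derivative_eq_intros)
    have 2: "(g has_derivative g') (at (y, t) within (\<lambda>y. (y, t)) ` V)"
      by (rule has_derivative_subset[OF g]) (use t in auto)
    have 3: "((\<lambda>y. g (y, t)) has_derivative (\<lambda>v. g' (v, 0))) (at y within V)"
      using diff_chain_within[OF 1 2] by (simp add: o_def)
    have "g' (v, 0) = (\<chi> i. g' (axis i 1, 0)) \<bullet> v" for v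
      by (rule linear_functional_eq_inner[of "\<lambda>v. g' (v, 0)", OF has_derivative_linear[OF 3]])
    then have "(\<lambda>v. g' (v, 0)) = (\<lambda>v. (\<chi> i. g' (axis i 1, 0)) \<bullet> v)" by (rule ext)
    from has_derivative_eq_rhs[OF 3 this] show ?thesis unfolding at_within_open[OF y V] .
  qed
  have A1: "((\<lambda>y. w y t) has_derivative (\<lambda>v. Dx y t \<bullet> v)) (at y)" if "y \<in> V" "t \<in> ?T" for y t
    using slice[OF dw[of "(y, t)"]] that by (simp add: Dx_def)
  have A3: "((\<lambda>y. wt y t) has_derivative (\<lambda>v. Dxt y t \<bullet> v)) (at y)" if "y \<in> V" "t \<in> ?T" for y t
    using slice[OF dP[of "(y, t)"]] that by (simp add: Dxt_def wt_def)
  have A2: "(w y has_real_derivative wt y t) (at t within ?T)" if y: "y \<in> V" and t: "t \<in> ?T" for y t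
  proof -
    have 1: "((\<lambda>t. (y, t)) has_derivative (\<lambda>r. (0, r))) (at t within ?T)"
      by (auto intro!: derivative_eq_intros)
    have 2: "(?w has_derivative (\<lambda>v. P v (y, t))) (at (y, t) within (\<lambda>t. (y, t)) ` ?T)"
      by (rule has_derivative_subset[OF dw]) (use y t in auto)
    have 3: "(w y has_derivative (\<lambda>r. P (0, r) (y, t))) (at t within ?T)"
      using diff_chain_within[OF 1 2] by (simp add: o_def)
    have "P (0, r) (y, t) = wt y t * r" for r
      using linear_cmul[OF has_derivative_linear[OF 3], of r 1] by (simp add: wt_def mult.commute)
    then have "(\<lambda>r. P (0, r) (y, t)) = (*) (wt y t)" by (intro ext)
    from has_derivative_eq_rhs[OF 3 this] show ?thesis unfolding has_field_derivative_def .
  qed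
  have cD: "continuous_on ?S (\<lambda>z. (\<chi> i. g i (fst z, snd z)))" if "\<And>i. continuous_on ?S (g i)"
    for g :: "'n \<Rightarrow> (real ^ 'n) \<times> real \<Rightarrow> real"
    using that by (intro continuous_on_vec_lambda) simp
  have c1: "continuous_on ?S (\<lambda>(y, t). Dx y t)"
    using cD[OF cP] by (simp add: Dx_def case_prod_unfold)
  have c2: "continuous_on ?S (\<lambda>(y, t). wt y t)" using cP by (simp add: wt_def case_prod_unfold)
  have c3: "continuous_on ?S (\<lambda>(y, t). Dxt y t)"
    using cD[OF cQ] by (simp add: Dxt_def case_prod_unfold)
  have slice_cont: "continuous_on {a..t} (\<lambda>r. g y r)"
    if "continuous_on ?S (\<lambda>(y, t). g y t)" "y \<in> V" "t \<in> ?T"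
    for g :: "real ^ 'n \<Rightarrow> real \<Rightarrow> 'x::topological_space" and y t
  proof -
    have 1: "continuous_on {a..t} (\<lambda>r. (y, r))" by (intro continuous_intros)
    have 2: "(\<lambda>r. (y, r)) ` {a..t} \<subseteq> ?S" using that by auto
    show ?thesis using continuous_on_compose2[OF that(1) 1 2] by simp
  qed
  have diff_eq: "Dx y t $ i - Dx y a $ i = integral {a..t} (\<lambda>r. Dxt y r $ i)"
    if y: "y \<in> V" and t: "t \<in> ?T" for y t i
  proof -
    obtain \<rho> where \<rho>: "0 < \<rho>" "ball y \<rho> \<subseteq> V" using V y open_contains_ball by blast
    let ?e = "axis i 1 :: real ^ 'n" and ?U = "{- \<rho><..<\<rho>}"
    have inV: "y + s *\<^sub>R ?e \<in> V" if "s \<in> ?U" for s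
      using that \<rho>(2) by (auto simp: dist_norm subset_iff)
    have aT: "a \<in> ?T" using ab by simp
    have line: "((\<lambda>s. y + s *\<^sub>R ?e) has_derivative (\<lambda>r. r *\<^sub>R ?e)) (at s)" for s
      by (auto intro!: derivative_eq_intros)
    have along: "((\<lambda>s. g (y + s *\<^sub>R ?e)) has_field_derivative d $ i) (at s within ?U)"
      if "(g has_derivative (\<lambda>v. d \<bullet> v)) (at (y + s *\<^sub>R ?e))"
      for g :: "real ^ 'n \<Rightarrow> real" and d s
    proof -
      have "((\<lambda>s. g (y + s *\<^sub>R ?e)) has_derivative (\<lambda>r. r * d $ i)) (at s)"
        using has_derivative_compose[OF line that] by (simp add: inner_axis)
      then have "((\<lambda>s. g (y + s *\<^sub>R ?e)) has_field_derivative d $ i) (at s)"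
        by (simp add: has_field_derivative_def mult_commute_abs)
      then show ?thesis by (rule has_field_derivative_at_within)
    qed
    have L1: "((\<lambda>s. integral (cbox a t) (\<lambda>r. wt (y + s *\<^sub>R ?e) r)) has_field_derivative
        integral (cbox a t) (\<lambda>r. Dxt (y + 0 *\<^sub>R ?e) r $ i)) (at 0 within ?U)"
    proof (rule leibniz_rule_field_derivative)
      show "((\<lambda>s. wt (y + s *\<^sub>R ?e) r) has_field_derivative Dxt (y + s *\<^sub>R ?e) r $ i) (at s within ?U)"
        if "s \<in> ?U" "r \<in> cbox a t" for s r
        by (rule along[OF A3]) (use inV[OF that(1)] that(2) t in auto)
      show "(\<lambda>r. wt (y + s *\<^sub>R ?e) r) integrable_on cbox a t" if "s \<in> ?U" for s
        using slice_cont[OF c2 inV[OF that] t] by (auto intro: integrable_continuous_interval)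
      have "continuous_on (?U \<times> cbox a t) (\<lambda>z. case (y + fst z *\<^sub>R ?e, snd z) of (y, t) \<Rightarrow> Dxt y t)"
        by (rule continuous_on_compose2[OF c3]) (use inV t in \<open>auto intro!: continuous_intros\<close>)
      then show "continuous_on (?U \<times> cbox a t) (\<lambda>(s, r). Dxt (y + s *\<^sub>R ?e) r $ i)"
        by (simp add: case_prod_unfold continuous_on_component)
    qed (use \<rho> in auto)
    have L2: "integral (cbox a t) (\<lambda>r. wt (y + s *\<^sub>R ?e) r) = w (y + s *\<^sub>R ?e) t - w (y + s *\<^sub>R ?e) a"
      if s: "s \<in> ?U" for s
    proof -
      have "((\<lambda>r. wt (y + s *\<^sub>R ?e) r) has_integral w (y + s *\<^sub>R ?e) t - w (y + s *\<^sub>R ?e) a) {a..t}"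
      proof (rule fundamental_theorem_of_calculus)
        show "(w (y + s *\<^sub>R ?e) has_vector_derivative wt (y + s *\<^sub>R ?e) r) (at r within {a..t})"
          if "r \<in> {a..t}" for r
          using DERIV_subset[OF A2[OF inV[OF s], of r], of "{a..t}"] that t
          by (auto simp: has_real_derivative_iff_has_vector_derivative)
      qed (use t in auto)
      then show ?thesis by (simp add: integral_unique)
    qed
    have "((\<lambda>s. w (y + s *\<^sub>R ?e) t - w (y + s *\<^sub>R ?e) a) has_field_derivative
        integral (cbox a t) (\<lambda>r. Dxt (y + 0 *\<^sub>R ?e) r $ i)) (at 0 within ?U)"
      by (rule has_field_derivative_transform_within[OF L1 \<rho>(1)]) (use \<rho> L2 in auto)
    then have "((\<lambda>s. w (y + s *\<^sub>R ?e) t - w (y + s *\<^sub>R ?e) a) has_field_derivative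
        integral {a..t} (\<lambda>r. Dxt y r $ i)) (at 0 within ?U)" by simp
    moreover have "((\<lambda>s. w (y + s *\<^sub>R ?e) t - w (y + s *\<^sub>R ?e) a) has_field_derivative
        (Dx (y + 0 *\<^sub>R ?e) t $ i - Dx (y + 0 *\<^sub>R ?e) a $ i)) (at 0 within ?U)"
      by (intro DERIV_diff along A1) (use y t aT in auto)
    moreover have "at 0 within ?U = at (0::real)" by (rule at_within_open) (use \<rho> in auto)
    ultimately show ?thesis using DERIV_unique by fastforce
  qed
  have A4: "(Dx y has_vector_derivative Dxt y t) (at t within ?T)" if y: "y \<in> V" and t: "t \<in> ?T" for y t
  proof -
    have "((\<lambda>t. Dx y t $ i) has_real_derivative Dxt y t $ i) (at t within ?T)" for i
    proof -
      have bT: "b \<in> ?T" using ab by simp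
      have "continuous_on ?T (\<lambda>r. Dxt y r $ i)"
        by (rule continuous_on_component[OF slice_cont[OF c3 y bT]])
      then have "((\<lambda>t. integral {a..t} (\<lambda>r. Dxt y r $ i)) has_real_derivative Dxt y t $ i) (at t within ?T)"
        using t by (rule integral_has_real_derivative)
      from DERIV_add[OF DERIV_const[of "Dx y a $ i"] this]
      have L: "((\<lambda>t. Dx y a $ i + integral {a..t} (\<lambda>r. Dxt y r $ i)) has_real_derivative Dxt y t $ i) (at t within ?T)"
        by simp
      show ?thesis
        by (rule has_field_derivative_transform_within[OF L zero_less_one t]) (simp flip: diff_eq[OF y])
    qed
    then show ?thesis
      unfolding has_vector_derivative_def
      by (subst has_derivative_componentwise_within)
        (auto simp: Basis_vec_def inner_axis has_field_derivative_def mult_commute_abs)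
  qed
  show ?thesis
    by (intro exI[of _ Dx] exI[of _ wt] exI[of _ Dxt] conjI ballI A1 A2 A3 A4 c1 c2 c3)
qed

text \<open>
  The difference quotients are bounded by \<open>B\<close>, by the mean value theorem, so dominated convergence
  applies.
\<close>

lemma has_real_derivative_integral:
  fixes h :: "'x \<Rightarrow> real \<Rightarrow> real"
  assumes M: "finite_measure M"
    and der: "\<And>x t. t \<in> {a..b} \<Longrightarrow> (h x has_real_derivative h' x t) (at t within {a..b})"
    and bd: "\<And>x t. t \<in> {a..b} \<Longrightarrow> \<bar>h' x t\<bar> \<le> B"
    and int: "\<And>t. t \<in> {a..b} \<Longrightarrow> integrable M (\<lambda>x. h x t)" and t: "t \<in> {a..b}"
  shows "((\<lambda>t. LINT x|M. h x t) has_real_derivative (LINT x|M. h' x t)) (at t within {a..b})"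
proof -
  interpret finite_measure M by fact
  have "((\<lambda>s. ((LINT x|M. h x s) - (LINT x|M. h x t)) / (s - t)) \<longlongrightarrow> (LINT x|M. h' x t)) (at t within {a..b})"
    unfolding tendsto_at_iff_sequentially
  proof (intro allI impI)
    fix X :: "nat \<Rightarrow> real" assume X: "\<forall>i. X i \<in> {a..b} - {t}" "X \<longlonglongrightarrow> t"
    define q where "q i x = (h x (X i) - h x t) / (X i - t)" for i x
    have qi: "integrable M (q i)" for i
      unfolding q_def using X(1) t by (intro integrable_divide Bochner_Integration.integrable_diff int) auto
    have lim: "(\<lambda>i. q i x) \<longlonglongrightarrow> h' x t" for x
    proof -
      have "((\<lambda>s. (h x s - h x t) / (s - t)) \<longlongrightarrow> h' x t) (at t within {a..b})"
        using der[OF t, of x] by (simp add: has_field_derivative_iff)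
      then show ?thesis using X unfolding tendsto_at_iff_sequentially q_def o_def by blast
    qed
    have bdq: "\<bar>q i x\<bar> \<le> B" for i x
    proof -
      have "norm (h x (X i) - h x t) \<le> B * norm (X i - t)"
        by (rule field_differentiable_bound[of "{a..b}" "h x" "h' x"]) (use der bd X(1) t in auto)
      then show ?thesis using X(1) by (auto simp: q_def abs_divide divide_le_eq)
    qed
    have "(\<lambda>i. integral\<^sup>L M (q i)) \<longlonglongrightarrow> (LINT x|M. h' x t)"
    proof (rule integral_dominated_convergence)
      show "(\<lambda>x. h' x t) \<in> borel_measurable M"
        by (rule borel_measurable_LIMSEQ_real[OF lim]) (use qi in auto)
      show "integrable M (\<lambda>x. B)" by simp
    qed (use qi lim bdq in auto)
    moreover have "integral\<^sup>L M (q i) = ((LINT x|M. h x (X i)) - (LINT x|M. h x t)) / (X i - t)" for i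
      unfolding q_def using X(1) t int by (simp add: Bochner_Integration.integral_diff)
    ultimately show "((\<lambda>s. ((LINT x|M. h x s) - (LINT x|M. h x t)) / (s - t)) \<circ> X) \<longlonglongrightarrow> (LINT x|M. h' x t)"
      by (simp add: o_def)
  qed
  then show ?thesis by (simp add: has_field_derivative_iff)
qed

text \<open>
  The function is the power \<open>p / 2\<close> of the quadratic form of \<open>H\<close>. At \<open>v = 0\<close>, where the chain rule
  fails for \<open>p < 2\<close>, it is \<open>O(|v|^p)\<close> and hence has derivative 0.
\<close>

lemma has_derivative_power_form:
  fixes H :: "real ^ 'n::finite ^ 'n"
  assumes sym: "transpose H = H" and pos: "\<And>v. v \<noteq> 0 \<Longrightarrow> 0 < v \<bullet> (H *v v)" and p: "1 < p"
  shows "((\<lambda>v. sqrt (v \<bullet> (H *v v)) powr (p - 2) * (v \<bullet> (H *v v))) has_derivative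
    (\<lambda>w. p * sqrt (v \<bullet> (H *v v)) powr (p - 2) * ((H *v v) \<bullet> w))) (at v)"
proof -
  define q where "q v = v \<bullet> (H *v v)" for v
  have q0: "0 \<le> q v" for v using pos[of v] by (cases "v = 0") (auto simp: q_def)
  have eq: "sqrt (q v) powr (p - 2) * q v = q v powr (p / 2)" for v
  proof (cases "q v = 0")
    case False
    have "sqrt (q v) powr (p - 2) = q v powr ((p - 2) / 2)"
      using q0[of v] by (simp add: powr_half_sqrt[symmetric] powr_powr)
    then have "sqrt (q v) powr (p - 2) * q v = q v powr (1 + (p - 2) / 2)"
      using powr_mult_base[OF q0[of v], of "(p - 2) / 2"] by (simp add: mult.commute)
    also have "1 + (p - 2) / 2 = p / 2" by (simp add: field_simps)
    finally show ?thesis .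
  qed simp
  have "((\<lambda>v. q v powr (p / 2)) has_derivative (\<lambda>w. p * sqrt (q v) powr (p - 2) * ((H *v v) \<bullet> w))) (at v)"
  proof (cases "v = 0")
    case False
    then have qv: "0 < q v" unfolding q_def by (rule pos)
    have symm: "v \<bullet> (H *v w) = (H *v v) \<bullet> w" for w
      using sym by (metis dot_lmul_matrix transpose_matrix_vector)
    have dq: "(q has_derivative (\<lambda>w. 2 * ((H *v v) \<bullet> w))) (at v)"
    proof -
      have "((\<lambda>v. H *v v) has_derivative (\<lambda>w. H *v w)) (at v)"
        by (rule bounded_linear_imp_has_derivative) (rule matrix_vector_mul_bounded_linear)
      from has_derivative_inner[OF has_derivative_ident this]
      show ?thesis unfolding q_def[abs_def]
        by (rule has_derivative_eq_rhs) (simp add: fun_eq_iff symm inner_commute)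
    qed
    have "((\<lambda>r. r powr (p / 2)) has_real_derivative (p / 2) * q v powr (p / 2 - 1)) (at (q v))"
      using has_real_derivative_powr[OF qv, of "p / 2"] by simp
    from has_derivative_compose[OF dq this[unfolded has_field_derivative_def]]
    have "((\<lambda>v. q v powr (p / 2)) has_derivative
        (\<lambda>w. (p / 2) * q v powr (p / 2 - 1) * (2 * ((H *v v) \<bullet> w)))) (at v)" .
    moreover have "q v powr (p / 2 - 1) = sqrt (q v) powr (p - 2)"
      using qv by (simp add: powr_half_sqrt[symmetric] powr_powr field_simps)
    ultimately show ?thesis by (simp add: mult.assoc)
  next
    case True
    obtain B where B: "0 < B" "\<And>x. norm (H *v x) \<le> norm x * B"
      using bounded_linear.pos_bounded[OF matrix_vector_mul_bounded_linear[of H]] by blast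
    have bound: "q w powr (p / 2) \<le> B powr (p / 2) * norm w powr p" for w
    proof -
      have "q w \<le> norm w * norm (H *v w)" unfolding q_def by (rule norm_cauchy_schwarz)
      also have "\<dots> \<le> norm w * (norm w * B)" using B by (intro mult_left_mono) auto
      finally have "q w \<le> B * (norm w)\<^sup>2" by (simp add: power2_eq_square mult_ac)
      then have "q w powr (p / 2) \<le> (B * (norm w)\<^sup>2) powr (p / 2)"
        using q0 p by (intro powr_mono2) auto
      also have "\<dots> = B powr (p / 2) * ((norm w)\<^sup>2) powr (p / 2)" using B by (simp add: powr_mult)
      also have "((norm w)\<^sup>2) powr (p / 2) = norm w powr p"
      proof -
        have "((norm w)\<^sup>2) powr (p / 2) = (norm w powr 2) powr (p / 2)" by simp
        also have "\<dots> = norm w powr p" unfolding powr_powr by simp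
        finally show ?thesis .
      qed
      finally show ?thesis .
    qed
    have "((\<lambda>v. q v powr (p / 2)) has_derivative (\<lambda>w. 0)) (at 0)"
      unfolding has_derivative_at
    proof (intro conjI)
      show "((\<lambda>w. norm (q (0 + w) powr (p / 2) - q 0 powr (p / 2) - 0) / norm w) \<longlongrightarrow> 0) (at 0)"
      proof (rule Lim_null_comparison)
        have n0: "((\<lambda>w. norm w) \<longlongrightarrow> 0) (at (0 :: real ^ 'n))" by (auto intro!: tendsto_eq_intros)
        have "((\<lambda>w. norm w powr (p - 1)) \<longlongrightarrow> 0) (at (0 :: real ^ 'n))"
          by (rule tendsto_zero_powrI[OF n0 tendsto_const]) (use p in auto)
        from tendsto_mult[OF tendsto_const this]
        show "((\<lambda>w. B powr (p / 2) * norm w powr (p - 1)) \<longlongrightarrow> 0) (at (0 :: real ^ 'n))" by simp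
        show "\<forall>\<^sub>F w in at (0 :: real ^ 'n). norm (norm (q (0 + w) powr (p / 2) - q 0 powr (p / 2) - 0) / norm w)
            \<le> B powr (p / 2) * norm w powr (p - 1)"
        proof (rule eventually_at_ball'[of 1, THEN eventually_mono])
          fix w :: "real ^ 'n" assume "w \<in> ball 0 1 \<and> w \<noteq> 0 \<and> w \<in> UNIV"
          then have w: "0 < norm w" by simp
          have "q w powr (p / 2) / norm w \<le> (B powr (p / 2) * norm w powr p) / norm w"
            by (rule divide_right_mono[OF bound]) simp
          also have "\<dots> = B powr (p / 2) * norm w powr (p - 1)"
            using w by (simp add: powr_diff)
          finally show "norm (norm (q (0 + w) powr (p / 2) - q 0 powr (p / 2) - 0) / norm w)
              \<le> B powr (p / 2) * norm w powr (p - 1)"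
            by (simp add: q_def)
        qed simp
      qed
    qed simp
    then show ?thesis using True by simp
  qed
  then show ?thesis unfolding eq[symmetric] by (simp add: q_def)
qed

lemma has_real_derivative_abs_powr:
  fixes r :: real
  assumes p: "1 < p"
  shows "((\<lambda>r. \<bar>r\<bar> powr p) has_real_derivative p * (sgn r * \<bar>r\<bar> powr (p - 1))) (at r)"
proof (cases r "0::real" rule: linorder_cases)
  case greater
  have "((\<lambda>r. r powr p) has_real_derivative p * (sgn r * \<bar>r\<bar> powr (p - 1))) (at r)"
    using has_real_derivative_powr[OF greater, of p] greater by simp
  then show ?thesis
    by (rule has_field_derivative_transform_within_open[of _ _ _ "{0<..}"]) (use greater in auto)
next
  case less
  have "((\<lambda>r. (- r) powr p) has_real_derivative p * (sgn r * \<bar>r\<bar> powr (p - 1))) (at r)"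
    using less by (auto intro!: derivative_eq_intros)
  then show ?thesis
    by (rule has_field_derivative_transform_within_open[of _ _ _ "{..<0}"]) (use less in auto)
next
  case equal
  have "((\<lambda>y::real. \<bar>y\<bar> powr p / y) \<longlongrightarrow> 0) (at 0)"
  proof (rule Lim_null_comparison)
    have "((\<lambda>y::real. \<bar>y\<bar>) \<longlongrightarrow> 0) (at 0)" by (auto intro!: tendsto_eq_intros)
    then show "((\<lambda>y::real. \<bar>y\<bar> powr (p - 1)) \<longlongrightarrow> 0) (at 0)"
      by (rule tendsto_zero_powrI[OF _ tendsto_const]) (use p in auto)
    show "\<forall>\<^sub>F y::real in at 0. norm (\<bar>y\<bar> powr p / y) \<le> \<bar>y\<bar> powr (p - 1)"
      by (rule eventually_at_ball'[of 1, THEN eventually_mono]) (auto simp: powr_diff abs_divide)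
  qed
  then show ?thesis using equal by (simp add: has_field_derivative_iff)
qed

lemma continuous_on_sgn_powr:
  fixes g :: "'x::topological_space \<Rightarrow> real"
  assumes "continuous_on S g" "0 < q"
  shows "continuous_on S (\<lambda>x. sgn (g x) * \<bar>g x\<bar> powr q)"
proof -
  have "continuous_on S (\<lambda>x. max 0 (g x) powr q - max 0 (- g x) powr q)"
    using assms by (intro continuous_on_diff continuous_on_powr' continuous_intros) auto
  then show ?thesis by (rule continuous_on_eq) (auto simp: sgn_if max_def)
qed

lemma continuous_on_abs_powr:
  fixes g :: "'x::topological_space \<Rightarrow> real"
  assumes "continuous_on S g" "0 < q"
  shows "continuous_on S (\<lambda>x. \<bar>g x\<bar> powr q)"
  using assms by (intro continuous_on_powr' continuous_intros) auto

text \<open>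
  As long as \<open>I\<close> is positive, the assumption on \<open>E'\<close> makes the derivative of \<open>E / I\<close> nonpositive, so
  \<open>E \<le> \<kappa> I\<close> with \<open>\<kappa> = E a / I a\<close>. Then \<open>I * exp (- W)\<close> does not decrease, where \<open>W\<close> is the exponent in
  the claim. The resulting lower bound holds up to and including a first zero of \<open>I\<close>, so there is no such
  zero.
\<close>

lemma ode_comparison:
  fixes I E E' \<eta> :: "real \<Rightarrow> real"
  assumes ab: "a < b" and p: "0 < p" and \<eta>: "continuous_on {a..b} \<eta>"
    and I': "\<And>t. t \<in> {a..b} \<Longrightarrow> (I has_real_derivative p * (\<eta> t * I t - E t)) (at t within {a..b})"
    and E': "\<And>t. t \<in> {a..b} \<Longrightarrow> (E has_real_derivative E' t) (at t within {a..b})"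
    and le: "\<And>t. t \<in> {a..b} \<Longrightarrow> 0 < I t \<Longrightarrow> E' t \<le> p * (\<eta> t * E t - (E t)\<^sup>2 / I t)"
    and Ia: "0 < I a"
  shows "I a * exp (p * integral {a..b} \<eta> - p * (E a / I a) * (b - a)) \<le> I b"
proof -
  define \<kappa> where "\<kappa> = E a / I a"
  define W where "W t = p * integral {a..t} \<eta> - p * \<kappa> * (t - a)" for t
  have key: "I a * exp (W \<tau>) \<le> I \<tau>" if \<tau>: "a < \<tau>" "\<tau> \<le> b" and Ipos: "\<And>s. a \<le> s \<Longrightarrow> s < \<tau> \<Longrightarrow> 0 < I s" for \<tau>
  proof -
    \<comment> \<open>The mean value theorem evaluates derivatives at interior points only, where \<open>I\<close> is positive even if \<open>I \<tau> = 0\<close>.\<close>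
    have ratio: "E s \<le> \<kappa> * I s" if s: "a \<le> s" "s < \<tau>" for s
    proof (cases "s = a")
      case True then show ?thesis using Ia by (simp add: \<kappa>_def)
    next
      case False
      then have as: "a < s" using s by simp
      define d where "d t = (E' t * I t - E t * (p * (\<eta> t * I t - E t))) / (I t * I t)" for t
      have "((\<lambda>t. E t / I t) has_real_derivative d t) (at t within {a..s})" if t: "a \<le> t" "t \<le> s" for t
      proof -
        have "(E has_real_derivative E' t) (at t within {a..s})"
          "(I has_real_derivative p * (\<eta> t * I t - E t)) (at t within {a..s})"
          using t s \<tau> by (auto intro!: DERIV_subset[OF E'] DERIV_subset[OF I'])
        then show ?thesis unfolding d_def using Ipos[of t] t s by (intro DERIV_divide) auto
      qed
      then have "\<exists>x\<in>{a<..<s}. E s / I s - E a / I a = d x * (s - a)"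
        by (intro mvt_simple[OF as, of "\<lambda>t. E t / I t" "\<lambda>t. (*) (d t)"]) (simp add: has_field_derivative_def)
      then obtain x where x: "a < x" "x < s" "E s / I s - E a / I a = d x * (s - a)" by auto
      have Ix: "0 < I x" using Ipos[of x] x s by simp
      have "E' x * I x \<le> p * (\<eta> x * E x - (E x)\<^sup>2 / I x) * I x"
        using le[of x] x s \<tau> Ix by (intro mult_right_mono) auto
      also have "\<dots> = E x * (p * (\<eta> x * I x - E x))"
        using Ix by (simp add: field_simps power2_eq_square)
      finally have "d x \<le> 0" unfolding d_def using Ix by (simp add: divide_nonpos_pos)
      then have "d x * (s - a) \<le> 0" using as by (intro mult_nonpos_nonneg) auto
      then have "E s / I s \<le> \<kappa>" using x(3) unfolding \<kappa>_def by linarith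
      then show ?thesis using Ipos[OF s] by (simp add: field_simps)
    qed
    define L where "L t = I t * exp (- W t)" for t
    have "(L has_real_derivative p * exp (- W t) * (\<kappa> * I t - E t)) (at t within {a..\<tau>})"
      if t: "a \<le> t" "t \<le> \<tau>" for t
    proof -
      have tT: "t \<in> {a..b}" using t \<tau> by simp
      have "((\<lambda>t. integral {a..t} \<eta>) has_real_derivative \<eta> t) (at t within {a..b})"
        by (rule integral_has_real_derivative[OF \<eta> tT])
      then have "(W has_real_derivative p * \<eta> t - p * \<kappa>) (at t within {a..b})"
        unfolding W_def[abs_def] by (auto intro!: derivative_eq_intros)
      then have "(L has_real_derivative p * exp (- W t) * (\<kappa> * I t - E t)) (at t within {a..b})"
        unfolding L_def[abs_def] using I'[OF tT] by (auto intro!: derivative_eq_intros simp: algebra_simps)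
      then show ?thesis by (rule DERIV_subset) (use \<tau> in auto)
    qed
    then have "\<exists>x\<in>{a<..<\<tau>}. L \<tau> - L a = (p * exp (- W x) * (\<kappa> * I x - E x)) * (\<tau> - a)"
      by (intro mvt_simple[OF \<tau>(1), of L "\<lambda>t. (*) (p * exp (- W t) * (\<kappa> * I t - E t))"]) (simp add: has_field_derivative_def)
    then obtain x where x: "a < x" "x < \<tau>" "L \<tau> - L a = (p * exp (- W x) * (\<kappa> * I x - E x)) * (\<tau> - a)" by auto
    have "0 \<le> p * exp (- W x) * (\<kappa> * I x - E x)" using ratio[of x] x p by simp
    then have "L a \<le> L \<tau>" using x by (metis diff_ge_0_iff_ge less_imp_le mult_nonneg_nonneg order.strict_trans)
    then have "I a \<le> I \<tau> * exp (- W \<tau>)" by (simp add: L_def W_def)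
    then have "I a * exp (W \<tau>) \<le> I \<tau> * exp (- W \<tau>) * exp (W \<tau>)" by (intro mult_right_mono) auto
    then show ?thesis by (simp add: mult.assoc flip: exp_add)
  qed
  have pos: "0 < I t" if t: "t \<in> {a..b}" for t
  proof (rule ccontr)
    assume "\<not> 0 < I t"
    define Z where "Z = {a..b} \<inter> I -` {..0}"
    have "continuous_on {a..b} I" by (rule DERIV_continuous_on[OF I'])
    then have Z: "closed Z" unfolding Z_def
      by (rule continuous_closed_preimage[OF _ closed_atLeastAtMost closed_atMost])
    have ne: "Z \<noteq> {}" using t \<open>\<not> 0 < I t\<close> by (auto simp: Z_def)
    have bd: "bdd_below Z" by (rule bdd_belowI[of _ a]) (auto simp: Z_def)
    define t0 where "t0 = Inf Z"
    have "t0 \<in> Z" unfolding t0_def by (rule closed_contains_Inf[OF ne bd Z])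
    then have t0: "a \<le> t0" "t0 \<le> b" "I t0 \<le> 0" by (auto simp: Z_def)
    then have "a < t0" using Ia by (cases "a = t0") auto
    moreover have "0 < I s" if "a \<le> s" "s < t0" for s
    proof (rule ccontr)
      assume "\<not> 0 < I s"
      then have "s \<in> Z" using that t0 by (auto simp: Z_def)
      then have "t0 \<le> s" unfolding t0_def by (rule cInf_lower[OF _ bd])
      then show False using that by simp
    qed
    ultimately have "I a * exp (W t0) \<le> I t0" using key t0 by blast
    moreover have "0 < I a * exp (W t0)" using Ia by simp
    ultimately show False using t0 by linarith
  qed
  have "I a * exp (W b) \<le> I b" by (rule key[OF ab order_refl]) (use pos in auto)
  then show ?thesis by (simp add: W_def \<kappa>_def)
qed

context closed_riemannian_manifold
begin

text \<open>
  Locally the bound holds on a closed coordinate ball times the time interval, and finitely many of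
  these cover.
\<close>

lemma bounded_on_time_interval:
  fixes F :: "'a \<Rightarrow> real \<Rightarrow> real"
  assumes F: "\<And>c. c \<in> A \<Longrightarrow> continuous_on (codom_chart c \<times> {a..b}) (\<lambda>(y, t). F (param c y) t)"
  obtains B where "\<And>x t. t \<in> {a..b} \<Longrightarrow> \<bar>F x t\<bar> \<le> B"
proof -
  have "\<exists>U B. open U \<and> x \<in> U \<and> 0 \<le> B \<and> (\<forall>z\<in>U. \<forall>t\<in>{a..b}. \<bar>F z t\<bar> \<le> B)" for x
  proof -
    obtain c where c: "c \<in> A" "x \<in> dom_chart c" by (rule obtain_chart)
    let ?y = "coord c x"
    obtain r where r: "0 < r" "cball ?y r \<subseteq> codom_chart c"
      using open_codom[OF c(1)] c(2) open_contains_cball[of "codom_chart c"] by blast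
    have "compact ((\<lambda>(y, t). F (param c y) t) ` (cball ?y r \<times> {a..b}))"
      by (rule compact_continuous_image[OF continuous_on_subset[OF F[OF c(1)]]])
        (use r in \<open>auto intro!: compact_Times\<close>)
    then obtain B where B: "\<forall>v\<in>(\<lambda>(y, t). F (param c y) t) ` (cball ?y r \<times> {a..b}). norm v \<le> B"
      using compact_imp_bounded bounded_iff by blast
    let ?U = "param c ` ball ?y r"
    have sub: "ball ?y r \<subseteq> codom_chart c" using r(2) ball_subset_cball by blast
    have "open ?U" by (rule open_param_image[OF c(1) _ sub]) simp
    moreover have "x \<in> ?U" using c r(1) by (intro image_eqI[of _ _ ?y]) auto
    moreover have "\<bar>F z t\<bar> \<le> max 0 B" if zt: "z \<in> ?U" "t \<in> {a..b}" for z t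
    proof -
      obtain y where y: "y \<in> ball ?y r" "z = param c y" using zt by blast
      have "norm (case (y, t) of (y, t) \<Rightarrow> F (param c y) t) \<le> B"
        by (rule bspec[OF B], rule imageI) (use y zt in auto)
      then show ?thesis using y by simp
    qed
    ultimately show ?thesis by (intro exI[of _ ?U] exI[of _ "max 0 B"]) auto
  qed
  then have "\<forall>x. \<exists>U B. open U \<and> x \<in> U \<and> 0 \<le> B \<and> (\<forall>z\<in>U. \<forall>t\<in>{a..b}. \<bar>F z t\<bar> \<le> B)" by (rule allI)
  from choice[OF this] obtain U where "\<forall>x. \<exists>B. open (U x) \<and> x \<in> U x \<and> 0 \<le> B \<and> (\<forall>z\<in>U x. \<forall>t\<in>{a..b}. \<bar>F z t\<bar> \<le> B)"
    by (elim exE) (rule that)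
  from choice[OF this] obtain B where UB: "\<forall>x. open (U x) \<and> x \<in> U x \<and> 0 \<le> B x \<and> (\<forall>z\<in>U x. \<forall>t\<in>{a..b}. \<bar>F z t\<bar> \<le> B x)"
    by (elim exE) (rule that)
  have U: "\<And>x. open (U x)" "\<And>x. x \<in> U x" "\<And>x. 0 \<le> B x" using UB by auto
  have UBz: "\<bar>F z t\<bar> \<le> B x" if "z \<in> U x" "t \<in> {a..b}" for x z t using UB that by blast
  obtain X where X: "finite X" "UNIV \<subseteq> (\<Union>x\<in>X. U x)"
    by (rule compactE_image[OF compact, of UNIV U]) (use U in auto)
  show thesis
  proof (rule that[of "\<Sum>x\<in>X. B x"])
    fix z t assume t: "t \<in> {a..b}"
    obtain x where x: "x \<in> X" "z \<in> U x" using X(2) by blast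
    have "\<bar>F z t\<bar> \<le> B x" by (rule UBz[OF x(2) t])
    also have "\<dots> \<le> (\<Sum>x\<in>X. B x)" using X(1) x(1) U(3) by (intro member_le_sum) auto
    finally show "\<bar>F z t\<bar> \<le> (\<Sum>x\<in>X. B x)" .
  qed
qed

lemma has_div_unique:
  assumes "has_div A G X x l" "has_div A G X x l'"
  shows "l = l'"
proof -
  obtain c where c: "c \<in> A" "x \<in> dom_chart c" by (rule obtain_chart)
  let ?Z = "\<lambda>y. vol_density G c (param c y) *\<^sub>R X c (param c y)"
  obtain D where D: "(?Z has_derivative D) (at (coord c x))"
    "l = (\<Sum>i\<in>UNIV. D (axis i 1) $ i) / vol_density G c x"
    using assms(1) c unfolding has_div_def by blast
  obtain D' where D': "(?Z has_derivative D') (at (coord c x))"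
    "l' = (\<Sum>i\<in>UNIV. D' (axis i 1) $ i) / vol_density G c x"
    using assms(2) c unfolding has_div_def by blast
  have "D = D'" by (rule has_derivative_unique[OF D(1) D'(1)])
  then show ?thesis using D D' by simp
qed

lemma has_div_divergence: "has_div A G X x l \<Longrightarrow> has_div A G X x (divergence A G X x)"
  unfolding divergence_def by (rule theI) (auto intro: has_div_unique)

end

section \<open>Solutions of the evolution equation\<close>

locale p_flow = closed_riemannian_manifold A G
  for A :: "('a::{t2_space, second_countable_topology}, 'n::finite) chart set"
    and G :: "('a, 'n) chart \<Rightarrow> 'a \<Rightarrow> real ^ 'n ^ 'n" +
  fixes f :: "'a \<Rightarrow> real" and p a b :: real and u :: "'a \<Rightarrow> real \<Rightarrow> real" and \<eta> :: "real \<Rightarrow> real"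
  assumes f_smooth: "smooth_fun A f" and p_gt_1: "1 < p" and ab: "a < b"
    and u_smooth: "smooth_fun_time A {a..b} u" and eta_smooth: "smooth_on {a..b} \<eta>"
    and solves: "solves_p_equation A G f p \<eta> a b u"
begin

abbreviation T :: "real set" where "T \<equiv> {a..b}"

definition ut :: "'a \<Rightarrow> real \<Rightarrow> real" where
  "ut x t = vector_derivative (u x) (at t within T)"

definition flux :: "real \<Rightarrow> ('a, 'n) chart \<Rightarrow> 'a \<Rightarrow> real ^ 'n" where
  "flux t = weighted_flux G f p (\<lambda>z. u z t)"

definition divf :: "'a \<Rightarrow> real \<Rightarrow> real" where
  "divf x t = divergence A G (flux t) x"

text \<open>
  In terms of \<open>w\<close> the equation states that the p-Laplacian of \<open>u\<close> is \<open>|u|^(p-2) w\<close>.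
\<close>

definition w :: "'a \<Rightarrow> real \<Rightarrow> real" where
  "w x t = ut x t - \<eta> t * u x t"

lemma
  assumes c: "c \<in> A"
  shows chart_du: "y \<in> codom_chart c \<Longrightarrow> t \<in> T \<Longrightarrow>
      ((\<lambda>y. u (param c y) t) has_derivative (\<lambda>v. dcoord c (\<lambda>z. u z t) (param c y) \<bullet> v)) (at y)"
    and chart_ut: "y \<in> codom_chart c \<Longrightarrow> t \<in> T \<Longrightarrow>
      (u (param c y) has_real_derivative ut (param c y) t) (at t within T)"
    and chart_dut: "y \<in> codom_chart c \<Longrightarrow> t \<in> T \<Longrightarrow>
      ((\<lambda>y. ut (param c y) t) has_derivative (\<lambda>v. dcoord c (\<lambda>z. ut z t) (param c y) \<bullet> v)) (at y)"
    and chart_mixed: "y \<in> codom_chart c \<Longrightarrow> t \<in> T \<Longrightarrow>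
      ((\<lambda>t. dcoord c (\<lambda>z. u z t) (param c y)) has_vector_derivative dcoord c (\<lambda>z. ut z t) (param c y)) (at t within T)"
    and chart_cont_u: "continuous_on (codom_chart c \<times> T) (\<lambda>(y, t). u (param c y) t)"
    and chart_cont_ut: "continuous_on (codom_chart c \<times> T) (\<lambda>(y, t). ut (param c y) t)"
    and chart_cont_du: "continuous_on (codom_chart c \<times> T) (\<lambda>(y, t). dcoord c (\<lambda>z. u z t) (param c y))"
    and chart_cont_dut: "continuous_on (codom_chart c \<times> T) (\<lambda>(y, t). dcoord c (\<lambda>z. ut z t) (param c y))"
proof -
  have sm: "smooth_on (codom_chart c \<times> T) (\<lambda>(y, t). u (param c y) t)"
    using u_smooth c unfolding smooth_fun_time_def by blast
  then show "continuous_on (codom_chart c \<times> T) (\<lambda>(y, t). u (param c y) t)"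
    by (rule smooth_on_imp_continuous_on)
  from mixed_derivatives[OF open_codom[OF c] ab sm]
  obtain Dx wt Dxt where D: "\<forall>y\<in>codom_chart c. \<forall>t\<in>T.
      ((\<lambda>y. u (param c y) t) has_derivative (\<lambda>v. Dx y t \<bullet> v)) (at y) \<and>
      ((\<lambda>t. u (param c y) t) has_real_derivative wt y t) (at t within T) \<and>
      ((\<lambda>y. wt y t) has_derivative (\<lambda>v. Dxt y t \<bullet> v)) (at y) \<and>
      (Dx y has_vector_derivative Dxt y t) (at t within T)"
    and cont: "continuous_on (codom_chart c \<times> T) (\<lambda>(y, t). Dx y t)"
      "continuous_on (codom_chart c \<times> T) (\<lambda>(y, t). wt y t)"
      "continuous_on (codom_chart c \<times> T) (\<lambda>(y, t). Dxt y t)"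
    by (elim exE conjE) (rule that)
  note DD = bspec[OF bspec[OF D]]
  note D1 = DD[THEN conjunct1] and D2 = DD[THEN conjunct2, THEN conjunct1]
    and D3 = DD[THEN conjunct2, THEN conjunct2, THEN conjunct1]
    and D4 = DD[THEN conjunct2, THEN conjunct2, THEN conjunct2]
  have e1: "dcoord c (\<lambda>z. u z t) (param c y) = Dx y t" if "y \<in> codom_chart c" "t \<in> T" for y t
    by (rule dcoord_eqI[OF c that(1) D1[OF that]])
  have e2: "ut (param c y) t = wt y t" if "y \<in> codom_chart c" "t \<in> T" for y t
    unfolding ut_def
    by (rule vector_derivative_within_closed_interval[OF ab that(2)])
      (use D2[OF that] in \<open>simp add: has_real_derivative_iff_has_vector_derivative\<close>)
  have D3': "((\<lambda>y. ut (param c y) t) has_derivative (\<lambda>v. Dxt y t \<bullet> v)) (at y)"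
    if "y \<in> codom_chart c" "t \<in> T" for y t
    by (rule has_derivative_transform_within_open[OF D3[OF that] open_codom[OF c] that(1)])
      (simp add: e2[OF _ that(2)])
  have e3: "dcoord c (\<lambda>z. ut z t) (param c y) = Dxt y t" if "y \<in> codom_chart c" "t \<in> T" for y t
    by (rule dcoord_eqI[OF c that(1) D3'[OF that]])
  show "((\<lambda>y. u (param c y) t) has_derivative (\<lambda>v. dcoord c (\<lambda>z. u z t) (param c y) \<bullet> v)) (at y)"
    if "y \<in> codom_chart c" "t \<in> T" using D1[OF that] unfolding e1[OF that] .
  show "(u (param c y) has_real_derivative ut (param c y) t) (at t within T)"
    if "y \<in> codom_chart c" "t \<in> T" using D2[OF that] unfolding e2[OF that] .
  show "((\<lambda>y. ut (param c y) t) has_derivative (\<lambda>v. dcoord c (\<lambda>z. ut z t) (param c y) \<bullet> v)) (at y)"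
    if "y \<in> codom_chart c" "t \<in> T" using D3'[OF that] unfolding e3[OF that] .
  show "((\<lambda>t. dcoord c (\<lambda>z. u z t) (param c y)) has_vector_derivative dcoord c (\<lambda>z. ut z t) (param c y)) (at t within T)"
    if "y \<in> codom_chart c" "t \<in> T"
    unfolding e3[OF that]
    by (rule has_vector_derivative_transform[OF that(2) _ D4[OF that]]) (simp add: e1 that(1))
  show "continuous_on (codom_chart c \<times> T) (\<lambda>(y, t). ut (param c y) t)"
    by (rule continuous_on_eq[OF cont(2)]) (auto simp: e2)
  show "continuous_on (codom_chart c \<times> T) (\<lambda>(y, t). dcoord c (\<lambda>z. u z t) (param c y))"
    by (rule continuous_on_eq[OF cont(1)]) (auto simp: e1)
  show "continuous_on (codom_chart c \<times> T) (\<lambda>(y, t). dcoord c (\<lambda>z. ut z t) (param c y))"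
    by (rule continuous_on_eq[OF cont(3)]) (auto simp: e3)
qed

lemma continuous_on_slice:
  assumes "continuous_on (V \<times> T) (\<lambda>(y, t). g y t)" "t \<in> T"
  shows "continuous_on V (\<lambda>y. g y t)"
proof -
  have 1: "continuous_on V (\<lambda>y. (y, t))" by (intro continuous_intros)
  have 2: "(\<lambda>y. (y, t)) ` V \<subseteq> V \<times> T" using assms by auto
  show ?thesis using continuous_on_compose2[OF assms(1) 1 2] by simp
qed

lemma C1_u: "t \<in> T \<Longrightarrow> C1_fun (\<lambda>z. u z t)"
  by (rule C1_I[OF chart_du]) (auto intro: continuous_on_slice[OF chart_cont_du])

lemma C1_ut: "t \<in> T \<Longrightarrow> C1_fun (\<lambda>z. ut z t)"
  by (rule C1_I[OF chart_dut]) (auto intro: continuous_on_slice[OF chart_cont_dut])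

lemma u_time_derivative: "t \<in> T \<Longrightarrow> (u x has_real_derivative ut x t) (at t within T)"
proof -
  assume t: "t \<in> T"
  obtain c where c: "c \<in> A" "x \<in> dom_chart c" by (rule obtain_chart)
  show ?thesis using chart_ut[OF c(1), of "coord c x" t] c t by simp
qed

lemma f_continuous: "continuous_on UNIV f"
  by (rule smooth_fun_continuous[OF f_smooth])

lemma vector_field_flux: "t \<in> T \<Longrightarrow> vector_field (flux t)"
  unfolding flux_def by (rule vector_field_weighted_flux[OF f_continuous C1_u p_gt_1])

lemma has_div_flux: "t \<in> T \<Longrightarrow> has_div A G (flux t) x (divf x t)"
  using solves has_div_divergence unfolding solves_p_equation_def p_laplacian_exists_def flux_def divf_def by blast

lemma equation:
  assumes "t \<in> T" "p \<ge> 2 \<or> u x t \<noteq> 0"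
  shows "divf x t = exp (- f x) * (abs_powr (u x t) (p - 2) * w x t)"
proof -
  have "abs_powr (u x t) (p - 2) * ut x t - exp (f x) * divf x t = \<eta> t * (abs_powr (u x t) (p - 2) * u x t)"
    using solves assms unfolding solves_p_equation_def p_laplacian_def ut_def divf_def flux_def by blast
  then have "exp (f x) * divf x t = abs_powr (u x t) (p - 2) * w x t"
    by (simp add: w_def algebra_simps)
  then have "exp (- f x) * (exp (f x) * divf x t) = exp (- f x) * (abs_powr (u x t) (p - 2) * w x t)" by simp
  then show ?thesis by (simp add: mult.assoc[symmetric] flip: exp_add)
qed

lemma abs_powr_mult_self: "r \<noteq> 0 \<Longrightarrow> r * abs_powr r (p - 2) = sgn r * \<bar>r\<bar> powr (p - 1)"
proof -
  assume r: "r \<noteq> 0"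
  have "r * abs_powr r (p - 2) = sgn r * (\<bar>r\<bar> * \<bar>r\<bar> powr (p - 2))"
    using r by (simp add: abs_powr_def sgn_if)
  also have "\<bar>r\<bar> * \<bar>r\<bar> powr (p - 2) = \<bar>r\<bar> powr (p - 1)"
    using powr_mult_base[of "\<bar>r\<bar>" "p - 2"] by simp
  finally show ?thesis .
qed

lemma abs_powr_mult_sq: "r \<noteq> 0 \<Longrightarrow> abs_powr r (p - 2) * r\<^sup>2 = \<bar>r\<bar> powr p"
proof -
  assume r: "r \<noteq> 0"
  have "abs_powr r (p - 2) * r\<^sup>2 = r * (r * abs_powr r (p - 2))"
    by (simp add: power2_eq_square)
  also have "\<dots> = \<bar>r\<bar> * (\<bar>r\<bar> powr (p - 1))"
    unfolding abs_powr_mult_self[OF r] by (simp add: sgn_if)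
  also have "\<dots> = \<bar>r\<bar> powr p" using powr_mult_base[of "\<bar>r\<bar>" "p - 1"] by simp
  finally show ?thesis .
qed

text \<open>
  At the zeros of \<open>u\<close> both sides vanish, because \<open>p > 1\<close>; so the left-hand side is continuous although
  \<open>divf\<close> may not be.
\<close>

lemma u_mult_divf:
  assumes "t \<in> T"
  shows "u x t * divf x t = exp (- f x) * (sgn (u x t) * \<bar>u x t\<bar> powr (p - 1)) * w x t"
proof (cases "u x t = 0")
  case False
  have "u x t * divf x t = exp (- f x) * (u x t * abs_powr (u x t) (p - 2)) * w x t"
    unfolding equation[OF assms disjI2[OF False]] by (simp add: mult_ac)
  then show ?thesis unfolding abs_powr_mult_self[OF False] .
qed simp

lemma continuous_u: "t \<in> T \<Longrightarrow> continuous_on UNIV (\<lambda>x. u x t)"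
  and continuous_w: "t \<in> T \<Longrightarrow> continuous_on UNIV (\<lambda>x. w x t)"
  unfolding w_def by (intro continuous_intros C1_continuous C1_u C1_ut; assumption)+

text \<open>
  For \<open>p < 2\<close> the equation is silent at a zero of \<open>u\<close>. But where \<open>u\<close> is nonzero the divergence has the
  sign of \<open>w\<close>, and if \<open>w\<close> is nonzero this sign is constant nearby, so that \<open>divergence_sign_at_zero\<close>
  gives it at the zero as well.
\<close>

lemma w_mult_divf_nonneg:
  assumes t: "t \<in> T" and u0: "u x t = 0"
  shows "0 \<le> w x t * divf x t"
proof (cases "p \<ge> 2")
  case True
  have "0 \<le> abs_powr (u x t) (p - 2)" by (simp add: abs_powr_def)
  then have "0 \<le> exp (- f x) * (abs_powr (u x t) (p - 2) * (w x t)\<^sup>2)" by simp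
  then show ?thesis
    unfolding equation[OF t disjI1[OF True]] by (simp add: power2_eq_square mult_ac)
next
  case False
  show ?thesis
  proof (cases "w x t = 0")
    case nz: False
    define \<sigma> where "\<sigma> = sgn (w x t)"
    have \<sigma>: "\<bar>\<sigma>\<bar> = 1" "0 < \<sigma> * w x t" using nz by (auto simp: \<sigma>_def sgn_if)
    define W where "W = {z. 0 < \<sigma> * w z t}"
    have W: "open W" unfolding W_def
      by (rule open_Collect_less) (intro continuous_intros continuous_w t)+
    have "0 \<le> \<sigma> * divf x t"
    proof (rule divergence_sign_at_zero[OF C1_u[OF t] _ u0 W])
      show "has_div A G (weighted_flux G f p (\<lambda>z. u z t)) x (divf x t)" for x
        using has_div_flux[OF t] by (simp add: flux_def)
      show "x \<in> W" using \<sigma> by (simp add: W_def)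
      show "0 \<le> \<sigma> * divf z t" if "z \<in> W" "u z t \<noteq> 0" for z
      proof -
        have "0 \<le> exp (- f z) * abs_powr (u z t) (p - 2) * (\<sigma> * w z t)"
          using that by (simp add: W_def abs_powr_def)
        then show ?thesis unfolding equation[OF t disjI2[OF that(2)]] by (simp add: mult_ac)
      qed
    qed (rule \<sigma>(1))
    then have "0 \<le> (\<sigma> * w x t) * (\<sigma> * divf x t)" using \<sigma> by simp
    also have "\<dots> = \<sigma>\<^sup>2 * (w x t * divf x t)" by (simp add: power2_eq_square mult_ac)
    also have "\<sigma>\<^sup>2 = 1" using \<sigma>(1) by (metis power2_abs power_one)
    finally show ?thesis by simp
  qed simp
qed

definition weight :: "'a \<Rightarrow> real" where "weight x = exp (- f x)"

definition mass :: "real \<Rightarrow> real" where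
  "mass t = (LINT x|vol. \<bar>u x t\<bar> powr p * weight x)"

definition energy :: "real \<Rightarrow> real" where
  "energy t = (LINT x|vol. deriv_along (flux t) (\<lambda>z. u z t) x)"

definition energy_deriv :: "real \<Rightarrow> real" where
  "energy_deriv t = (LINT x|vol. p * deriv_along (flux t) (\<lambda>z. ut z t) x)"

lemma weight_pos: "0 < weight x"
  by (simp add: weight_def)

lemma continuous_weight: "continuous_on UNIV weight"
  unfolding weight_def[abs_def] by (intro continuous_intros f_continuous)

lemma continuous_u_mult_divf: "t \<in> T \<Longrightarrow> continuous_on UNIV (\<lambda>x. u x t * divf x t)"
  by (simp add: u_mult_divf, intro continuous_on_mult continuous_on_sgn_powr continuous_u continuous_w
      continuous_weight[unfolded weight_def[abs_def]]) (use p_gt_1 in auto)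

lemma continuous_mass_density: "t \<in> T \<Longrightarrow> continuous_on UNIV (\<lambda>x. \<bar>u x t\<bar> powr p * weight x)"
  by (intro continuous_on_mult continuous_on_abs_powr continuous_u continuous_weight) (use p_gt_1 in auto)

lemma integral_weighted_volume:
  fixes F :: "'a \<Rightarrow> real"
  assumes "F \<in> borel_measurable borel"
  shows "(LINT x|weighted_volume A G f. F x) = (LINT x|vol. weight x * F x)"
proof -
  have "weight \<in> borel_measurable borel" by (rule borel_measurable_continuous_onI[OF continuous_weight])
  then show ?thesis
    unfolding weighted_volume_def weight_def[symmetric] using assms weight_pos
    by (subst integral_density) (auto simp: less_imp_le)
qed

lemma I_p_eq_mass: "t \<in> T \<Longrightarrow> I_p A G f p u t = mass t"
proof -
  assume t: "t \<in> T"
  have "(\<lambda>x. \<bar>u x t\<bar> powr p) \<in> borel_measurable borel"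
    by (intro borel_measurable_continuous_onI continuous_on_abs_powr continuous_u t) (use p_gt_1 in auto)
  from integral_weighted_volume[OF this] show ?thesis
    by (simp add: I_p_def mass_def mult.commute)
qed

lemma D_p_eq: "t \<in> T \<Longrightarrow> D_p A G f p u t = (LINT x|vol. u x t * divf x t)"
proof -
  assume t: "t \<in> T"
  have eq: "u x t * p_laplacian A G f p (\<lambda>z. u z t) x = exp (f x) * (u x t * divf x t)" for x
    by (simp add: p_laplacian_def divf_def flux_def)
  have "(\<lambda>x. exp (f x) * (u x t * divf x t)) \<in> borel_measurable borel"
    by (intro borel_measurable_continuous_onI continuous_on_mult[OF _ continuous_u_mult_divf[OF t]]
        continuous_on_exp f_continuous)
  from integral_weighted_volume[OF this] have "D_p A G f p u t = (LINT x|vol. weight x * (exp (f x) * (u x t * divf x t)))"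
    by (simp add: D_p_def eq)
  then show ?thesis by (simp add: weight_def mult.assoc[symmetric] flip: exp_add)
qed

lemma continuous_energy_densities:
  assumes "t \<in> T"
  shows "continuous_on UNIV (deriv_along (flux t) (\<lambda>z. u z t))"
    and "continuous_on UNIV (deriv_along (flux t) (\<lambda>z. ut z t))"
  by (intro continuous_deriv_along vector_field_flux C1_u C1_ut assms)+

lemma deriv_along_scale:
  assumes "vector_field X" "C1_fun \<phi>"
  shows "deriv_along X (\<lambda>x. k * \<phi> x) x = k * deriv_along X \<phi> x"
proof -
  obtain c where c: "c \<in> A" "x \<in> dom_chart c" by (rule obtain_chart)
  show ?thesis
    by (simp add: deriv_along_eq[OF assms(1) C1_scale[OF assms(2)] c] deriv_along_eq[OF assms c]
        dcoord_scale[OF assms(2) c])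
qed

lemma deriv_along_add:
  assumes "vector_field X" "C1_fun \<phi>" "C1_fun \<psi>"
  shows "deriv_along X (\<lambda>x. \<phi> x + \<psi> x) x = deriv_along X \<phi> x + deriv_along X \<psi> x"
proof -
  obtain c where c: "c \<in> A" "x \<in> dom_chart c" by (rule obtain_chart)
  show ?thesis
    by (simp add: deriv_along_eq[OF assms(1) C1_add[OF assms(2,3)] c] deriv_along_eq[OF assms(1,2) c]
        deriv_along_eq[OF assms(1,3) c] dcoord_add[OF assms(2,3) c] inner_add_left)
qed

text \<open>
  Integration by parts against \<open>u\<close>: since \<open>u * divf\<close> is continuous, the divergence inequality applies
  to both \<open>u\<close> and \<open>- u\<close> and gives an equation.
\<close>

lemma D_p_eq_energy:
  assumes t: "t \<in> T"
  shows "D_p A G f p u t = - energy t"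
proof -
  let ?X = "flux t" and ?k = "\<lambda>x. u x t * divf x t"
  note cont = continuous_u_mult_divf[OF t] continuous_energy_densities(1)[OF t]
  have "(LINT x|vol. ?k x + deriv_along ?X (\<lambda>z. u z t) x) \<le> 0"
    by (rule divergence_inequality[OF vector_field_flux[OF t] has_div_flux[OF t] C1_u[OF t] cont(1)]) simp
  moreover have "(LINT x|vol. - ?k x + deriv_along ?X (\<lambda>z. (- 1) * u z t) x) \<le> 0"
    by (rule divergence_inequality[OF vector_field_flux[OF t] has_div_flux[OF t] C1_scale[OF C1_u[OF t]]
          continuous_on_minus[OF cont(1)]]) simp
  ultimately show ?thesis
    unfolding deriv_along_scale[OF vector_field_flux[OF t] C1_u[OF t]]
    by (simp add: D_p_eq[OF t] energy_def integrable_vol_continuous cont)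
qed

lemma deriv_along_flux:
  assumes t: "t \<in> T" and \<phi>: "C1_fun \<phi>" and c: "c \<in> A" "x \<in> dom_chart c"
  defines "H \<equiv> matrix_inv (G c x)" and "\<xi> \<equiv> dcoord c (\<lambda>z. u z t) x"
  shows "deriv_along (flux t) \<phi> x =
    weight x * (sqrt (\<xi> \<bullet> (H *v \<xi>)) powr (p - 2) * ((H *v \<xi>) \<bullet> dcoord c \<phi> x))"
proof -
  have g: "grad G (\<lambda>z. u z t) c x = H *v \<xi>" by (simp add: grad_eq H_def \<xi>_def)
  have "metric_norm G c x (H *v \<xi>) = sqrt (\<xi> \<bullet> (H *v \<xi>))"
    using metric_grad[OF c, of "\<lambda>z. u z t"] unfolding g metric_norm_def
    by (simp add: \<xi>_def[symmetric] inner_commute)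
  then show ?thesis
    unfolding deriv_along_eq[OF vector_field_flux[OF t] \<phi> c]
    by (simp add: flux_def weighted_flux_def g weight_def inner_commute)
qed

text \<open>
  In a chart the density is a power of the quadratic form of the inverse metric at \<open>du\<close>, and
  \<open>chart_mixed\<close> provides the time derivative of \<open>du\<close>.
\<close>

lemma energy_has_derivative:
  assumes t: "t \<in> T"
  shows "(energy has_real_derivative energy_deriv t) (at t within T)"
proof -
  define K where "K x t = deriv_along (flux t) (\<lambda>z. u z t) x" for x t
  define K' where "K' x t = p * deriv_along (flux t) (\<lambda>z. ut z t) x" for x t
  have der: "(K x has_real_derivative K' x t) (at t within T)" if t: "t \<in> T" for x t
  proof -
    obtain c where c: "c \<in> A" "x \<in> dom_chart c" by (rule obtain_chart)
    define H where "H = matrix_inv (G c x)"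
    define \<xi> where "\<xi> t = dcoord c (\<lambda>z. u z t) x" for t
    define \<xi>' where "\<xi>' = dcoord c (\<lambda>z. ut z t) x"
    have H: "transpose H = H" "\<And>v. v \<noteq> 0 \<Longrightarrow> 0 < v \<bullet> (H *v v)"
      unfolding H_def using transpose_matrix_inv_posdef[OF metric_sym[OF c] metric_pos[OF c]]
        matrix_inv_posdef[OF metric_sym[OF c] metric_pos[OF c]] by auto
    have "(\<xi> has_vector_derivative \<xi>') (at t within T)"
      using chart_mixed[OF c(1), of "coord c x" t] c t by (simp add: \<xi>_def[abs_def] \<xi>'_def)
    then have "(\<xi> has_derivative (\<lambda>r. r *\<^sub>R \<xi>')) (at t within T)" by (simp add: has_vector_derivative_def)
    from has_derivative_compose[OF this has_derivative_power_form[OF H p_gt_1]]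
    have "((\<lambda>t. sqrt (\<xi> t \<bullet> (H *v \<xi> t)) powr (p - 2) * (\<xi> t \<bullet> (H *v \<xi> t))) has_derivative
        (\<lambda>r. p * sqrt (\<xi> t \<bullet> (H *v \<xi> t)) powr (p - 2) * ((H *v \<xi> t) \<bullet> (r *\<^sub>R \<xi>')))) (at t within T)" .
    then have "((\<lambda>t. sqrt (\<xi> t \<bullet> (H *v \<xi> t)) powr (p - 2) * (\<xi> t \<bullet> (H *v \<xi> t))) has_real_derivative
        p * sqrt (\<xi> t \<bullet> (H *v \<xi> t)) powr (p - 2) * ((H *v \<xi> t) \<bullet> \<xi>')) (at t within T)"
      unfolding has_field_derivative_def by (rule has_derivative_eq_rhs) (simp add: fun_eq_iff)
    from DERIV_cmult[OF this, of "weight x"]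
    have "((\<lambda>t. weight x * (sqrt (\<xi> t \<bullet> (H *v \<xi> t)) powr (p - 2) * (\<xi> t \<bullet> (H *v \<xi> t)))) has_real_derivative
        K' x t) (at t within T)"
      by (simp add: K'_def deriv_along_flux[OF t C1_ut[OF t] c] H_def \<xi>_def \<xi>'_def mult_ac)
    then show ?thesis
      by (rule has_field_derivative_transform_within[OF _ zero_less_one t])
        (simp add: K_def deriv_along_flux[OF _ C1_u c] H_def \<xi>_def inner_commute)
  qed
  obtain B where B: "\<And>x t. t \<in> T \<Longrightarrow> \<bar>K' x t\<bar> \<le> B"
  proof (rule bounded_on_time_interval[of a b K'])
    fix c assume c: "c \<in> A"
    let ?S = "codom_chart c \<times> T"
    let ?x = "\<lambda>z. param c (fst z)"
    define M where "M z = G c (?x z)" for z :: "(real ^ 'n) \<times> real"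
    define g where "g z = matrix_inv (M z) *v dcoord c (\<lambda>x. u x (snd z)) (?x z)" for z :: "(real ^ 'n) \<times> real"
    have fst_cont: "continuous_on ?S F" if "continuous_on (codom_chart c) (\<lambda>y. F' y)" "F = (\<lambda>z. F' (fst z))"
      for F :: "(real ^ 'n) \<times> real \<Rightarrow> 'x::topological_space" and F'
      unfolding that(2) by (rule continuous_on_compose2[OF that(1)]) (auto intro!: continuous_intros)
    have M: "continuous_on ?S M" by (rule fst_cont[OF continuous_metric[OF c]]) (simp add: M_def[abs_def])
    have pos: "0 < v \<bullet> (M z *v v)" if "z \<in> ?S" "v \<noteq> 0" for z v
      unfolding M_def by (rule metric_pos[OF c]) (use that c in auto)
    have g: "continuous_on ?S g" unfolding g_def[abs_def]
      by (rule continuous_on_matrix_inv_mult[OF M _ pos])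
        (use chart_cont_du[OF c] in \<open>simp_all add: case_prod_unfold\<close>)
    have "continuous_on ?S (\<lambda>z. p * ((exp (- f (?x z)) *\<^sub>R
        (sqrt (g z \<bullet> (M z *v g z)) powr (p - 2) *\<^sub>R g z)) \<bullet> dcoord c (\<lambda>x. ut x (snd z)) (?x z)))"
    proof (intro continuous_on_mult continuous_on_const continuous_on_inner continuous_on_scaleR[OF _ continuous_on_power_flux[OF M g pos p_gt_1]])
      show "continuous_on ?S (\<lambda>z. exp (- f (?x z)))"
        by (rule fst_cont[of "\<lambda>y. exp (- f (param c y))"])
          (auto intro!: continuous_intros continuous_on_param[OF f_continuous c])
      show "continuous_on ?S (\<lambda>z. dcoord c (\<lambda>x. ut x (snd z)) (?x z))"
        using chart_cont_dut[OF c] by (simp add: case_prod_unfold)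
    qed
    then show "continuous_on ?S (\<lambda>(y, t). K' (param c y) t)"
    proof (rule continuous_on_eq)
      fix z assume z: "z \<in> ?S"
      then have zt: "snd z \<in> T" and zx: "?x z \<in> dom_chart c" using c by auto
      show "p * ((exp (- f (?x z)) *\<^sub>R (sqrt (g z \<bullet> (M z *v g z)) powr (p - 2) *\<^sub>R g z))
          \<bullet> dcoord c (\<lambda>x. ut x (snd z)) (?x z)) = (case z of (y, t) \<Rightarrow> K' (param c y) t)"
        unfolding case_prod_unfold K'_def deriv_along_eq[OF vector_field_flux[OF zt] C1_ut[OF zt] c zx]
        by (simp add: flux_def weighted_flux_def metric_norm_def grad_eq g_def M_def inner_commute)
    qed
  qed (rule that)
  have "((\<lambda>t. LINT x|vol. K x t) has_real_derivative (LINT x|vol. K' x t)) (at t within T)"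
    by (rule has_real_derivative_integral[OF finite_measure_vol der B _ t])
      (auto simp: K_def[abs_def] intro!: integrable_vol_continuous continuous_energy_densities)
  then show ?thesis unfolding K_def K'_def energy_def[abs_def, symmetric] energy_deriv_def .
qed

text \<open>
  The time derivative of the density is \<open>p u divf + p \<eta> |u|^p weight\<close>, by \<open>u_mult_divf\<close>.
\<close>

lemma mass_has_derivative:
  assumes t: "t \<in> T"
  shows "(mass has_real_derivative p * (\<eta> t * mass t - energy t)) (at t within T)"
proof -
  define h where "h x t = \<bar>u x t\<bar> powr p * weight x" for x t
  define h' where "h' x t = p * (sgn (u x t) * \<bar>u x t\<bar> powr (p - 1)) * ut x t * weight x" for x t
  have der: "(h x has_real_derivative h' x t) (at t within T)" if t: "t \<in> T" for x t
  proof -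
    have "((\<lambda>t. \<bar>u x t\<bar> powr p) has_real_derivative p * (sgn (u x t) * \<bar>u x t\<bar> powr (p - 1)) * ut x t) (at t within T)"
      using DERIV_chain2[OF has_real_derivative_abs_powr[OF p_gt_1] u_time_derivative[OF t]] .
    from DERIV_cmult_right[OF this, of "weight x"] show ?thesis unfolding h_def[abs_def] h'_def .
  qed
  obtain B where B: "\<And>x t. t \<in> T \<Longrightarrow> \<bar>h' x t\<bar> \<le> B"
  proof (rule bounded_on_time_interval[of a b h'])
    fix c assume c: "c \<in> A"
    let ?S = "codom_chart c \<times> T"
    have cu: "continuous_on ?S (\<lambda>z. u (param c (fst z)) (snd z))"
      "continuous_on ?S (\<lambda>z. ut (param c (fst z)) (snd z))"
      using chart_cont_u[OF c] chart_cont_ut[OF c] by (simp_all add: case_prod_unfold)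
    have cw: "continuous_on ?S (\<lambda>z. weight (param c (fst z)))"
      by (rule continuous_on_compose2[OF continuous_on_param[OF continuous_weight c]])
        (auto intro!: continuous_intros)
    show "continuous_on ?S (\<lambda>(y, t). h' (param c y) t)"
      unfolding h'_def case_prod_unfold
      by (intro continuous_on_mult continuous_on_const continuous_on_sgn_powr cu cw) (use p_gt_1 in auto)
  qed (rule that)
  have 1: "((\<lambda>t. LINT x|vol. h x t) has_real_derivative (LINT x|vol. h' x t)) (at t within T)"
    by (rule has_real_derivative_integral[OF finite_measure_vol der B _ t])
      (auto simp: h_def intro!: integrable_vol_continuous continuous_mass_density)
  have "h' x t = p * (u x t * divf x t) + p * \<eta> t * (\<bar>u x t\<bar> powr p * weight x)" for x
  proof -
    have "sgn (u x t) * \<bar>u x t\<bar> powr (p - 1) * u x t = \<bar>u x t\<bar> powr p"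
      using powr_mult_base[of "\<bar>u x t\<bar>" "p - 1"] by (cases "u x t = 0") (auto simp: sgn_if mult_ac)
    then show ?thesis
      unfolding u_mult_divf[OF t] h'_def weight_def w_def by (simp add: algebra_simps)
  qed
  then have "(LINT x|vol. h' x t) = p * (LINT x|vol. u x t * divf x t) + p * \<eta> t * mass t"
    by (simp add: mass_def integrable_vol_continuous continuous_u_mult_divf[OF t] continuous_mass_density[OF t])
  also have "\<dots> = p * (\<eta> t * mass t - energy t)"
    using D_p_eq_energy[OF t] D_p_eq[OF t] by (simp add: algebra_simps)
  finally show ?thesis using 1 unfolding h_def mass_def[abs_def, symmetric] by simp
qed

text \<open>
  The divergence inequality with the test function \<open>u_t - (\<eta> + 2 \<kappa>) u = w - 2 \<kappa> u\<close>. Its product with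
  \<open>divf\<close> is, up to a nonnegative factor, \<open>w^2 - 2 \<kappa> u w \<ge> - \<kappa>^2 u^2\<close>, and the right-hand side turns into
  a continuous function after multiplication with that factor.
\<close>

lemma energy_deriv_le:
  assumes t: "t \<in> T"
  shows "energy_deriv t \<le> p * ((\<eta> t + 2 * \<kappa>) * energy t + \<kappa>\<^sup>2 * mass t)"
proof -
  let ?X = "flux t" and ?k = "\<eta> t + 2 * \<kappa>"
  let ?v = "\<lambda>x. ut x t + (- ?k) * u x t"
  let ?g = "\<lambda>x. - (\<kappa>\<^sup>2) * (\<bar>u x t\<bar> powr p * weight x)"
  note X = vector_field_flux[OF t]
  have v: "C1_fun ?v" by (intro C1_add C1_ut C1_scale C1_u t)
  have g: "continuous_on UNIV ?g"
    by (intro continuous_on_mult[OF continuous_on_const] continuous_mass_density t)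
  have le: "?g x \<le> ?v x * divf x t" for x
  proof (cases "u x t = 0")
    case True
    then have "?v x = w x t" by (simp add: w_def)
    then show ?thesis using w_mult_divf_nonneg[OF t True] True p_gt_1 by simp
  next
    case False
    define q where "q = weight x * abs_powr (u x t) (p - 2)"
    have q: "0 \<le> q" using weight_pos[of x] by (simp add: q_def abs_powr_def)
    have d: "divf x t = q * w x t"
      unfolding equation[OF t disjI2[OF False]] by (simp add: q_def weight_def)
    have "?v x = w x t - 2 * \<kappa> * u x t" by (simp add: w_def algebra_simps)
    then have "?v x * divf x t + \<kappa>\<^sup>2 * (q * (u x t)\<^sup>2) = q * (w x t - \<kappa> * u x t)\<^sup>2"
      unfolding d by (simp add: power2_eq_square algebra_simps)
    then have "0 \<le> ?v x * divf x t + \<kappa>\<^sup>2 * (q * (u x t)\<^sup>2)" using q by simp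
    moreover have "q * (u x t)\<^sup>2 = \<bar>u x t\<bar> powr p * weight x"
      using abs_powr_mult_sq[OF False] by (simp add: q_def mult.assoc mult.commute)
    ultimately show ?thesis by simp
  qed
  have "(LINT x|vol. ?g x + deriv_along ?X ?v x) \<le> 0"
    by (rule divergence_inequality[OF X has_div_flux[OF t] v g le])
  moreover have "deriv_along ?X ?v x = deriv_along ?X (\<lambda>z. ut z t) x + (- ?k) * deriv_along ?X (\<lambda>z. u z t) x" for x
    unfolding deriv_along_add[OF X C1_ut[OF t] C1_scale[OF C1_u[OF t]]] deriv_along_scale[OF X C1_u[OF t]] ..
  ultimately have "(LINT x|vol. ?g x + (deriv_along ?X (\<lambda>z. ut z t) x + (- ?k) * deriv_along ?X (\<lambda>z. u z t) x)) \<le> 0"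
    by simp
  moreover have "(LINT x|vol. ?g x + (deriv_along ?X (\<lambda>z. ut z t) x + (- ?k) * deriv_along ?X (\<lambda>z. u z t) x))
      = - (\<kappa>\<^sup>2) * mass t + ((LINT x|vol. deriv_along ?X (\<lambda>z. ut z t) x) + (- ?k) * energy t)"
    unfolding mass_def energy_def
    by (simp only: Bochner_Integration.integral_add Bochner_Integration.integrable_add integral_mult_right_zero
        integrable_mult_right integrable_vol_continuous continuous_mass_density[OF t] continuous_energy_densities[OF t])
  ultimately have "(LINT x|vol. deriv_along ?X (\<lambda>z. ut z t) x) \<le> ?k * energy t + \<kappa>\<^sup>2 * mass t"
    by (simp add: algebra_simps)
  then have "p * (LINT x|vol. deriv_along ?X (\<lambda>z. ut z t) x) \<le> p * (?k * energy t + \<kappa>\<^sup>2 * mass t)"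
    using p_gt_1 by (intro mult_left_mono) auto
  then show ?thesis by (simp add: energy_deriv_def)
qed

text \<open>
  Nonempty open sets have positive volume.
\<close>

lemma mass_pos:
  assumes t: "t \<in> T" and x: "u x t \<noteq> 0"
  shows "0 < mass t"
proof -
  have nn: "0 \<le> \<bar>u x t\<bar> powr p * weight x" for x using weight_pos[of x] by simp
  have int: "integrable vol (\<lambda>x. \<bar>u x t\<bar> powr p * weight x)"
    by (rule integrable_vol_continuous[OF continuous_mass_density[OF t]])
  have "mass t \<noteq> 0"
  proof
    assume "mass t = 0"
    then have "AE x in vol. \<bar>u x t\<bar> powr p * weight x = 0"
      unfolding mass_def using integral_nonneg_eq_0_iff_AE[OF int] nn by simp
    then have ae: "AE x in vol. x \<notin> {x. u x t \<noteq> 0}"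
      by eventually_elim (use weight_pos in \<open>simp add: less_imp_neq[THEN not_sym]\<close>)
    have op: "open {x. u x t \<noteq> 0}"
      by (rule open_Collect_neq) (intro continuous_intros continuous_u t)+
    then have "{x. u x t \<noteq> 0} \<in> null_sets vol"
      using ae by (subst AE_iff_null_sets) auto
    then show False using emeasure_vol_open_pos[OF op] x by auto
  qed
  moreover have "0 \<le> mass t" unfolding mass_def by (rule Bochner_Integration.integral_nonneg) (rule nn)
  ultimately show ?thesis by simp
qed

theorem mass_lower_bound:
  assumes "u x a \<noteq> 0"
  shows "I_p A G f p u b \<ge>
           I_p A G f p u a * exp (p * integral {a..b} \<eta> + p * U_p A G f p u a * (b - a))"
proof -
  have aT: "a \<in> T" and bT: "b \<in> T" using ab by auto
  have "mass a * exp (p * integral {a..b} \<eta> - p * (energy a / mass a) * (b - a)) \<le> mass b"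
  proof (rule ode_comparison[OF ab _ smooth_on_imp_continuous_on[OF eta_smooth] mass_has_derivative energy_has_derivative])
    fix t assume t: "t \<in> T" and m: "0 < mass t"
    \<comment> \<open>The parameter \<open>\<kappa> = - energy t / mass t\<close> makes the bound as small as possible.\<close>
    have "energy_deriv t \<le> p * ((\<eta> t + 2 * (- (energy t / mass t))) * energy t + (- (energy t / mass t))\<^sup>2 * mass t)"
      by (rule energy_deriv_le[OF t])
    also have "\<dots> = p * (\<eta> t * energy t - (energy t)\<^sup>2 / mass t)"
      using m by (simp add: power2_eq_square field_simps)
    finally show "energy_deriv t \<le> p * (\<eta> t * energy t - (energy t)\<^sup>2 / mass t)" .
  qed (use p_gt_1 mass_pos[OF aT assms] in auto)
  then show ?thesis
    by (simp add: U_p_def I_p_eq_mass[OF aT] I_p_eq_mass[OF bT] D_p_eq_energy[OF aT])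
qed

end

theorem corollary3p2:
  fixes A :: "('a::{t2_space, second_countable_topology}, 'n::finite) chart set"
    and G :: "('a, 'n) chart \<Rightarrow> 'a \<Rightarrow> real ^ 'n ^ 'n"
    and f :: "'a \<Rightarrow> real"
    and p a b :: real
    and u :: "'a \<Rightarrow> real \<Rightarrow> real"
    and \<eta> :: "real \<Rightarrow> real"
  assumes "closed_riemannian_manifold A G"
    and "smooth_fun A f"
    and "1 < p"
    and "a < b"
    and "smooth_fun_time A {a..b} u"
    and "\<exists>x. u x a \<noteq> 0"
    and "smooth_on {a..b} \<eta>"
    and "solves_p_equation A G f p \<eta> a b u"
  shows "I_p A G f p u b \<ge>
           I_p A G f p u a * exp (p * integral {a..b} \<eta> + p * U_p A G f p u a * (b - a))"
proof -
  interpret closed_riemannian_manifold A G by fact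
  interpret p_flow A G f p a b u \<eta> by unfold_locales fact+
  show ?thesis using mass_lower_bound assms(6) by blast
qed

end
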